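(* Let $d=2^n$. There is a learning algorithm without quantum memory (for channels) that uses $T=\mathcal{O}(2^n)$ applications of an unknown $n$-qubit channel $\mathcal{C}$ and, with probability at least $2/3$, correctly determines whether $\mathcal{C}$ is $\rho\mapsto U\rho U^\dagger$ for a fixed Haar-random $U\in U(d)$, $\rho\mapsto O\rho O^t$ for a fixed Haar-random $O\in O(d)$, or $\rho\mapsto S\rho S^\dagger$ for a fixed Haar-random $S\in\mathrm{Sp}(d/2)$.
   Context: $U(d)$ is the unitary group, $O(d)=\{O\in U(d):O^t=O^{-1}\}$, and $\mathrm{Sp}(d/2)=\{S\in U(d): JS^tJ^{-1}=S^{-1}\}$ with $J=\begin{pmatrix}0&I_{d/2}\\-I_{d/2}&0\end{pmatrix}$, each with its Haar probability measure. A learning algorithm without quantum memory for an unknown $n$-qubit channel $\mathcal{C}$, using $T$ applications, proceeds in $T$ rounds, with an auxiliary register of an arbitrary number $n'\ge0$ of qubits: in each round it chooses (depending arbitrarily on all previously observed classical outcomes and internal randomness) a pure state $|\phi\rangle$ on $n+n'$ qubits and a POVM $\{F_s\}_s$ on $n+n'$ qubits, applies $\mathcal{C}$ to the first $n$ qubits, and observes outcome $s$ with probability $\mathrm{Tr}\big(F_s(\mathcal{C}\otimes\mathrm{id})(|\phi\rangle\langle\phi|)\big)$; no quantum state is retained between rounds. Its final output is an arbitrary function of the classical outcomes.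
   Formalization: The claim is stated for all sufficiently large n: at n = 1, Sp(1) = SU(2) and U(2) give identically distributed channels (and at n = 0, Sp(d/2) is undefined), so it cannot hold for every n. *)

theory Defs
  imports "HOL-Probability.Probability"
begin

text \<open>Square complex matrices of size d are represented as functions
  nat => nat => complex supported on {0..<d} x {0..<d}; vectors as nat => complex.
  The type nat => nat => complex carries the product topology, hence a Borel
  sigma algebra, which is used for the Haar measures.\<close>

type_synonym cmat = "nat \<Rightarrow> nat \<Rightarrow> complex"
type_synonym cvec = "nat \<Rightarrow> complex"

definition is_mat :: "nat \<Rightarrow> cmat \<Rightarrow> bool" where
  "is_mat d A \<longleftrightarrow> (\<forall>i j. (d \<le> i \<or> d \<le> j) \<longrightarrow> A i j = 0)"

definition mmul :: "nat \<Rightarrow> cmat \<Rightarrow> cmat \<Rightarrow> cmat" where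
  "mmul d A B = (\<lambda>i j. if i < d \<and> j < d then (\<Sum>k<d. A i k * B k j) else 0)"

definition madj :: "nat \<Rightarrow> cmat \<Rightarrow> cmat" where
  "madj d A = (\<lambda>i j. if i < d \<and> j < d then cnj (A j i) else 0)"

definition mtransp :: "nat \<Rightarrow> cmat \<Rightarrow> cmat" where
  "mtransp d A = (\<lambda>i j. if i < d \<and> j < d then A j i else 0)"

definition idm :: "nat \<Rightarrow> cmat" where
  "idm d = (\<lambda>i j. if i < d \<and> j = i then 1 else 0)"

definition mtrace :: "nat \<Rightarrow> cmat \<Rightarrow> complex" where
  "mtrace d A = (\<Sum>i<d. A i i)"

definition unitary_group :: "nat \<Rightarrow> cmat set" where
  "unitary_group d = {U. is_mat d U \<and> mmul d (madj d U) U = idm d \<and> mmul d U (madj d U) = idm d}"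

definition orthogonal_group :: "nat \<Rightarrow> cmat set" where
  "orthogonal_group d = {Q \<in> unitary_group d.
      mmul d (mtransp d Q) Q = idm d \<and> mmul d Q (mtransp d Q) = idm d}"

text \<open>J = [[0, I],[-I, 0]] (blocks of size d/2) and its inverse J^{-1} = [[0,-I],[I,0]].\<close>
definition Jmat :: "nat \<Rightarrow> cmat" where
  "Jmat d = (\<lambda>i j. if i < d div 2 \<and> j = i + d div 2 then 1
                   else if d div 2 \<le> i \<and> i < 2 * (d div 2) \<and> j + d div 2 = i then -1 else 0)"

definition Jinv :: "nat \<Rightarrow> cmat" where
  "Jinv d = (\<lambda>i j. - Jmat d i j)"

definition symplectic_group :: "nat \<Rightarrow> cmat set" where
  "symplectic_group d = {S \<in> unitary_group d.
      mmul d (mmul d (mmul d (Jmat d) (mtransp d S)) (Jinv d)) S = idm d}"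

definition is_haar_measure :: "nat \<Rightarrow> cmat set \<Rightarrow> cmat measure \<Rightarrow> bool" where
  "is_haar_measure d G M \<longleftrightarrow>
     prob_space M \<and> space M = G \<and> sets M = sets (restrict_space borel G) \<and>
     (\<forall>g\<in>G. \<forall>A\<in>sets M. (\<lambda>x. mmul d g x) -` A \<inter> G \<in> sets M \<and>
                         emeasure M ((\<lambda>x. mmul d g x) -` A \<inter> G) = emeasure M A)"

definition haar :: "nat \<Rightarrow> cmat set \<Rightarrow> cmat measure" where
  "haar d G = (THE M. is_haar_measure d G M)"

datatype group_class = UnitaryC | OrthogonalC | SymplecticC

definition class_group :: "group_class \<Rightarrow> nat \<Rightarrow> cmat set" where
  "class_group k d = (case k of UnitaryC \<Rightarrow> unitary_group d
                              | OrthogonalC \<Rightarrow> orthogonal_group d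
                              | SymplecticC \<Rightarrow> symplectic_group d)"

definition class_channel :: "group_class \<Rightarrow> nat \<Rightarrow> cmat \<Rightarrow> (cmat \<Rightarrow> cmat)" where
  "class_channel k d M = (\<lambda>\<rho>. case k of
       UnitaryC \<Rightarrow> mmul d (mmul d M \<rho>) (madj d M)
     | OrthogonalC \<Rightarrow> mmul d (mmul d M \<rho>) (mtransp d M)
     | SymplecticC \<Rightarrow> mmul d (mmul d M \<rho>) (madj d M))"

text \<open>(C \<otimes> id_m)(rho) for a map C on d x d matrices; the system index is the
  high-order part (i div m), the auxiliary index the low-order part (i mod m).\<close>
definition ext_id :: "nat \<Rightarrow> nat \<Rightarrow> (cmat \<Rightarrow> cmat) \<Rightarrow> cmat \<Rightarrow> cmat" where
  "ext_id d m C \<rho> = (\<lambda>i j. if i < d * m \<and> j < d * m then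
      C (\<lambda>a b. if a < d \<and> b < d then \<rho> (a * m + i mod m) (b * m + j mod m) else 0)
        (i div m) (j div m) else 0)"

definition proj :: "nat \<Rightarrow> cvec \<Rightarrow> cmat" where
  "proj D \<phi> = (\<lambda>i j. if i < D \<and> j < D then \<phi> i * cnj (\<phi> j) else 0)"

definition psd :: "nat \<Rightarrow> cmat \<Rightarrow> bool" where
  "psd D F \<longleftrightarrow> is_mat D F \<and> (\<forall>i j. F i j = cnj (F j i)) \<and>
     (\<forall>v. 0 \<le> Re (\<Sum>i<D. \<Sum>j<D. cnj (v i) * F i j * v j))"

text \<open>A learning algorithm without quantum memory. Internal randomness: a seed r
  drawn from seed; in each round, given seed r and the list h of previous outcomes,
  it chooses n' = aux r h auxiliary qubits, a pure state inp r h on n+n' qubits and a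
  finite POVM povm r h (outcome s = index in the list); the final answer is answer r h.\<close>
record learner =
  seed :: "nat pmf"
  aux :: "nat \<Rightarrow> nat list \<Rightarrow> nat"
  inp :: "nat \<Rightarrow> nat list \<Rightarrow> cvec"
  povm :: "nat \<Rightarrow> nat list \<Rightarrow> cmat list"
  answer :: "nat \<Rightarrow> nat list \<Rightarrow> group_class"

definition valid_learner :: "nat \<Rightarrow> learner \<Rightarrow> bool" where
  "valid_learner n L \<longleftrightarrow> (\<forall>r h. let D = 2 ^ (n + aux L r h); \<phi> = inp L r h; Fs = povm L r h in
      (\<forall>i\<ge>D. \<phi> i = 0) \<and> (\<Sum>i<D. (cmod (\<phi> i))\<^sup>2) = 1 \<and>
      (\<forall>F\<in>set Fs. psd D F) \<and>
      (\<forall>i j. (\<Sum>s<length Fs. (Fs ! s) i j) = idm D i j))"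

definition round_prob :: "nat \<Rightarrow> (cmat \<Rightarrow> cmat) \<Rightarrow> learner \<Rightarrow> nat \<Rightarrow> nat list \<Rightarrow> nat \<Rightarrow> real" where
  "round_prob n C L r h s = (let m = 2 ^ aux L r h; D = 2 ^ n * m in
     Re (mtrace D (mmul D ((povm L r h) ! s) (ext_id (2 ^ n) m C (proj D (inp L r h))))))"

fun succ :: "nat \<Rightarrow> (cmat \<Rightarrow> cmat) \<Rightarrow> learner \<Rightarrow> group_class \<Rightarrow> nat \<Rightarrow> nat \<Rightarrow> nat list \<Rightarrow> real" where
  "succ n C L k r 0 h = (if answer L r h = k then 1 else 0)"
| "succ n C L k r (Suc t) h =
     (\<Sum>s<length (povm L r h). round_prob n C L r h s * succ n C L k r t (h @ [s]))"

definition success_prob :: "nat \<Rightarrow> (cmat \<Rightarrow> cmat) \<Rightarrow> learner \<Rightarrow> group_class \<Rightarrow> nat \<Rightarrow> real" where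
  "success_prob n C L k T = measure_pmf.expectation (seed L) (\<lambda>r. succ n C L k r T [])"

end

theory Submission
  imports Defs "HOL-Real_Asymp.Real_Asymp"
begin

text \<open>Every measurement is made in the computational basis on a basis state, so that a round with
  input \<open>e\<^sub>c\<close> samples from the weights \<open>|M\<^sub>i\<^sub>c|\<^sup>2\<close> of column c of the unknown matrix M. Two samples from
  column 0 collide with probability about \<open>3/d\<close> if M is orthogonal and about \<open>2/d\<close> if M is unitary or
  symplectic, because the fourth moment of a real Gaussian is 3 and that of a complex one is 2. With
  \<open>h = d/2\<close>, symplecticity forces \<open>|M\<^sub>i\<^sub>0| = |M\<^sub>\<sigma>\<^sub>(\<^sub>i\<^sub>)\<^sub>,\<^sub>h|\<close> for the swap \<open>\<sigma>\<close> of the two halves, so a sample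
  from column 0 and one from column h are \<open>\<sigma>\<close>-partners with probability about \<open>2/d\<close>, against \<open>1/d\<close> in
  the unitary case. Counting such events in \<open>100 d\<close> independent blocks of two rounds each separates
  the three cases by Chebyshev's inequality.

  The required moments only use invariance under 45 degree rotations in two coordinates (together with
  their symplectic partners) and under transpositions: averaging over these relates monomials in the
  weights, and the relation that the weights sum to 1 fixes the constants.

  The Haar measure is a cluster point of normalised covering numbers, which are invariant under
  isometries and additive on separated sets, made countably additive by Caratheodory's construction.\<close>

section \<open>Invariant measures for compact groups of isometries\<close>

text \<open>\<open>haar\<close> is a definite description, so nothing can be said about it before
  existence and uniqueness of an invariant probability measure are known; this accounts for the
  measure theory.

  A rotation of two coordinates alone is not symplectic: it drags the two partner coordinates along,
  so a rotor exists only for coordinates that are neither equal nor partners. The moment identities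
  therefore sum over such pairs, and the pairs left out (2 d of d^2) are bounded by AM-GM. This
  costs a relative error of order 1/d, hence the restriction to large n; in exchange, one family of
  rotors serves all three groups.

  M is drawn once and reused in every round, so the collision probability is itself random and its
  mean is not enough. Its second moment must match the squared mean to leading order, which brings
  in moments of degree four in the weights. Sampling noise is a separate matter: the counts that
  decide the answer have means near 100 times 3, 2 or 1 and standard deviations of at most about 17,
  against gaps of 100.\<close>

lemma compact_PiE_UNIV:
  fixes K :: "'i \<Rightarrow> 'a::topological_space set"
  assumes "\<And>i. compact (K i)"
  shows "compact {f. \<forall>i. f i \<in> K i}"
proof -
  have "compactin (product_topology (\<lambda>_::'i. euclidean) UNIV) (PiE UNIV K)"
    using assms by (simp add: compactin_PiE)
  moreover have "PiE UNIV K = {f. \<forall>i. f i \<in> K i}"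
    by auto
  ultimately show ?thesis
    by (simp add: euclidean_product_topology)
qed

text \<open>A distance function rather than a metric type: on \<open>cmat\<close> the Frobenius
  distance sees only the entries below d, so it separates points only within X. Continuity of
  \<delta> makes its balls open, which ties it to the given topology.\<close>

locale compact_isometries =
  fixes X :: "'a::topological_space set" and \<delta> :: "'a \<Rightarrow> 'a \<Rightarrow> real" and \<Gamma> :: "('a \<Rightarrow> 'a) set"
  assumes compact_X: "compact X" and X_nonempty: "X \<noteq> {}"
    and refl: "\<And>x. \<delta> x x = 0" and sym: "\<And>x y. \<delta> x y = \<delta> y x"
    and triangle: "\<And>x y z. \<delta> x z \<le> \<delta> x y + \<delta> y z"
    and cont: "\<And>x. continuous_on UNIV (\<delta> x)"
    and sep: "\<And>x y. x \<in> X \<Longrightarrow> y \<in> X \<Longrightarrow> \<delta> x y = 0 \<Longrightarrow> x = y"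
    and maps: "\<And>g x. g \<in> \<Gamma> \<Longrightarrow> x \<in> X \<Longrightarrow> g x \<in> X"
    and isometry: "\<And>g x y. g \<in> \<Gamma> \<Longrightarrow> x \<in> X \<Longrightarrow> y \<in> X \<Longrightarrow> \<delta> (g x) (g y) = \<delta> x y"
    and cont_map: "\<And>g. g \<in> \<Gamma> \<Longrightarrow> continuous_on UNIV g"
    and inverse: "\<And>g. g \<in> \<Gamma> \<Longrightarrow> \<exists>g'\<in>\<Gamma>. \<forall>x\<in>X. g' (g x) = x \<and> g (g' x) = x"
begin

lemma nonneg: "0 \<le> \<delta> x y"
  using triangle[of x x y] refl[of x] sym[of x y] by simp

lemma open_ball: "open {y. \<delta> x y < e}"
  by (intro open_Collect_less cont continuous_on_const)

section \<open>Covering numbers\<close>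

definition covers :: "real \<Rightarrow> 'a set \<Rightarrow> 'a set \<Rightarrow> bool" where
  "covers e E C \<longleftrightarrow> finite C \<and> C \<subseteq> X \<and> (\<forall>y\<in>E. \<exists>c\<in>C. \<delta> c y < e)"

definition cov_num :: "real \<Rightarrow> 'a set \<Rightarrow> nat" where
  "cov_num e E = (LEAST k. \<exists>C. covers e E C \<and> card C = k)"

lemma cov_num_le: "covers e E C \<Longrightarrow> cov_num e E \<le> card C"
  unfolding cov_num_def by (rule Least_le) blast

lemma covers_exists:
  assumes "e > 0" "E \<subseteq> X"
  shows "\<exists>C. covers e E C"
proof -
  have "X \<subseteq> (\<Union>c\<in>X. {y. \<delta> c y < e})"
  proof
    fix y assume "y \<in> X"
    then show "y \<in> (\<Union>c\<in>X. {y. \<delta> c y < e})"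
      using refl[of y] \<open>e > 0\<close> by (auto intro!: bexI[of _ y])
  qed
  then obtain C where "C \<subseteq> X" "finite C" "X \<subseteq> (\<Union>c\<in>C. {y. \<delta> c y < e})"
    using compactE_image[OF compact_X, of X "\<lambda>c. {y. \<delta> c y < e}"] open_ball by blast
  moreover from this(3) have "\<forall>y\<in>E. \<exists>c\<in>C. \<delta> c y < e"
    using assms(2) by auto
  ultimately show ?thesis
    unfolding covers_def by metis
qed

lemma cov_num_attained:
  assumes "e > 0" "E \<subseteq> X"
  obtains C where "covers e E C" "card C = cov_num e E"
proof -
  have "\<exists>k C. covers e E C \<and> card C = k"
    using covers_exists[OF assms] by blast
  from LeastI_ex[OF this] show ?thesis
    using that unfolding cov_num_def by blast
qed

lemma cov_num_mono:
  assumes "e > 0" "E \<subseteq> F" "F \<subseteq> X"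
  shows "cov_num e E \<le> cov_num e F"
proof -
  obtain C where C: "covers e F C" "card C = cov_num e F"
    using cov_num_attained[OF assms(1,3)] .
  then have "covers e E C"
    using assms(2) unfolding covers_def by blast
  then show ?thesis
    using cov_num_le C(2) by metis
qed

lemma cov_num_Un:
  assumes "e > 0" "E \<subseteq> X" "F \<subseteq> X"
  shows "cov_num e (E \<union> F) \<le> cov_num e E + cov_num e F"
proof -
  obtain C where C: "covers e E C" "card C = cov_num e E"
    using cov_num_attained[OF assms(1,2)] .
  obtain D where D: "covers e F D" "card D = cov_num e F"
    using cov_num_attained[OF assms(1,3)] .
  have "covers e (E \<union> F) (C \<union> D)"
    using C(1) D(1) unfolding covers_def by blast
  then have "cov_num e (E \<union> F) \<le> card (C \<union> D)"
    by (rule cov_num_le)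
  also have "\<dots> \<le> card C + card D"
    by (rule card_Un_le)
  finally show ?thesis
    using C D by simp
qed

text \<open>A ball of radius e cannot meet both sets, since their points are at least 2 e apart; an
  optimal cover of the union splits into disjoint covers of E and of F.\<close>

lemma cov_num_separated:
  assumes "e > 0" "E \<subseteq> X" "F \<subseteq> X" and far: "\<And>x y. x \<in> E \<Longrightarrow> y \<in> F \<Longrightarrow> 2 * e \<le> \<delta> x y"
  shows "cov_num e E + cov_num e F \<le> cov_num e (E \<union> F)"
proof -
  obtain C where C: "covers e (E \<union> F) C" "card C = cov_num e (E \<union> F)"
    using cov_num_attained[of e "E \<union> F"] assms by blast
  define C1 where "C1 = {c\<in>C. \<exists>y\<in>E. \<delta> c y < e}"
  define C2 where "C2 = {c\<in>C. \<exists>y\<in>F. \<delta> c y < e}"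
  have fin: "finite C" "finite C1" "finite C2"
    using C(1) unfolding covers_def C1_def C2_def by auto
  have "C1 \<inter> C2 = {}"
  proof -
    have False if "c \<in> C" "x \<in> E" "\<delta> c x < e" "y \<in> F" "\<delta> c y < e" for c x y
      using far[OF that(2,4)] triangle[of x y c] sym[of x c] that by linarith
    then show ?thesis
      unfolding C1_def C2_def by blast
  qed
  then have "card C1 + card C2 = card (C1 \<union> C2)"
    using fin by (simp add: card_Un_disjoint)
  also have "\<dots> \<le> card C"
    using fin by (intro card_mono) (auto simp: C1_def C2_def)
  finally have "card C1 + card C2 \<le> cov_num e (E \<union> F)"
    using C by simp
  moreover have "covers e E C1" "covers e F C2"
    using C(1) unfolding covers_def C1_def C2_def by (simp_all add: subset_iff) blast+
  ultimately show ?thesis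
    using cov_num_le[of e E C1] cov_num_le[of e F C2] by linarith
qed

text \<open>Images of covers are covers because the centres lie in X, where g is isometric. An
  inequality is enough: the inverse maps in \<Gamma> restore equality in
  \<open>outer_preimage\<close>.\<close>

lemma cov_num_image:
  assumes "e > 0" "E \<subseteq> X" "g \<in> \<Gamma>"
  shows "cov_num e (g ` E) \<le> cov_num e E"
proof -
  obtain C where C: "covers e E C" "card C = cov_num e E"
    using cov_num_attained[OF assms(1,2)] .
  have "covers e (g ` E) (g ` C)"
    using C(1) maps[OF assms(3)] isometry[OF assms(3)] assms(2)
    unfolding covers_def by (force simp: subset_iff)
  then have "cov_num e (g ` E) \<le> card (g ` C)"
    by (rule cov_num_le)
  also have "\<dots> \<le> card C"
    using C(1) unfolding covers_def by (intro card_image_le) simp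
  finally show ?thesis
    using C by simp
qed

lemma cov_num_X_pos: "e > 0 \<Longrightarrow> 0 < cov_num e X"
  using cov_num_attained[of e X "0 < cov_num e X"] X_nonempty unfolding covers_def
  by (metis card_gt_0_iff ex_in_conv order_refl)

lemma cov_num_empty: "cov_num e {} = 0"
  using cov_num_le[of e "{}" "{}"] by (simp add: covers_def)

text \<open>The limit of the covering-number ratios need not exist along scales tending to 0; a cluster
  point in the compact product of unit intervals inherits every closed condition that holds
  eventually.\<close>

definition ratio :: "nat \<Rightarrow> 'a set \<Rightarrow> real" where
  "ratio n E = real (cov_num (1 / Suc n) (E \<inter> X)) / real (cov_num (1 / Suc n) X)"

lemma ratio_cluster_point:
  obtains \<nu> :: "'a set \<Rightarrow> real"
  where "\<And>P. closed P \<Longrightarrow> eventually (\<lambda>n. ratio n \<in> P) sequentially \<Longrightarrow> \<nu> \<in> P"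
proof -
  have le: "cov_num (1 / Suc n) (E \<inter> X) \<le> cov_num (1 / Suc n) X" for n E
    by (intro cov_num_mono) auto
  have "ratio n E \<in> {0..1}" for n E
    using le[of n E] cov_num_X_pos[of "1 / Suc n"] by (simp add: ratio_def divide_le_eq_1)
  then have ev: "eventually (\<lambda>f. f \<in> {f. \<forall>E. f E \<in> {0..1::real}}) (filtermap ratio sequentially)"
    by (simp add: eventually_filtermap)
  have "compact {f :: 'a set \<Rightarrow> real. \<forall>E. f E \<in> {0..1}}"
    by (rule compact_PiE_UNIV) simp
  moreover have "filtermap ratio sequentially \<noteq> bot"
    by (simp add: filtermap_bot_iff)
  ultimately obtain \<nu> where l: "inf (nhds \<nu>) (filtermap ratio sequentially) \<noteq> bot"
    using ev unfolding compact_filter by blast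
  show thesis
  proof (rule that[of \<nu>], rule ccontr)
    fix P assume P: "closed P" "eventually (\<lambda>n. ratio n \<in> P) sequentially" "\<nu> \<notin> P"
    have "eventually (\<lambda>f. f \<in> - P) (nhds \<nu>)"
      using P by (intro eventually_nhds_in_open) auto
    moreover have "eventually (\<lambda>f. f \<in> P) (filtermap ratio sequentially)"
      using P by (simp add: eventually_filtermap)
    ultimately have "eventually (\<lambda>f. False) (inf (nhds \<nu>) (filtermap ratio sequentially))"
      unfolding eventually_inf by blast
    then show False
      using l by (simp add: eventually_False)
  qed
qed

text \<open>Each property is a weak inequality or an equation between values at finitely many sets,
  hence closed in the product topology. Superadditivity on separated sets holds for
  \<open>ratio n\<close> only once 2 / (n + 1) < \<eta>; this is where eventual validity
  matters.\<close>

lemma invariant_content_exists: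
  obtains \<nu> :: "'a set \<Rightarrow> real"
  where "\<And>E. 0 \<le> \<nu> E" "\<nu> UNIV = 1" "\<nu> {} = 0" "\<And>E F. E \<subseteq> F \<Longrightarrow> \<nu> E \<le> \<nu> F"
    "\<And>E. \<nu> (E \<inter> X) = \<nu> E"
    "\<And>E F. \<nu> (E \<union> F) \<le> \<nu> E + \<nu> F"
    "\<And>E F \<eta>. \<eta> > 0 \<Longrightarrow> (\<And>x y. x \<in> E \<inter> X \<Longrightarrow> y \<in> F \<inter> X \<Longrightarrow> \<eta> \<le> \<delta> x y) \<Longrightarrow> \<nu> E + \<nu> F \<le> \<nu> (E \<union> F)"
    "\<And>g E. g \<in> \<Gamma> \<Longrightarrow> \<nu> (g ` (E \<inter> X)) \<le> \<nu> E"
proof -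
  obtain \<nu> where cl: "\<And>P. closed P \<Longrightarrow> eventually (\<lambda>n. ratio n \<in> P) sequentially \<Longrightarrow> \<nu> \<in> P"
    using ratio_cluster_point by blast
  have c: "continuous_on UNIV (\<lambda>f :: 'a set \<Rightarrow> real. f E)" for E
    by simp
  have pos: "0 < real (cov_num (1 / Suc n) X)" for n
    using cov_num_X_pos[of "1 / Suc n"] by simp
  have le: "\<nu> E \<le> \<nu> F" if "\<And>n. ratio n E \<le> ratio n F" for E F
    using cl[of "{f. f E \<le> f F}"] that by (simp add: closed_Collect_le)
  show thesis
  proof (rule that[of \<nu>])
    show "0 \<le> \<nu> E" for E
      using cl[of "{f. 0 \<le> f E}"] by (simp add: closed_Collect_le ratio_def)
    show "\<nu> UNIV = 1"
      using cl[of "{f. f UNIV = 1}"] pos by (simp add: closed_Collect_eq ratio_def)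
    show "\<nu> {} = 0"
      using cl[of "{f. f {} = 0}"] by (simp add: closed_Collect_eq ratio_def cov_num_empty)
    show "\<nu> E \<le> \<nu> F" if "E \<subseteq> F" for E F
      using that by (intro le) (auto simp: ratio_def intro!: divide_right_mono cov_num_mono)
    show "\<nu> (E \<inter> X) = \<nu> E" for E
      by (intro antisym le) (simp_all add: ratio_def Int_assoc)
    show "\<nu> (E \<union> F) \<le> \<nu> E + \<nu> F" for E F
    proof -
      have "ratio n (E \<union> F) \<le> ratio n E + ratio n F" for n
        using cov_num_Un[of "1 / Suc n" "E \<inter> X" "F \<inter> X"] pos[of n]
        by (simp add: ratio_def add_divide_distrib[symmetric] divide_right_mono Int_Un_distrib2 flip: of_nat_add)
      then show ?thesis
        using cl[of "{f. f (E \<union> F) \<le> f E + f F}"] by (simp add: closed_Collect_le continuous_on_add)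
    qed
    show "\<nu> E + \<nu> F \<le> \<nu> (E \<union> F)"
      if eta: "\<eta> > 0" and far: "\<And>x y. x \<in> E \<inter> X \<Longrightarrow> y \<in> F \<inter> X \<Longrightarrow> \<eta> \<le> \<delta> x y" for E F \<eta>
    proof -
      have "eventually (\<lambda>n. 2 * (1 / real (Suc n)) < \<eta>) sequentially"
        using eta by real_asymp
      then have "eventually (\<lambda>n. ratio n E + ratio n F \<le> ratio n (E \<union> F)) sequentially"
      proof eventually_elim
        case (elim n)
        have "2 * (1 / real (Suc n)) \<le> \<delta> x y" if "x \<in> E \<inter> X" "y \<in> F \<inter> X" for x y
          using far[OF that] elim by linarith
        then have "cov_num (1 / Suc n) (E \<inter> X) + cov_num (1 / Suc n) (F \<inter> X)
            \<le> cov_num (1 / Suc n) ((E \<inter> X) \<union> (F \<inter> X))"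
          by (intro cov_num_separated) auto
        then show ?case
          by (simp add: ratio_def add_divide_distrib[symmetric] divide_right_mono Int_Un_distrib2 flip: of_nat_add)
      qed
      then show ?thesis
        using cl[of "{f. f E + f F \<le> f (E \<union> F)}"] by (simp add: closed_Collect_le continuous_on_add)
    qed
    show "\<nu> (g ` (E \<inter> X)) \<le> \<nu> E" if "g \<in> \<Gamma>" for g E
    proof (rule le)
      fix n
      have "g ` (E \<inter> X) \<inter> X = g ` (E \<inter> X)"
        using maps[OF that] by auto
      then show "ratio n (g ` (E \<inter> X)) \<le> ratio n E"
        using cov_num_image[of "1 / Suc n" "E \<inter> X" g] that
        by (simp add: ratio_def divide_right_mono)
    qed
  qed
qed

section \<open>From a content to a countably additive measure\<close>

context
  fixes \<nu> :: "'a set \<Rightarrow> real"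
  assumes content_nonneg: "\<And>E. 0 \<le> \<nu> E" and content_UNIV: "\<nu> UNIV = 1" and content_empty: "\<nu> {} = 0"
    and content_mono: "\<And>E F. E \<subseteq> F \<Longrightarrow> \<nu> E \<le> \<nu> F"
    and content_Int: "\<And>E. \<nu> (E \<inter> X) = \<nu> E"
    and content_Un: "\<And>E F. \<nu> (E \<union> F) \<le> \<nu> E + \<nu> F"
    and content_separated: "\<And>E F \<eta>. \<eta> > 0 \<Longrightarrow>
      (\<And>x y. x \<in> E \<inter> X \<Longrightarrow> y \<in> F \<inter> X \<Longrightarrow> \<eta> \<le> \<delta> x y) \<Longrightarrow> \<nu> E + \<nu> F \<le> \<nu> (E \<union> F)"
    and content_image: "\<And>g E. g \<in> \<Gamma> \<Longrightarrow> \<nu> (g ` (E \<inter> X)) \<le> \<nu> E"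
begin

definition open_cover :: "'a set \<Rightarrow> (nat \<Rightarrow> 'a set) \<Rightarrow> bool" where
  "open_cover A U \<longleftrightarrow> (\<forall>i. open (U i)) \<and> A \<subseteq> (\<Union>i. U i)"

text \<open>Covering by open sets lets compactness reduce any cover of X to a finite one, so the
  total mass does not collapse, and preimages of covers under continuous maps are again
  covers.\<close>

definition outer :: "'a set \<Rightarrow> ennreal" where
  "outer A = (INF U\<in>{U. open_cover A U}. \<Sum>i. ennreal (\<nu> (U i)))"

lemma outer_le: "open_cover A U \<Longrightarrow> outer A \<le> (\<Sum>i. ennreal (\<nu> (U i)))"
  unfolding outer_def by (rule INF_lower) simp

lemma outer_close:
  assumes "outer A < e"
  obtains U where "open_cover A U" "(\<Sum>i. ennreal (\<nu> (U i))) < e"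
  using assms unfolding outer_def INF_less_iff by auto

lemma outer_mono: "A \<subseteq> B \<Longrightarrow> outer A \<le> outer B"
  unfolding outer_def by (rule INF_superset_mono) (simp_all add: open_cover_def Collect_mono_iff, blast)

lemma content_finite_UN: "finite I \<Longrightarrow> \<nu> (\<Union>i\<in>I. U i) \<le> (\<Sum>i\<in>I. \<nu> (U i))"
proof (induction I rule: finite_induct)
  case (insert i I)
  then show ?case
    using content_Un[of "U i" "\<Union>i\<in>I. U i"] by simp
qed (simp add: content_empty)

lemma outer_le_1: "outer A \<le> 1"
proof -
  define U where "U = (\<lambda>i::nat. if i = 0 then UNIV else {} :: 'a set)"
  have "open_cover A U"
    by (auto simp: open_cover_def U_def)
  then have "outer A \<le> (\<Sum>i. ennreal (\<nu> (U i)))"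
    by (rule outer_le)
  also have "\<dots> = (\<Sum>i\<in>{0}. ennreal (\<nu> (U i)))"
    by (rule suminf_finite) (auto simp: U_def content_empty)
  finally show ?thesis
    by (simp add: U_def content_UNIV)
qed

lemma outer_X: "outer X = 1"
proof (rule antisym[OF outer_le_1])
  show "1 \<le> outer X"
    unfolding outer_def
  proof (rule INF_greatest)
    fix U assume "U \<in> {U. open_cover X U}"
    then have U: "\<And>i. open (U i)" "X \<subseteq> (\<Union>i\<in>UNIV. U i)"
      by (auto simp: open_cover_def)
    then obtain I where I: "finite I" "X \<subseteq> (\<Union>i\<in>I. U i)"
      by (metis compactE_image[OF compact_X])
    have "1 = \<nu> X"
      using content_Int[of UNIV] content_UNIV by simp
    also have "\<dots> \<le> \<nu> (\<Union>i\<in>I. U i)"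
      using I by (intro content_mono)
    also have "\<dots> \<le> (\<Sum>i\<in>I. \<nu> (U i))"
      using I by (intro content_finite_UN)
    finally have "1 \<le> ennreal (\<Sum>i\<in>I. \<nu> (U i))"
      by (simp add: ennreal_leI flip: ennreal_1)
    also have "\<dots> = (\<Sum>i\<in>I. ennreal (\<nu> (U i)))"
      by (simp add: content_nonneg)
    also have "\<dots> \<le> (\<Sum>i. ennreal (\<nu> (U i)))"
      using I by (intro sum_le_suminf) auto
    finally show "1 \<le> (\<Sum>i. ennreal (\<nu> (U i)))" .
  qed
qed

lemma outer_empty: "outer {} = 0"
  using outer_le[of "{}" "\<lambda>_. {}"] by (simp add: open_cover_def content_empty)

lemma outer_UN: "outer (\<Union>i. A i) \<le> (\<Sum>n::nat. outer (A n))"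
proof (rule ennreal_le_epsilon)
  fix e :: real assume "0 < e" "(\<Sum>n. outer (A n)) < top"
  then have *: "outer (A n) < outer (A n) + e * (1/2)^Suc n" for n
    by (auto simp add: less_top dest!: ennreal_suminf_lessD)
  have "\<exists>U. open_cover (A n) U \<and> (\<Sum>i. ennreal (\<nu> (U i))) \<le> outer (A n) + e * (1/2)^Suc n" for n
    using outer_close[OF *[of n]] by (metis less_imp_le)
  then obtain B where B: "\<And>n. open_cover (A n) (B n)"
      and Ble: "\<And>n. (\<Sum>i. ennreal (\<nu> (B n i))) \<le> outer (A n) + e * (1/2)^Suc n"
    by metis
  define C where "C = case_prod B o prod_decode"
  have "open_cover (\<Union>i. A i) C"
    using B unfolding open_cover_def C_def
    by (auto simp add: split_def subset_eq) (metis fst_conv prod_encode_inverse snd_conv)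
  then have "outer (\<Union>i. A i) \<le> (\<Sum>i. ennreal (\<nu> (C i)))"
    by (rule outer_le)
  also have "\<dots> = (\<Sum>n. \<Sum>i. ennreal (\<nu> (B n i)))"
    unfolding C_def comp_def by (intro suminf_ennreal_2dimen) (auto simp: split_def)
  also have "\<dots> \<le> (\<Sum>n. outer (A n) + e * (1/2) ^ Suc n)"
    by (intro suminf_le allI Ble) auto
  also have "... = (\<Sum>n. outer (A n)) + (\<Sum>n. ennreal e * ennreal ((1/2) ^ Suc n))"
    using \<open>0 < e\<close> by (subst suminf_add[symmetric])
                     (auto simp del: ennreal_suminf_cmult simp add: ennreal_mult[symmetric])
  also have "\<dots> = (\<Sum>n. outer (A n)) + e"
    unfolding ennreal_suminf_cmult
    by (subst suminf_ennreal_eq[OF zero_le_power power_half_series]) auto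
  finally show "outer (\<Union>i. A i) \<le> (\<Sum>n. outer (A n)) + e" .
qed

lemma outer_measure_space_outer: "outer_measure_space (Pow X) outer"
  unfolding outer_measure_space_def positive_def increasing_def countably_subadditive_def
  using outer_empty outer_mono outer_UN by auto

lemma outer_Un: "outer (A \<union> B) \<le> outer A + outer B"
proof -
  have "outer (\<Union>i. binaryset A B i) \<le> (\<Sum>n. outer (binaryset A B n))"
    by (rule outer_UN)
  then show ?thesis
    using suminf_binaryset_eq[of outer A B] outer_empty by (simp add: UN_binaryset_eq)
qed

text \<open>A member of the cover may meet both A and B. Cutting it with the open neighbourhoods of
  radius \<eta>/3, which are still \<eta>/3 apart, keeps the pieces open and makes
  \<open>content_separated\<close> applicable to each member.\<close>

lemma outer_separated:
  assumes "\<eta> > 0" and far: "\<And>x y. x \<in> A \<Longrightarrow> y \<in> B \<Longrightarrow> \<eta> \<le> \<delta> x y"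
  shows "outer A + outer B \<le> outer (A \<union> B)"
  unfolding outer_def[of "A \<union> B"]
proof (rule INF_greatest)
  fix U assume "U \<in> {U. open_cover (A \<union> B) U}"
  then have U: "\<And>i. open (U i)" "A \<union> B \<subseteq> (\<Union>i. U i)"
    by (auto simp: open_cover_def)
  define nb where "nb S = (\<Union>a\<in>S. {y. \<delta> a y < \<eta> / 3})" for S
  have nb: "open (nb S)" "S \<subseteq> nb S" for S
    unfolding nb_def using \<open>\<eta> > 0\<close> refl
    by (auto intro!: open_UN open_ball simp del: less_divide_eq_numeral1)
  have sepa: "\<eta> / 3 \<le> \<delta> x y" if xy: "x \<in> nb A" "y \<in> nb B" for x y
  proof -
    obtain a b where "a \<in> A" "\<delta> a x < \<eta> / 3" "b \<in> B" "\<delta> b y < \<eta> / 3"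
      using xy unfolding nb_def by blast
    then show ?thesis
      using far[of a b] triangle[of a b x] triangle[of x b y] sym[of y b] by linarith
  qed
  have "outer A \<le> (\<Sum>i. ennreal (\<nu> (U i \<inter> nb A)))"
    using U nb[of A] by (intro outer_le) (auto simp: open_cover_def)
  moreover have "outer B \<le> (\<Sum>i. ennreal (\<nu> (U i \<inter> nb B)))"
    using U nb[of B] by (intro outer_le) (auto simp: open_cover_def)
  ultimately have "outer A + outer B \<le> (\<Sum>i. ennreal (\<nu> (U i \<inter> nb A)) + ennreal (\<nu> (U i \<inter> nb B)))"
    by (subst suminf_add[symmetric]) (auto intro: add_mono)
  also have "\<dots> \<le> (\<Sum>i. ennreal (\<nu> (U i)))"
  proof (intro suminf_le allI)
    fix i
    have "\<nu> (U i \<inter> nb A) + \<nu> (U i \<inter> nb B) \<le> \<nu> (U i \<inter> nb A \<union> U i \<inter> nb B)"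
      by (rule content_separated[of "\<eta> / 3"]) (use sepa \<open>\<eta> > 0\<close> in auto)
    also have "\<dots> \<le> \<nu> (U i)"
      by (rule content_mono) auto
    finally show "ennreal (\<nu> (U i \<inter> nb A)) + ennreal (\<nu> (U i \<inter> nb B)) \<le> ennreal (\<nu> (U i))"
      using content_nonneg by (simp add: ennreal_leI flip: ennreal_plus)
  qed auto
  finally show "outer A + outer B \<le> (\<Sum>i. ennreal (\<nu> (U i)))" .
qed

lemma outer_sum_separated:
  assumes "\<And>j k. j < k \<Longrightarrow> \<exists>\<eta>>0. \<forall>x\<in>R j. \<forall>y\<in>R k. \<eta> \<le> \<delta> x y"
  shows "(\<Sum>k<n::nat. outer (R k)) \<le> outer (\<Union>k<n. R k)"
proof (induction n)
  case (Suc n)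
  have "\<forall>j. \<exists>\<eta>. j < n \<longrightarrow> \<eta> > 0 \<and> (\<forall>x\<in>R j. \<forall>y\<in>R n. \<eta> \<le> \<delta> x y)"
    using assms by meson
  then obtain \<eta> where eta: "\<And>j. j < n \<Longrightarrow> \<eta> j > 0 \<and> (\<forall>x\<in>R j. \<forall>y\<in>R n. \<eta> j \<le> \<delta> x y)"
    by metis
  \<comment> \<open>The 1 keeps the set nonempty for n = 0.\<close>
  define \<epsilon> where "\<epsilon> = Min (insert 1 (\<eta> ` {..<n}))"
  have "\<epsilon> > 0"
    using eta unfolding \<epsilon>_def by (subst Min_gr_iff) auto
  moreover have "\<epsilon> \<le> \<eta> j" if "j < n" for j
    using that unfolding \<epsilon>_def by (intro Min_le) auto
  then have "\<epsilon> \<le> \<delta> x y" if "x \<in> (\<Union>k<n. R k)" "y \<in> R n" for x y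
    using that eta by fastforce
  ultimately have "outer (\<Union>k<n. R k) + outer (R n) \<le> outer ((\<Union>k<n. R k) \<union> R n)"
    by (rule outer_separated) auto
  moreover have "(\<Union>k<n. R k) \<union> R n = (\<Union>k<Suc n. R k)"
    by (auto simp: less_Suc_eq)
  ultimately show ?case
    using Suc.IH by simp (meson add_right_mono order_trans)
qed (simp add: outer_empty)

text \<open>Caratheodory's criterion for metric outer measures. \<open>D n\<close> is the part of A
  at distance at least 1 / (n + 1) from F and \<open>R n\<close> is the layer between
  \<open>D n\<close> and \<open>D (Suc n)\<close>. Layers of equal parity are separated from each
  other, so their outer measures sum to at most 1; the tail of the layers is then negligible and
  \<open>D n\<close> exhausts A - F in outer measure.\<close>

lemma outer_split_closed:
  assumes "closed F" "A \<subseteq> X"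
  shows "outer (A \<inter> F) + outer (A - F) \<le> outer A"
proof -
  define D where "D n = {y\<in>A. \<forall>z\<in>F \<inter> X. 1 / real (Suc n) \<le> \<delta> z y}" for n
  define R where "R n = D (Suc n) - D n" for n
  have D_Un: "\<exists>n. y \<in> D n" if "y \<in> A - F" for y
  proof (cases "F \<inter> X = {}")
    case True
    then show ?thesis
      using that by (auto simp: D_def)
  next
    case False
    have "compact (F \<inter> X)"
      using compact_X assms(1) by (simp add: closed_Int_compact)
    moreover have "continuous_on (F \<inter> X) (\<delta> y)"
      using cont continuous_on_subset by blast
    ultimately obtain z where z: "z \<in> F \<inter> X" "\<And>w. w \<in> F \<inter> X \<Longrightarrow> \<delta> y z \<le> \<delta> y w"
      using continuous_attains_inf[of "F \<inter> X" "\<delta> y"] False by blast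
    have "\<delta> y z \<noteq> 0"
      using sep[of y z] z(1) that assms(2) by auto
    then have "\<delta> y z > 0"
      using nonneg[of y z] by simp
    then obtain n where "1 / real (Suc n) < \<delta> y z"
      using nat_approx_posE by blast
    then have "1 / real (Suc n) \<le> \<delta> w y" if "w \<in> F \<inter> X" for w
      using z(2)[OF that] sym[of y w] by linarith
    then show ?thesis
      using that by (auto simp: D_def)
  qed
  have D_mono: "D n \<subseteq> D (Suc n)" for n
  proof
    fix y assume y: "y \<in> D n"
    have "1 / real (Suc (Suc n)) \<le> 1 / real (Suc n)"
      by (simp add: frac_le)
    then show "y \<in> D (Suc n)"
      using y unfolding D_def by (auto intro: order_trans)
  qed
  then have D_le: "D m \<subseteq> D n" if "m \<le> n" for m n
    using that by (rule lift_Suc_mono_le)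
  have split: "outer (A \<inter> F) + outer (D n) \<le> outer A" for n
  proof -
    have "outer (A \<inter> F) + outer (D n) \<le> outer ((A \<inter> F) \<union> D n)"
      by (rule outer_separated[of "1 / Suc n"]) (use assms(2) in \<open>auto simp: D_def\<close>)
    also have "\<dots> \<le> outer A"
      by (rule outer_mono) (auto simp: D_def)
    finally show ?thesis .
  qed
  \<comment> \<open>Points of \<open>R j\<close> are at least 1 / (j + 2) away from F, points of
    \<open>R k\<close> less than 1 / (k + 1). Adjacent layers have no such gap, hence the split by
    parity below.\<close>
  have far: "\<exists>\<eta>>0. \<forall>x\<in>R j. \<forall>y\<in>R k. \<eta> \<le> \<delta> x y" if "j + 2 \<le> k" for j k
  proof (intro exI[of _ "1 / real (j + 2) - 1 / real (j + 3)"] conjI ballI)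
    show "1 / real (j + 2) - 1 / real (j + 3) > 0"
      by (simp add: frac_less2)
    fix x y assume xy: "x \<in> R j" "y \<in> R k"
    from xy(2) obtain z where z: "z \<in> F \<inter> X" "\<delta> z y < 1 / real (Suc k)"
      by (auto simp: R_def D_def not_le)
    have "1 / real (Suc (Suc j)) \<le> \<delta> z x"
      using xy(1) z(1) by (auto simp: R_def D_def)
    moreover have "1 / real (Suc k) \<le> 1 / real (j + 3)"
      using that by (intro divide_left_mono) auto
    ultimately show "1 / real (j + 2) - 1 / real (j + 3) \<le> \<delta> x y"
      using z(2) triangle[of z x y] sym[of x y] by simp
  qed
  have even: "(\<Sum>k<n. outer (R (2 * k))) \<le> 1" for n
    using outer_sum_separated[of "\<lambda>k. R (2 * k)" n] far outer_le_1 order_trans by fastforce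
  have odd: "(\<Sum>k<n. outer (R (2 * k + 1))) \<le> 1" for n
    using outer_sum_separated[of "\<lambda>k. R (2 * k + 1)" n] far outer_le_1 order_trans by fastforce
  define r where "r k = enn2real (outer (R k))" for k
  have r: "ennreal (r k) = outer (R k)" for k
    using outer_le_1[of "R k"] unfolding r_def
    by (intro ennreal_enn2real) (metis ennreal_one_less_top le_less_trans)
  have r0: "0 \<le> r k" for k
    by (simp add: r_def)
  have "(\<Sum>k<n. r k) \<le> 2" for n
  proof -
    have "(\<Sum>k<n. r k) \<le> (\<Sum>k<2 * n. r k)"
      by (rule sum_mono2) (auto simp: r0)
    also have "\<dots> = (\<Sum>k<n. r (2 * k)) + (\<Sum>k<n. r (2 * k + 1))"
      by (induction n) auto
    also have "\<dots> \<le> 1 + 1"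
    proof (rule add_mono)
      have "ennreal (\<Sum>k<n. r (2 * k)) \<le> 1" "ennreal (\<Sum>k<n. r (2 * k + 1)) \<le> 1"
        using even[of n] odd[of n] by (simp_all add: r r0 flip: sum_ennreal)
      then show "(\<Sum>k<n. r (2 * k)) \<le> 1" "(\<Sum>k<n. r (2 * k + 1)) \<le> 1"
        by (simp_all flip: ennreal_1)
    qed
    finally show ?thesis by simp
  qed
  then have summ: "summable r"
    using r0 by (intro summableI_nonneg_bounded)
  have cover: "A - F \<subseteq> D n \<union> (\<Union>k. R (k + n))" for n
  proof
    fix y assume "y \<in> A - F"
    then obtain m where "y \<in> D m"
      using D_Un by blast
    then show "y \<in> D n \<union> (\<Union>k. R (k + n))"
    proof (induction m)
      case 0
      have "D 0 \<subseteq> D n"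
        by (rule D_le) simp
      with 0 show ?case by auto
    next
      case (Suc m)
      show ?case
      proof (cases "Suc m \<le> n")
        case True
        then have "D (Suc m) \<subseteq> D n"
          by (rule D_le)
        with Suc.prems show ?thesis by auto
      next
        case False
        show ?thesis
        proof (cases "y \<in> D m")
          case False
          then have "y \<in> R ((m - n) + n)"
            using Suc.prems \<open>\<not> Suc m \<le> n\<close> by (simp add: R_def)
          then show ?thesis by blast
        qed (use Suc.IH in auto)
      qed
    qed
  qed
  show ?thesis
  proof (rule ennreal_le_epsilon)
    fix e :: real assume "e > 0"
    obtain n where n: "norm (\<Sum>k. r (k + n)) < e"
      using suminf_exist_split[OF \<open>e > 0\<close> summ] by auto
    have "outer (A - F) \<le> outer (D n) + outer (\<Union>k. R (k + n))"
      using outer_mono[OF cover[of n]] outer_Un order_trans by blast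
    also have "\<dots> \<le> outer (D n) + (\<Sum>k. outer (R (k + n)))"
      by (intro add_left_mono outer_UN)
    also have "(\<Sum>k. outer (R (k + n))) = ennreal (\<Sum>k. r (k + n))"
      unfolding r[symmetric] using summ r0 by (intro suminf_ennreal2) auto
    also have "\<dots> \<le> ennreal e"
      using n by (intro ennreal_leI) auto
    finally have "outer (A - F) \<le> outer (D n) + e"
      by (simp add: add_left_mono)
    then have "outer (A \<inter> F) + outer (A - F) \<le> (outer (A \<inter> F) + outer (D n)) + e"
      by (metis add.assoc add_left_mono)
    also have "\<dots> \<le> outer A + e"
      by (intro add_right_mono split)
    finally show "outer (A \<inter> F) + outer (A - F) \<le> outer A + ennreal e" .
  qed
qed

text \<open>On X the preimage under g is an image under the inverse map, whose content
  \<open>content_image\<close> controls; taking preimages keeps the cover open.\<close>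

lemma outer_preimage_le:
  assumes "g \<in> \<Gamma>"
  shows "outer (g -` A \<inter> X) \<le> outer A"
  unfolding outer_def[of A]
proof (rule INF_greatest)
  fix U assume "U \<in> {U. open_cover A U}"
  then have U: "\<And>i. open (U i)" "A \<subseteq> (\<Union>i. U i)"
    by (auto simp: open_cover_def)
  obtain g' where g': "g' \<in> \<Gamma>" "\<And>x. x \<in> X \<Longrightarrow> g' (g x) = x" "\<And>x. x \<in> X \<Longrightarrow> g (g' x) = x"
    using inverse[OF assms] by blast
  have "open_cover (g -` A \<inter> X) (\<lambda>i. g -` U i)"
    unfolding open_cover_def using U(1) cont_map[OF assms] subsetD[OF U(2)]
    by (auto intro: open_vimage)
  then have "outer (g -` A \<inter> X) \<le> (\<Sum>i. ennreal (\<nu> (g -` U i)))"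
    by (rule outer_le)
  also have "\<dots> \<le> (\<Sum>i. ennreal (\<nu> (U i)))"
  proof (intro suminf_le allI ennreal_leI)
    fix i
    have "g -` U i \<inter> X \<subseteq> g' ` (U i \<inter> X)"
    proof
      fix x assume "x \<in> g -` U i \<inter> X"
      then show "x \<in> g' ` (U i \<inter> X)"
        using g'(2)[of x] maps[OF assms, of x] by (intro image_eqI[of _ _ "g x"]) auto
    qed
    then have "\<nu> (g -` U i) \<le> \<nu> (g' ` (U i \<inter> X))"
      using content_mono content_Int by metis
    also have "\<dots> \<le> \<nu> (U i)"
      by (rule content_image[OF g'(1)])
    finally show "\<nu> (g -` U i) \<le> \<nu> (U i)" .
  qed auto
  finally show "outer (g -` A \<inter> X) \<le> (\<Sum>i. ennreal (\<nu> (U i)))" .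
qed

lemma outer_preimage:
  assumes "g \<in> \<Gamma>" "A \<subseteq> X"
  shows "outer (g -` A \<inter> X) = outer A"
proof (rule antisym[OF outer_preimage_le[OF assms(1)]])
  obtain g' where g': "g' \<in> \<Gamma>" "\<And>x. x \<in> X \<Longrightarrow> g' (g x) = x" "\<And>x. x \<in> X \<Longrightarrow> g (g' x) = x"
    using inverse[OF assms(1)] by blast
  have "A = g' -` (g -` A \<inter> X) \<inter> X"
    using g'(3) maps[OF g'(1)] assms(2) by auto
  then show "outer A \<le> outer (g -` A \<inter> X)"
    using outer_preimage_le[OF g'(1), of "g -` A \<inter> X"] by simp
qed

lemma invariant_measure_of_content:
  "\<exists>M. prob_space M \<and> space M = X \<and> sets M = sets (restrict_space borel X) \<and>
     (\<forall>g\<in>\<Gamma>. \<forall>A\<in>sets M. g -` A \<inter> X \<in> sets M \<and> emeasure M (g -` A \<inter> X) = emeasure M A)"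
proof -
  interpret S: sigma_algebra X "Pow X"
    by (rule sigma_algebra_Pow)
  define L where "L = lambda_system X (Pow X) outer"
  have ms: "measure_space X L outer"
    unfolding L_def by (rule S.caratheodory_lemma[OF outer_measure_space_outer])
  interpret L: sigma_algebra X L
    using ms by (simp add: measure_space_def)
  have closed_L: "F \<inter> X \<in> L" if "closed F" for F
  proof -
    have "outer (A \<inter> (F \<inter> X)) + outer (A - F \<inter> X) = outer A" if "A \<subseteq> X" for A
    proof -
      have eq: "A \<inter> (F \<inter> X) = A \<inter> F" "A - F \<inter> X = A - F"
        using that by auto
      have "outer A \<le> outer (A \<inter> F) + outer (A - F)"
        using outer_Un[of "A \<inter> F" "A - F"] by (simp add: Int_Diff_Un)
      then show ?thesis
        using outer_split_closed[OF \<open>closed F\<close> that] by (simp add: eq)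
    qed
    then show ?thesis
      unfolding L_def S.lambda_system_eq by auto
  qed
  have borel_L: "B \<inter> X \<in> L" if "B \<in> sets borel" for B
  proof -
    have "B \<in> sigma_sets UNIV {F. closed F}"
      using that unfolding borel_eq_closed by simp
    then show ?thesis
    proof (induction rule: sigma_sets.induct)
      case (Compl B)
      have "(UNIV - B) \<inter> X = X - B \<inter> X" by auto
      then show ?case using Compl by auto
    next
      case (Union B)
      have "(\<Union>i. B i) \<inter> X = (\<Union>i. B i \<inter> X)" by auto
      moreover have "(\<Union>i. B i \<inter> X) \<in> L" by (rule L.countable_nat_UN) (use Union in auto)
      ultimately show ?case by simp
    qed (auto simp: closed_L)
  qed
  \<comment> \<open>The lambda system may be larger than the trace of the Borel sets, whereas the
    measure sought has exactly the latter as its measurable sets.\<close>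
  define \<B> where "\<B> = sets (restrict_space borel X)"
  have \<B>: "sigma_algebra X \<B>" "\<B> \<subseteq> L"
    using sets.sigma_algebra_axioms[of "restrict_space borel X"] borel_L
    by (auto simp: \<B>_def space_restrict_space sets_restrict_space Int_commute)
  have msB: "measure_space X \<B> outer"
    using measure_down[OF ms \<B>] .
  define M where "M = measure_of X \<B> outer"
  have \<B>_Pow: "\<B> \<subseteq> Pow X"
    using \<B>(1) by (simp add: sigma_algebra_iff2)
  have sp: "space M = X" and se: "sets M = \<B>"
    using \<B> \<B>_Pow unfolding M_def by (simp_all add: sigma_algebra.sigma_sets_eq)
  have em: "emeasure M A = outer A" if "A \<in> \<B>" for A
    using msB that \<B>_Pow unfolding M_def measure_space_def
    by (intro emeasure_measure_of_sigma) auto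
  have "X \<in> \<B>"
    using sets.top[of "restrict_space borel X"] by (simp add: \<B>_def space_restrict_space)
  have "prob_space M"
    using em[OF \<open>X \<in> \<B>\<close>] by (intro prob_spaceI) (simp add: sp outer_X)
  moreover have "g -` A \<inter> X \<in> \<B> \<and> outer (g -` A \<inter> X) = outer A" if gA: "g \<in> \<Gamma>" "A \<in> \<B>" for g A
  proof
    obtain B where B: "B \<in> sets borel" "A = X \<inter> B"
      using gA(2) unfolding \<B>_def by (auto simp: sets_restrict_space)
    have "g \<in> borel_measurable borel"
      by (rule borel_measurable_continuous_onI[OF cont_map[OF gA(1)]])
    then have "g -` B \<in> sets borel"
      using measurable_sets[of g borel borel B] B(1) by simp
    moreover have "g -` A \<inter> X = X \<inter> g -` B"
      using B(2) maps[OF gA(1)] by auto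
    ultimately show "g -` A \<inter> X \<in> \<B>"
      unfolding \<B>_def sets_restrict_space by auto
    show "outer (g -` A \<inter> X) = outer A"
      using outer_preimage[OF gA(1)] gA(2) \<B>_Pow by auto
  qed
  ultimately show ?thesis
    using sp se em by (intro exI[of _ M]) (simp add: \<B>_def)
qed

end

theorem invariant_measure_exists:
  "\<exists>M. prob_space M \<and> space M = X \<and> sets M = sets (restrict_space borel X) \<and>
     (\<forall>g\<in>\<Gamma>. \<forall>A\<in>sets M. g -` A \<inter> X \<in> sets M \<and> emeasure M (g -` A \<inter> X) = emeasure M A)"
proof (rule invariant_content_exists, goal_cases)
  case (1 \<nu>)
  show ?case
    by (rule invariant_measure_of_content[OF 1])
qed

end

section \<open>Haar measure on closed groups of unitary matrices\<close>

lemma is_mat_simps [simp]: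
  "is_mat d (mmul d A B)" "is_mat d (madj d A)" "is_mat d (mtransp d A)" "is_mat d (idm d)"
  by (auto simp: is_mat_def mmul_def madj_def mtransp_def idm_def)

lemma mat_eqI:
  assumes "is_mat d A" "is_mat d B" "\<And>i j. i < d \<Longrightarrow> j < d \<Longrightarrow> A i j = B i j"
  shows "A = B"
  using assms unfolding is_mat_def by (intro ext) (metis not_less)

lemma mmul_assoc: "mmul d (mmul d A B) C = mmul d A (mmul d B C)"
  unfolding mmul_def
  by (intro ext) (auto simp: sum_distrib_left sum_distrib_right mult.assoc intro: sum.swap)

lemma sum_idm_left: "i < d \<Longrightarrow> (\<Sum>k<d. idm d i k * f k) = f i"
  by (simp add: idm_def mult_delta_left mult_delta_right)

lemma sum_idm_right: "j < d \<Longrightarrow> (\<Sum>k<d. f k * idm d k j) = f j"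
  by (simp add: idm_def mult_delta_left mult_delta_right)

lemma mmul_idm_left: "is_mat d A \<Longrightarrow> mmul d (idm d) A = A"
  by (rule mat_eqI[of d]) (simp_all, simp add: mmul_def sum_idm_left)

lemma mmul_idm_right: "is_mat d A \<Longrightarrow> mmul d A (idm d) = A"
  by (rule mat_eqI[of d]) (simp_all, simp add: mmul_def sum_idm_right)

lemma madj_mmul: "madj d (mmul d A B) = mmul d (madj d B) (madj d A)"
  by (intro ext) (auto simp: madj_def mmul_def mult.commute)

lemma madj_madj: "is_mat d A \<Longrightarrow> madj d (madj d A) = A"
  by (rule mat_eqI[of d]) (simp_all, simp add: madj_def)

lemma madj_idm: "madj d (idm d) = idm d"
  by (intro ext) (auto simp: madj_def idm_def)

lemma unitary_groupD:
  assumes "U \<in> unitary_group d"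
  shows "is_mat d U" "mmul d (madj d U) U = idm d" "mmul d U (madj d U) = idm d"
  using assms by (auto simp: unitary_group_def)

lemma unitary_group_idm: "idm d \<in> unitary_group d"
  by (simp add: unitary_group_def madj_idm mmul_idm_left)

lemma unitary_group_madj: "U \<in> unitary_group d \<Longrightarrow> madj d U \<in> unitary_group d"
  by (auto simp: unitary_group_def madj_madj)

lemma unitary_group_mmul:
  assumes "U \<in> unitary_group d" "V \<in> unitary_group d"
  shows "mmul d U V \<in> unitary_group d"
proof -
  note U = unitary_groupD[OF assms(1)] and V = unitary_groupD[OF assms(2)]
  have "mmul d (mmul d (madj d V) (madj d U)) (mmul d U V)
      = mmul d (madj d V) (mmul d (mmul d (madj d U) U) V)"
    by (simp add: mmul_assoc)
  moreover have "mmul d (mmul d U V) (mmul d (madj d V) (madj d U))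
      = mmul d U (mmul d (mmul d V (madj d V)) (madj d U))"
    by (simp add: mmul_assoc)
  ultimately show ?thesis
    using U V by (simp add: unitary_group_def madj_mmul mmul_idm_left)
qed

lemma unitary_sum_columns:
  assumes "U \<in> unitary_group d" "a < d" "b < d"
  shows "(\<Sum>i<d. cnj (U i a) * U i b) = idm d a b"
  using fun_cong[OF fun_cong[OF unitary_groupD(2)[OF assms(1)], of a], of b] assms(2,3)
  by (simp add: mmul_def madj_def)

lemma unitary_preserves_norm:
  assumes "U \<in> unitary_group d"
  shows "(\<Sum>i<d. (cmod (\<Sum>k<d. U i k * v k))\<^sup>2) = (\<Sum>k<d. (cmod (v k))\<^sup>2)"
proof -
  have "complex_of_real (\<Sum>i<d. (cmod (\<Sum>k<d. U i k * v k))\<^sup>2)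
      = (\<Sum>i<d. (\<Sum>k<d. U i k * v k) * cnj (\<Sum>l<d. U i l * v l))"
    by (simp only: of_real_sum complex_norm_square)
  also have "\<dots> = (\<Sum>i<d. \<Sum>k<d. \<Sum>l<d. v k * cnj (v l) * (cnj (U i l) * U i k))"
    by (simp add: sum_product mult_ac)
  also have "\<dots> = (\<Sum>k<d. \<Sum>i<d. \<Sum>l<d. v k * cnj (v l) * (cnj (U i l) * U i k))"
    by (rule sum.swap)
  also have "\<dots> = (\<Sum>k<d. \<Sum>l<d. \<Sum>i<d. v k * cnj (v l) * (cnj (U i l) * U i k))"
    by (intro sum.cong refl sum.swap)
  also have "\<dots> = (\<Sum>k<d. \<Sum>l<d. v k * (cnj (v l) * idm d l k))"
    by (intro sum.cong refl) (simp add: unitary_sum_columns[OF assms] mult.assoc flip: sum_distrib_left)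
  also have "\<dots> = (\<Sum>k<d. v k * cnj (v k))"
    by (simp add: sum_idm_right flip: sum_distrib_left)
  also have "\<dots> = complex_of_real (\<Sum>k<d. (cmod (v k))\<^sup>2)"
    by (simp only: of_real_sum complex_norm_square)
  finally show ?thesis
    using of_real_eq_iff by blast
qed

lemma unitary_column_norm:
  assumes "U \<in> unitary_group d" "c < d"
  shows "(\<Sum>i<d. (cmod (U i c))\<^sup>2) = 1"
proof -
  have "(\<Sum>k<d. U i k * (if k = c then 1 else 0)) = U i c" for i
    using assms(2) by (simp add: mult_delta_right)
  moreover have "(\<Sum>k<d. (cmod (if k = c then 1 else 0))\<^sup>2) = 1"
    using assms(2) by (simp add: if_distrib[of cmod] if_distrib[of "\<lambda>x. x ^ 2"] cong: if_cong)
  ultimately show ?thesis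
    using unitary_preserves_norm[OF assms(1), of "\<lambda>k. if k = c then 1 else 0"] by simp
qed

lemma unitary_entry_le_1:
  assumes "U \<in> unitary_group d"
  shows "cmod (U i j) \<le> 1"
proof (cases "i < d \<and> j < d")
  case True
  then have "(cmod (U i j))\<^sup>2 \<le> (\<Sum>k<d. (cmod (U k j))\<^sup>2)"
    by (intro member_le_sum) auto
  then show ?thesis
    using unitary_column_norm[OF assms] True by (simp add: power_le_one_iff abs_square_le_1)
next
  case False
  then show ?thesis
    using unitary_groupD(1)[OF assms] by (auto simp: is_mat_def)
qed

text \<open>The Frobenius distance, which left multiplication by a unitary preserves column by
  column.\<close>

definition mat_dist :: "nat \<Rightarrow> cmat \<Rightarrow> cmat \<Rightarrow> real" where
  "mat_dist d A B = L2_set (\<lambda>p. cmod (A (fst p) (snd p) - B (fst p) (snd p))) ({..<d} \<times> {..<d})"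

lemma mat_dist_triangle: "mat_dist d A C \<le> mat_dist d A B + mat_dist d B C"
proof -
  have "mat_dist d A C \<le> L2_set (\<lambda>p. cmod (A (fst p) (snd p) - B (fst p) (snd p))
      + cmod (B (fst p) (snd p) - C (fst p) (snd p))) ({..<d} \<times> {..<d})"
    unfolding mat_dist_def by (intro L2_set_mono norm_ge_zero) norm
  also have "\<dots> \<le> mat_dist d A B + mat_dist d B C"
    unfolding mat_dist_def by (rule L2_set_triangle_ineq)
  finally show ?thesis .
qed

lemma mat_dist_mmul:
  assumes "g \<in> unitary_group d"
  shows "mat_dist d (mmul d g A) (mmul d g B) = mat_dist d A B"
proof -
  have "(\<Sum>i<d. \<Sum>j<d. (cmod (mmul d g A i j - mmul d g B i j))\<^sup>2)
      = (\<Sum>j<d. \<Sum>i<d. (cmod (\<Sum>k<d. g i k * (A k j - B k j)))\<^sup>2)"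
    by (subst sum.swap) (simp add: mmul_def right_diff_distrib sum_subtractf)
  also have "\<dots> = (\<Sum>j<d. \<Sum>k<d. (cmod (A k j - B k j))\<^sup>2)"
    by (simp add: unitary_preserves_norm[OF assms])
  also have "\<dots> = (\<Sum>i<d. \<Sum>j<d. (cmod (A i j - B i j))\<^sup>2)"
    by (rule sum.swap)
  finally show ?thesis
    by (simp add: mat_dist_def L2_set_def sum.cartesian_product split_def)
qed

lemma continuous_on_mat_entry:
  fixes f :: "'a::topological_space \<Rightarrow> cmat"
  assumes "continuous_on S f"
  shows "continuous_on S (\<lambda>x. f x i j)"
  by (rule continuous_on_product_then_coordinatewise, rule continuous_on_product_then_coordinatewise)
    (rule assms)

lemma continuous_on_mmul:
  fixes f g :: "'a::topological_space \<Rightarrow> cmat"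
  assumes "continuous_on S f" "continuous_on S g"
  shows "continuous_on S (\<lambda>x. mmul d (f x) (g x))"
proof (intro continuous_on_coordinatewise_then_product)
  fix i j
  show "continuous_on S (\<lambda>x. mmul d (f x) (g x) i j)"
  proof (cases "i < d \<and> j < d")
    case True
    have "continuous_on S (\<lambda>x. \<Sum>k<d. f x i k * g x k j)"
      by (intro continuous_on_sum continuous_on_mult continuous_on_mat_entry[OF assms(1)]
          continuous_on_mat_entry[OF assms(2)])
    then show ?thesis
      using True by (simp add: mmul_def)
  next
    case False
    then show ?thesis
      by (auto simp: mmul_def)
  qed
qed

lemma continuous_on_madj:
  fixes f :: "'a::topological_space \<Rightarrow> cmat"
  assumes "continuous_on S f"
  shows "continuous_on S (\<lambda>x. madj d (f x))"
proof (intro continuous_on_coordinatewise_then_product)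
  fix i j
  show "continuous_on S (\<lambda>x. madj d (f x) i j)"
  proof (cases "i < d \<and> j < d")
    case True
    have "continuous_on S (\<lambda>x. cnj (f x j i))"
      by (intro continuous_on_cnj continuous_on_mat_entry[OF assms])
    then show ?thesis
      using True by (simp add: madj_def)
  next
    case False
    then show ?thesis
      by (auto simp: madj_def)
  qed
qed

lemma closed_Collect_mat_eq:
  fixes f g :: "'a::topological_space \<Rightarrow> cmat"
  assumes "continuous_on UNIV f" "continuous_on UNIV g"
  shows "closed {x. f x = g x}"
proof -
  have "{x. f x = g x} = {x. \<forall>i j. f x i j = g x i j}"
    by (auto simp: fun_eq_iff)
  then show ?thesis
    by (simp only:) (intro closed_Collect_all closed_Collect_eq continuous_on_mat_entry[OF assms(1)]
        continuous_on_mat_entry[OF assms(2)])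
qed

lemma closed_unitary_group: "closed (unitary_group d)"
proof -
  have "closed {U. is_mat d U}"
    unfolding is_mat_def
    by (intro closed_Collect_all closed_Collect_imp closed_Collect_eq continuous_on_const
        open_Collect_const continuous_on_mat_entry[OF continuous_on_id])
  then have "closed ({U. is_mat d U} \<inter> ({U. mmul d (madj d U) U = idm d} \<inter> {U. mmul d U (madj d U) = idm d}))"
    by (intro closed_Int closed_Collect_mat_eq continuous_on_mmul continuous_on_madj continuous_on_id
        continuous_on_const)
  also have "\<dots> = unitary_group d"
    by (auto simp: unitary_group_def)
  finally show ?thesis .
qed

lemma borel_measurable_mat_entry [measurable]:
  "(\<lambda>A :: cmat. A i j) \<in> borel_measurable borel"
  by (rule borel_measurable_continuous_onI[OF continuous_on_mat_entry[OF continuous_on_id]])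

lemma borel_measurable_matI:
  fixes f :: "'a \<Rightarrow> cmat"
  assumes "\<And>i j. (\<lambda>x. f x i j) \<in> borel_measurable M"
  shows "f \<in> borel_measurable M"
proof (rule measurable_coordinatewise_then_product)
  fix i
  show "(\<lambda>x. f x i) \<in> borel_measurable M"
    by (rule measurable_coordinatewise_then_product) (rule assms)
qed

lemma borel_measurable_cnj [measurable]: "cnj \<in> borel_measurable borel"
  by (rule borel_measurable_continuous_onI[OF continuous_on_cnj[OF continuous_on_id]])

section \<open>Existence and uniqueness of the Haar measure\<close>

locale matrix_group =
  fixes d :: nat and G :: "cmat set"
  assumes subset_unitary: "G \<subseteq> unitary_group d" and idm_mem: "idm d \<in> G"
    and mmul_mem: "\<And>A B. A \<in> G \<Longrightarrow> B \<in> G \<Longrightarrow> mmul d A B \<in> G"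
    and madj_mem: "\<And>A. A \<in> G \<Longrightarrow> madj d A \<in> G"
    and closed_G: "closed G"
begin

text \<open>Entries of unitary matrices lie in the closed unit disc, so G is a closed subset of a
  product of discs, compact by Tychonoff.\<close>

lemma compact_G: "compact G"
proof -
  define K where "K = {f :: cmat. \<forall>i. f i \<in> {g. \<forall>j. g j \<in> cball 0 1}}"
  have "compact K"
    unfolding K_def by (intro compact_PiE_UNIV) simp
  then have "compact (G \<inter> K)"
    by (rule closed_Int_compact[OF closed_G])
  moreover have "G \<inter> K = G"
    using subset_unitary unitary_entry_le_1 by (auto simp: K_def)
  ultimately show ?thesis
    by simp
qed

lemma G_cancel:
  assumes "g \<in> G" "A \<in> G"
  shows "mmul d (madj d g) (mmul d g A) = A" "mmul d g (mmul d (madj d g) A) = A"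
  using unitary_groupD[OF subsetD[OF subset_unitary assms(1)]]
    unitary_groupD(1)[OF subsetD[OF subset_unitary assms(2)]]
  by (simp_all add: mmul_idm_left flip: mmul_assoc)

lemma haar_measure_exists: "\<exists>M. is_haar_measure d G M"
proof -
  interpret compact_isometries G "mat_dist d" "mmul d ` G"
  proof
    show "compact G" by (rule compact_G)
    show "G \<noteq> {}" using idm_mem by auto
    show "mat_dist d x x = 0" for x by (simp add: mat_dist_def L2_set_def)
    show "mat_dist d x y = mat_dist d y x" for x y
      by (simp add: mat_dist_def norm_minus_commute)
    show "mat_dist d x z \<le> mat_dist d x y + mat_dist d y z" for x y z
      by (rule mat_dist_triangle)
    show "continuous_on UNIV (mat_dist d x)" for x
      unfolding mat_dist_def L2_set_def
      by (intro continuous_on_real_sqrt continuous_on_sum continuous_on_power continuous_on_norm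
          continuous_on_diff continuous_on_const continuous_on_mat_entry[OF continuous_on_id])
    show "x = y" if "x \<in> G" "y \<in> G" "mat_dist d x y = 0" for x y
    proof (rule mat_eqI[of d])
      show "is_mat d x" "is_mat d y"
        using that subset_unitary unitary_groupD(1) by auto
      show "x i j = y i j" if "i < d" "j < d" for i j
        using \<open>mat_dist d x y = 0\<close> that by (auto simp: mat_dist_def L2_set_eq_0_iff)
    qed
    show "g x \<in> G" if "g \<in> mmul d ` G" "x \<in> G" for g x
      using that mmul_mem by auto
    show "mat_dist d (g x) (g y) = mat_dist d x y" if "g \<in> mmul d ` G" for g x y
      using that subset_unitary mat_dist_mmul by auto
    show "continuous_on UNIV g" if g: "g \<in> mmul d ` G" for g
    proof -
      obtain A where "g = mmul d A" using g by auto
      moreover have "continuous_on UNIV (\<lambda>x. mmul d A x)"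
        by (intro continuous_on_mmul continuous_on_const continuous_on_id)
      ultimately show ?thesis by simp
    qed
    show "\<exists>g'\<in>mmul d ` G. \<forall>x\<in>G. g' (g x) = x \<and> g (g' x) = x" if g: "g \<in> mmul d ` G" for g
    proof -
      obtain A where A: "A \<in> G" "g = mmul d A" using g by auto
      then show ?thesis
        using G_cancel madj_mem by (intro bexI[of _ "mmul d (madj d A)"]) auto
    qed
  qed
  show ?thesis
    using invariant_measure_exists unfolding is_haar_measure_def by simp
qed

lemma haar_measureD:
  assumes "is_haar_measure d G M"
  shows "prob_space M" "space M = G" "sets M = sets (restrict_space borel G)"
    "\<And>g A. g \<in> G \<Longrightarrow> A \<in> sets M \<Longrightarrow> mmul d g -` A \<inter> G \<in> sets M"
    "\<And>g A. g \<in> G \<Longrightarrow> A \<in> sets M \<Longrightarrow> emeasure M (mmul d g -` A \<inter> G) = emeasure M A"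
  using assms unfolding is_haar_measure_def by blast+

lemma haar_measurable_mmul:
  assumes "is_haar_measure d G M" "g \<in> G"
  shows "mmul d g \<in> measurable M M"
proof (rule measurableI)
  show "mmul d g x \<in> space M" if "x \<in> space M" for x
    using assms(2) mmul_mem[of g x] that haar_measureD(2)[OF assms(1)] by simp
  show "mmul d g -` A \<inter> space M \<in> sets M" if "A \<in> sets M" for A
    using haar_measureD(2,4)[OF assms(1)] assms(2) that by simp
qed

lemma haar_distr_mmul:
  assumes M: "is_haar_measure d G M" and g: "g \<in> G"
  shows "distr M M (mmul d g) = M"
proof (rule measure_eqI)
  fix A assume "A \<in> sets (distr M M (mmul d g))"
  then show "emeasure (distr M M (mmul d g)) A = emeasure M A"
    using g haar_measurable_mmul[OF M g] haar_measureD(2,5)[OF M]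
    by (simp add: emeasure_distr)
qed simp

lemma haar_nn_integral_mmul:
  assumes M: "is_haar_measure d G M" and g: "g \<in> G" and f: "f \<in> borel_measurable M"
  shows "(\<integral>\<^sup>+x. f (mmul d g x) \<partial>M) = (\<integral>\<^sup>+x. f x \<partial>M)"
  using nn_integral_distr[OF haar_measurable_mmul[OF M g], of f] f
  by (simp only: haar_distr_mmul[OF M g])

lemma haar_integral_mmul:
  fixes f :: "cmat \<Rightarrow> real"
  assumes M: "is_haar_measure d G M" and g: "g \<in> G" and f: "f \<in> borel_measurable M"
  shows "(\<integral>x. f (mmul d g x) \<partial>M) = (\<integral>x. f x \<partial>M)"
  using integral_distr[OF haar_measurable_mmul[OF M g] f] by (simp only: haar_distr_mmul[OF M g])

lemma haar_entry_measurable: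
  assumes "is_haar_measure d G M"
  shows "(\<lambda>x. x i j) \<in> borel_measurable M"
proof -
  have "(\<lambda>x :: cmat. x i j) \<in> borel_measurable (restrict_space borel G)"
    by (intro measurable_restrict_space1) measurable
  then show ?thesis
    using measurable_cong_sets[OF haar_measureD(3)[OF assms] refl] by blast
qed

lemma haar_measurable_into:
  assumes M: "is_haar_measure d G M" and f: "\<And>i j. (\<lambda>x. f x i j) \<in> borel_measurable N"
    and mem: "\<And>x. x \<in> space N \<Longrightarrow> f x \<in> G"
  shows "f \<in> measurable N M"
proof -
  have *: "f \<in> borel_measurable N"
    by (rule borel_measurable_matI) (rule f)
  have "f \<in> measurable N (restrict_space borel G)"
  proof (rule measurable_restrict_space2)
    show "f \<in> space N \<rightarrow> G"
      using mem by (rule Pi_I)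
  qed (rule *)
  then show ?thesis
    by (simp only: measurable_cong_sets[OF refl haar_measureD(3)[OF M]])
qed

text \<open>Integrating the indicator of A at the point \<open>x\<inverse>y\<close> over \<open>M \<otimes> N\<close> in the two orders gives
  \<open>N A\<close> and a number depending on M only.\<close>

lemma haar_measure_eq_inverse:
  assumes M: "is_haar_measure d G M" and N: "is_haar_measure d G N" and A: "A \<in> sets N"
  shows "emeasure N A = (\<integral>\<^sup>+x. indicator A (madj d x) \<partial>M)"
proof -
  interpret M: prob_space M by (rule haar_measureD(1)[OF M])
  interpret N: prob_space N by (rule haar_measureD(1)[OF N])
  interpret pair_sigma_finite M N ..
  have sp: "space M = G" "space N = G"
    using haar_measureD(2)[OF M] haar_measureD(2)[OF N] by simp_all
  have [measurable]: "(\<lambda>p. fst p i j) \<in> borel_measurable (M \<Otimes>\<^sub>M N)"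
    "(\<lambda>p. snd p i j) \<in> borel_measurable (M \<Otimes>\<^sub>M N)" for i j
    by (rule measurable_compose[OF measurable_fst haar_entry_measurable[OF M]]
        measurable_compose[OF measurable_snd haar_entry_measurable[OF N]])+
  have m: "(\<lambda>(x, y). mmul d (madj d x) y) \<in> measurable (M \<Otimes>\<^sub>M N) N"
  proof (rule haar_measurable_into[OF N])
    fix i j
    show "(\<lambda>x. (case x of (x, y) \<Rightarrow> mmul d (madj d x) y) i j) \<in> borel_measurable (M \<Otimes>\<^sub>M N)"
    proof (cases "i < d \<and> j < d")
      case True
      have "(\<lambda>p. \<Sum>k<d. cnj (fst p k i) * snd p k j) \<in> borel_measurable (M \<Otimes>\<^sub>M N)"
        by measurable
      then show ?thesis
        using True by (simp add: mmul_def madj_def split_def)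
    next
      case False
      then show ?thesis
        by (auto simp: mmul_def split_def)
    qed
  qed (auto simp: space_pair_measure sp intro: mmul_mem madj_mem)
  have inv: "madj d \<in> measurable M N"
  proof (rule haar_measurable_into[OF N])
    fix i j
    show "(\<lambda>x. madj d x i j) \<in> borel_measurable M"
      unfolding madj_def using measurable_compose[OF haar_entry_measurable[OF M, of j i] borel_measurable_cnj]
      by (cases "i < d \<and> j < d") auto
  qed (auto simp: sp intro: madj_mem)
  have "(\<lambda>p. indicator A (case p of (x, y) \<Rightarrow> mmul d (madj d x) y) :: ennreal) \<in> borel_measurable (M \<Otimes>\<^sub>M N)"
    using m A by (rule measurable_compose[OF _ borel_measurable_indicator])
  then have "(\<lambda>(x, y). indicator A (mmul d (madj d x) y) :: ennreal) \<in> borel_measurable (M \<Otimes>\<^sub>M N)"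
    by (simp add: split_def)
  then have "(\<integral>\<^sup>+y. (\<integral>\<^sup>+x. indicator A (mmul d (madj d x) y) \<partial>M) \<partial>N)
      = (\<integral>\<^sup>+x. (\<integral>\<^sup>+y. indicator A (mmul d (madj d x) y) \<partial>N) \<partial>M)"
    by (rule Fubini')
  moreover have "(\<integral>\<^sup>+y. indicator A (mmul d (madj d x) y) \<partial>N) = emeasure N A" if "x \<in> G" for x
    using haar_nn_integral_mmul[OF N madj_mem[OF that], of "indicator A"] A by simp
  then have "(\<integral>\<^sup>+x. (\<integral>\<^sup>+y. indicator A (mmul d (madj d x) y) \<partial>N) \<partial>M) = (\<integral>\<^sup>+x. emeasure N A \<partial>M)"
    by (intro nn_integral_cong) (simp add: sp)
  moreover have "(\<integral>\<^sup>+x. indicator A (mmul d (madj d x) y) \<partial>M) = (\<integral>\<^sup>+x. indicator A (madj d x) \<partial>M)"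
    if y: "y \<in> G" for y
  proof -
    have "mmul d (madj d x) y = madj d (mmul d (madj d y) x)" for x
      using y subset_unitary unitary_groupD(1) by (auto simp: madj_mmul madj_madj)
    moreover have "(\<lambda>x. indicator A (madj d x) :: ennreal) \<in> borel_measurable M"
      using inv A by (rule measurable_compose[OF _ borel_measurable_indicator])
    ultimately show ?thesis
      using haar_nn_integral_mmul[OF M madj_mem[OF y], of "\<lambda>x. indicator A (madj d x)"] by simp
  qed
  then have "(\<integral>\<^sup>+y. (\<integral>\<^sup>+x. indicator A (mmul d (madj d x) y) \<partial>M) \<partial>N)
      = (\<integral>\<^sup>+y. (\<integral>\<^sup>+x. indicator A (madj d x) \<partial>M) \<partial>N)"
    by (rule nn_integral_cong) (simp add: sp)
  ultimately show ?thesis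
    by (simp add: M.emeasure_space_1 N.emeasure_space_1)
qed

text \<open>Keeping M as the first measure in \<open>haar_measure_eq_inverse\<close> yields one and
  the same integral for M and for N.\<close>

lemma haar_measure_unique:
  assumes M: "is_haar_measure d G M" and N: "is_haar_measure d G N"
  shows "M = N"
proof (rule measure_eqI)
  show "sets M = sets N"
    using haar_measureD(3)[OF M] haar_measureD(3)[OF N] by simp
  then show "emeasure M A = emeasure N A" if "A \<in> sets M" for A
    using haar_measure_eq_inverse[OF M M, of A] haar_measure_eq_inverse[OF M N, of A] that by simp
qed

lemma is_haar_measure_haar: "is_haar_measure d G (haar d G)"
proof -
  obtain M where M: "is_haar_measure d G M"
    using haar_measure_exists by blast
  show ?thesis
    unfolding haar_def by (rule theI[of "is_haar_measure d G" M, OF M]) (rule haar_measure_unique[OF _ M])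
qed

end

section \<open>The classical groups and their elementary elements\<close>

lemma matrix_group_unitary: "matrix_group d (unitary_group d)"
  by unfold_locales (auto intro: unitary_group_idm unitary_group_mmul unitary_group_madj closed_unitary_group)

text \<open>The orthogonal and the symplectic group are the fixed points in \<open>U(d)\<close> of an antilinear
  involution: complex conjugation, and \<open>A \<mapsto> J A\<^sup>* J\<inverse>\<close> with \<open>A\<^sup>*\<close> the entrywise conjugate.\<close>

definition real_form :: "nat \<Rightarrow> (nat \<Rightarrow> nat) \<Rightarrow> (nat \<Rightarrow> complex) \<Rightarrow> cmat set" where
  "real_form d s e = {A \<in> unitary_group d. \<forall>a<d. \<forall>b<d. A a b = e a * e b * cnj (A (s a) (s b))}"

locale signed_involution =
  fixes d :: nat and s :: "nat \<Rightarrow> nat" and e :: "nat \<Rightarrow> complex"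
  assumes s_less: "\<And>a. a < d \<Longrightarrow> s a < d" and s_s: "\<And>a. a < d \<Longrightarrow> s (s a) = a"
    and e_sign: "\<And>a. e a = 1 \<or> e a = -1"
begin

lemma e_simps [simp]: "e a * e a = 1" "cnj (e a) = e a" "e a * (e a * x) = x"
  using e_sign[of a] by auto

lemma bij_s: "bij_betw s {..<d} {..<d}"
  by (rule bij_betwI[of _ _ _ s]) (auto simp: s_less s_s)

lemma s_eq_iff: "a < d \<Longrightarrow> b < d \<Longrightarrow> s a = s b \<longleftrightarrow> a = b"
  using s_s by metis

lemma real_formD:
  assumes "A \<in> real_form d s e" "a < d" "b < d"
  shows "A a b = e a * e b * cnj (A (s a) (s b))"
  using assms by (simp add: real_form_def)

lemma real_form_unitary: "A \<in> real_form d s e \<Longrightarrow> A \<in> unitary_group d"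
  by (simp add: real_form_def)

lemma real_form_mmul:
  assumes A: "A \<in> real_form d s e" and B: "B \<in> real_form d s e"
  shows "mmul d A B \<in> real_form d s e"
  unfolding real_form_def
proof (intro CollectI conjI allI impI)
  show "mmul d A B \<in> unitary_group d"
    using A B by (intro unitary_group_mmul real_form_unitary)
  fix a b assume ab: "a < d" "b < d"
  have "(\<Sum>k<d. A a k * B k b) = (\<Sum>k<d. e a * e b * cnj (A (s a) (s k) * B (s k) (s b)))"
  proof (rule sum.cong)
    fix k assume "k \<in> {..<d}"
    then have "A a k * B k b = (e a * e k * cnj (A (s a) (s k))) * (e k * e b * cnj (B (s k) (s b)))"
      using real_formD[OF A ab(1)] real_formD[OF B _ ab(2)] by simp
    also have "\<dots> = (e k * e k) * (e a * e b * cnj (A (s a) (s k) * B (s k) (s b)))"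
      by (simp only: complex_cnj_mult mult_ac)
    finally show "A a k * B k b = e a * e b * cnj (A (s a) (s k) * B (s k) (s b))"
      by simp
  qed simp
  also have "\<dots> = e a * e b * cnj (\<Sum>k<d. A (s a) (s k) * B (s k) (s b))"
    by (simp add: sum_distrib_left)
  also have "(\<Sum>k<d. A (s a) (s k) * B (s k) (s b)) = (\<Sum>k<d. A (s a) k * B k (s b))"
    by (rule sum.reindex_bij_betw[OF bij_s])
  finally show "mmul d A B a b = e a * e b * cnj (mmul d A B (s a) (s b))"
    using ab s_less by (simp add: mmul_def)
qed

lemma real_form_madj:
  assumes A: "A \<in> real_form d s e"
  shows "madj d A \<in> real_form d s e"
  unfolding real_form_def
proof (intro CollectI conjI allI impI)
  show "madj d A \<in> unitary_group d"
    using A by (intro unitary_group_madj real_form_unitary)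
  fix a b assume ab: "a < d" "b < d"
  have "cnj (A b a) = cnj (e b * e a * cnj (A (s b) (s a)))"
    using real_formD[OF A ab(2,1)] by (rule arg_cong)
  then show "madj d A a b = e a * e b * cnj (madj d A (s a) (s b))"
    using ab s_less by (simp add: madj_def mult_ac)
qed

lemma matrix_group_real_form: "matrix_group d (real_form d s e)"
proof
  show "real_form d s e \<subseteq> unitary_group d"
    by (auto simp: real_form_def)
  show "idm d \<in> real_form d s e"
    using s_eq_iff s_less unfolding real_form_def by (simp add: unitary_group_idm) (auto simp: idm_def)
  have "closed (unitary_group d \<inter> {A. \<forall>a. a < d \<longrightarrow> (\<forall>b. b < d \<longrightarrow> A a b = e a * e b * cnj (A (s a) (s b)))})"
    by (intro closed_Int closed_unitary_group closed_Collect_all closed_Collect_imp open_Collect_const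
        closed_Collect_eq continuous_on_mult continuous_on_const continuous_on_cnj
        continuous_on_mat_entry[OF continuous_on_id])
  also have "\<dots> = real_form d s e"
    by (auto simp: real_form_def)
  finally show "closed (real_form d s e)" .
qed (simp_all add: real_form_mmul real_form_madj)

end

interpretation trivial_sign: signed_involution d "\<lambda>a. a" "\<lambda>a. 1" for d
  by unfold_locales auto

text \<open>Transpose and adjoint are both inverse to Q, so they coincide and the entries are
  real.\<close>

lemma orthogonal_group_eq: "orthogonal_group d = real_form d (\<lambda>a. a) (\<lambda>a. 1)"
proof (intro set_eqI iffI)
  fix Q assume Q: "Q \<in> orthogonal_group d"
  then have U: "Q \<in> unitary_group d" and t: "mmul d (mtransp d Q) Q = idm d"
    by (auto simp: orthogonal_group_def)
  have "mtransp d Q = mmul d (mmul d (mtransp d Q) Q) (madj d Q)"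
    by (simp add: mmul_assoc unitary_groupD(3)[OF U] mmul_idm_right)
  then have "mtransp d Q = madj d Q"
    by (simp add: t mmul_idm_left)
  then have "mtransp d Q b a = madj d Q b a" for a b
    by simp
  then show "Q \<in> real_form d (\<lambda>a. a) (\<lambda>a. 1)"
    using U by (simp add: real_form_def mtransp_def madj_def) metis
next
  fix Q assume Q: "Q \<in> real_form d (\<lambda>a. a) (\<lambda>a. 1)"
  have "mtransp d Q = madj d Q"
    using trivial_sign.real_formD[OF Q] by (intro ext) (auto simp: mtransp_def madj_def)
  then show "Q \<in> orthogonal_group d"
    using unitary_groupD[of Q d] trivial_sign.real_form_unitary[OF Q] by (simp add: orthogonal_group_def)
qed

section \<open>The symplectic form as a signed permutation of the indices\<close>

definition partner :: "nat \<Rightarrow> nat \<Rightarrow> nat" where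
  "partner h i = (if i < h then i + h else i - h)"

definition half_sign :: "nat \<Rightarrow> nat \<Rightarrow> complex" where
  "half_sign h i = (if i < h then 1 else -1)"

lemma partner_less: "i < 2 * h \<Longrightarrow> partner h i < 2 * h"
  by (auto simp: partner_def)

lemma partner_partner: "i < 2 * h \<Longrightarrow> partner h (partner h i) = i"
  by (auto simp: partner_def)

lemma partner_neq: "i < 2 * h \<Longrightarrow> partner h i \<noteq> i"
  by (auto simp: partner_def)

lemma partner_eq_iff: "i < 2 * h \<Longrightarrow> j < 2 * h \<Longrightarrow> partner h i = partner h j \<longleftrightarrow> i = j"
  using partner_partner by metis

lemma half_sign_partner: "i < 2 * h \<Longrightarrow> half_sign h (partner h i) = - half_sign h i"
  by (auto simp: partner_def half_sign_def)

interpretation half_sign: signed_involution "2 * h" "partner h" "half_sign h" for h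
  by unfold_locales (auto simp: partner_less partner_partner half_sign_def)

lemma Jmat_row: "a < 2 * h \<Longrightarrow> Jmat (2 * h) a k = (if k = partner h a then half_sign h a else 0)"
  by (auto simp: Jmat_def partner_def half_sign_def)

lemma Jinv_column:
  "b < 2 * h \<Longrightarrow> l < 2 * h \<Longrightarrow> Jinv (2 * h) l b = (if l = partner h b then half_sign h b else 0)"
  by (auto simp: Jinv_def Jmat_def partner_def half_sign_def)

lemma symplectic_conjugate_entry:
  assumes "a < 2 * h" "b < 2 * h"
  shows "mmul (2 * h) (mmul (2 * h) (Jmat (2 * h)) (mtransp (2 * h) S)) (Jinv (2 * h)) a b
    = half_sign h a * half_sign h b * S (partner h b) (partner h a)"
proof -
  have "mmul (2 * h) (Jmat (2 * h)) (mtransp (2 * h) S) a l = half_sign h a * S l (partner h a)"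
    if "l < 2 * h" for l
    using assms that partner_less by (simp add: mmul_def mtransp_def Jmat_row mult_delta_left)
  then show ?thesis
    using assms partner_less[OF assms(2)]
    by (subst mmul_def) (simp add: Jinv_column mult_delta_right)
qed

text \<open>J is a signed swap of the two halves, so conjugating the transpose by it only moves
  entries and changes signs. The result is a left inverse of the unitary S, hence its adjoint, and
  conjugating this equation of entries gives the real form.\<close>

lemma symplectic_group_eq: "symplectic_group (2 * h) = real_form (2 * h) (partner h) (half_sign h)"
proof (intro set_eqI iffI)
  fix S
  define X where "X = mmul (2 * h) (mmul (2 * h) (Jmat (2 * h)) (mtransp (2 * h) S)) (Jinv (2 * h))"
  have entry: "X a b = half_sign h a * half_sign h b * S (partner h b) (partner h a)"
    if "a < 2 * h" "b < 2 * h" for a b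
    unfolding X_def using that by (rule symplectic_conjugate_entry)
  have matX: "is_mat (2 * h) X"
    by (simp add: X_def)
  {
    assume "S \<in> symplectic_group (2 * h)"
    then have U: "S \<in> unitary_group (2 * h)" and XS: "mmul (2 * h) X S = idm (2 * h)"
      by (auto simp: symplectic_group_def X_def)
    have "X = mmul (2 * h) (mmul (2 * h) X S) (madj (2 * h) S)"
      by (simp only: mmul_assoc unitary_groupD(3)[OF U] mmul_idm_right[OF matX])
    then have Xeq: "X = madj (2 * h) S"
      by (simp add: XS mmul_idm_left)
    have "S a b = half_sign h a * half_sign h b * cnj (S (partner h a) (partner h b))"
      if "a < 2 * h" "b < 2 * h" for a b
    proof -
      have "cnj (S a b) = X b a"
        using that by (simp add: Xeq madj_def)
      then have "cnj (cnj (S a b)) = cnj (half_sign h b * half_sign h a * S (partner h a) (partner h b))"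
        using entry[OF that(2,1)] by simp
      then show ?thesis
        by (simp add: mult_ac)
    qed
    then show "S \<in> real_form (2 * h) (partner h) (half_sign h)"
      using U by (simp add: real_form_def)
  }
  {
    assume S: "S \<in> real_form (2 * h) (partner h) (half_sign h)"
    have "X = madj (2 * h) S"
    proof (rule mat_eqI[OF matX])
      fix a b assume ab: "a < 2 * h" "b < 2 * h"
      have "cnj (S b a) = cnj (half_sign h b * half_sign h a * cnj (S (partner h b) (partner h a)))"
        using half_sign.real_formD[OF S ab(2,1)] by (rule arg_cong)
      then show "X a b = madj (2 * h) S a b"
        using ab by (simp add: entry madj_def mult_ac)
    qed simp
    then show "S \<in> symplectic_group (2 * h)"
      using half_sign.real_form_unitary[OF S] unitary_groupD(2)[of S "2 * h"]
      by (simp add: symplectic_group_def X_def)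
  }
qed

lemma matrix_group_orthogonal: "matrix_group d (orthogonal_group d)"
  unfolding orthogonal_group_eq by (rule trivial_sign.matrix_group_real_form)

lemma matrix_group_symplectic: "matrix_group (2 * h) (symplectic_group (2 * h))"
  unfolding symplectic_group_eq by (rule half_sign.matrix_group_real_form)

section \<open>Elementary unitaries that mix coordinates in pairs\<close>

definition pair_mat :: "nat \<Rightarrow> (nat \<Rightarrow> nat) \<Rightarrow> (nat \<Rightarrow> complex) \<Rightarrow> (nat \<Rightarrow> complex) \<Rightarrow> cmat" where
  "pair_mat d \<tau> \<alpha> \<beta> = (\<lambda>a b. if a < d \<and> b < d
     then (if b = a then \<alpha> a else 0) + (if b = \<tau> a then \<beta> a else 0) else 0)"

lemma is_mat_pair_mat [simp]: "is_mat d (pair_mat d \<tau> \<alpha> \<beta>)"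
  by (auto simp: is_mat_def pair_mat_def)

text \<open>Unitarity row by row: \<open>norm_1\<close> is the norm of row a and \<open>orth\<close>
  its inner product with row \<open>\<tau> a\<close>. At a fixed point of \<tau> both entries of
  \<open>pair_mat\<close> fall on the same place, so \<beta> has to vanish there.\<close>

locale pair_rotation =
  fixes d :: nat and \<tau> :: "nat \<Rightarrow> nat" and \<alpha> \<beta> :: "nat \<Rightarrow> complex"
  assumes tau_less: "\<And>a. a < d \<Longrightarrow> \<tau> a < d" and tau_tau: "\<And>a. a < d \<Longrightarrow> \<tau> (\<tau> a) = a"
    and alpha_real: "\<And>a. a < d \<Longrightarrow> cnj (\<alpha> a) = \<alpha> a" and alpha_tau: "\<And>a. a < d \<Longrightarrow> \<alpha> (\<tau> a) = \<alpha> a"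
    and norm_1: "\<And>a. a < d \<Longrightarrow> \<alpha> a * \<alpha> a + \<beta> a * cnj (\<beta> a) = 1"
    and orth: "\<And>a. a < d \<Longrightarrow> \<alpha> a * (cnj (\<beta> (\<tau> a)) + \<beta> a) = 0"
    and fixed: "\<And>a. a < d \<Longrightarrow> \<tau> a = a \<Longrightarrow> \<beta> a = 0"
begin

lemma pair_mat_mmul:
  assumes "a < d" "b < d"
  shows "mmul d (pair_mat d \<tau> \<alpha> \<beta>) A a b = \<alpha> a * A a b + \<beta> a * A (\<tau> a) b"
  using assms tau_less
  by (simp add: mmul_def pair_mat_def distrib_right mult_delta_left sum.distrib)

lemma mmul_pair_mat_madj: "mmul d (pair_mat d \<tau> \<alpha> \<beta>) (madj d (pair_mat d \<tau> \<alpha> \<beta>)) = idm d"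
proof (rule mat_eqI[of d])
  fix a b assume ab: "a < d" "b < d"
  have "\<tau> a = \<tau> b \<longleftrightarrow> a = b" "a = \<tau> b \<longleftrightarrow> b = \<tau> a"
    using ab tau_tau by metis+
  then show "mmul d (pair_mat d \<tau> \<alpha> \<beta>) (madj d (pair_mat d \<tau> \<alpha> \<beta>)) a b = idm d a b"
    using ab tau_less[OF ab(1)] norm_1[OF ab(1)] orth[OF ab(1)] fixed[OF ab(1)]
      alpha_real[OF ab(1)] alpha_tau[OF ab(1)]
    unfolding pair_mat_mmul[OF ab]
    by (cases "b = a"; cases "b = \<tau> a") (auto simp: madj_def pair_mat_def idm_def algebra_simps)
qed simp_all

lemma madj_pair_mat: "madj d (pair_mat d \<tau> \<alpha> \<beta>) = pair_mat d \<tau> \<alpha> (\<lambda>a. cnj (\<beta> (\<tau> a)))"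
proof (rule mat_eqI[of d])
  fix a b assume ab: "a < d" "b < d"
  have "a = \<tau> b \<longleftrightarrow> b = \<tau> a"
    using ab tau_tau by metis
  then show "madj d (pair_mat d \<tau> \<alpha> \<beta>) a b = pair_mat d \<tau> \<alpha> (\<lambda>a. cnj (\<beta> (\<tau> a))) a b"
    using ab alpha_real tau_tau by (auto simp: madj_def pair_mat_def)
qed simp_all

lemma pair_rotation_madj: "pair_rotation d \<tau> \<alpha> (\<lambda>a. cnj (\<beta> (\<tau> a)))"
proof
  fix a assume a: "a < d"
  show "\<alpha> a * \<alpha> a + cnj (\<beta> (\<tau> a)) * cnj (cnj (\<beta> (\<tau> a))) = 1"
    using norm_1[OF tau_less[OF a]] alpha_tau[OF a] by (simp add: mult.commute)
  show "\<alpha> a * (cnj (cnj (\<beta> (\<tau> (\<tau> a)))) + cnj (\<beta> (\<tau> a))) = 0"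
    using orth[OF a] tau_tau[OF a] by (simp add: add.commute)
qed (use tau_less tau_tau alpha_real alpha_tau fixed in auto)

text \<open>The adjoint is again a pair rotation, so the one-sided identity applied to it supplies
  the other side.\<close>

lemma pair_mat_unitary: "pair_mat d \<tau> \<alpha> \<beta> \<in> unitary_group d"
proof -
  interpret adj: pair_rotation d \<tau> \<alpha> "\<lambda>a. cnj (\<beta> (\<tau> a))"
    by (rule pair_rotation_madj)
  have "mmul d (madj d (pair_mat d \<tau> \<alpha> \<beta>)) (pair_mat d \<tau> \<alpha> \<beta>) = idm d"
    using adj.mmul_pair_mat_madj by (simp add: madj_madj flip: madj_pair_mat)
  then show ?thesis
    using mmul_pair_mat_madj by (simp add: unitary_group_def)
qed

lemma pair_mat_real_form:
  assumes "signed_involution d s e"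
    and comm: "\<And>a. a < d \<Longrightarrow> \<tau> (s a) = s (\<tau> a)" and al: "\<And>a. a < d \<Longrightarrow> \<alpha> (s a) = \<alpha> a"
    and be: "\<And>a. a < d \<Longrightarrow> \<beta> a = e a * e (\<tau> a) * cnj (\<beta> (s a))"
  shows "pair_mat d \<tau> \<alpha> \<beta> \<in> real_form d s e"
proof -
  interpret signed_involution d s e by fact
  have "pair_mat d \<tau> \<alpha> \<beta> a b = e a * e b * cnj (pair_mat d \<tau> \<alpha> \<beta> (s a) (s b))" if ab: "a < d" "b < d" for a b
  proof -
    have "s b = s a \<longleftrightarrow> b = a" "s b = \<tau> (s a) \<longleftrightarrow> b = \<tau> a"
      using ab s_eq_iff tau_less comm by auto
    then have "e a * e b * cnj (pair_mat d \<tau> \<alpha> \<beta> (s a) (s b))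
      = (if b = a then e a * e a * \<alpha> a else 0) + (if b = \<tau> a then e a * e (\<tau> a) * cnj (\<beta> (s a)) else 0)"
      using ab s_less al alpha_real by (simp add: pair_mat_def distrib_left)
    also have "\<dots> = pair_mat d \<tau> \<alpha> \<beta> a b"
      using ab be[OF ab(1)] by (simp add: pair_mat_def)
    finally show ?thesis by simp
  qed
  then show ?thesis
    by (simp add: real_form_def pair_mat_unitary)
qed

end

definition rot_swap :: "nat \<Rightarrow> nat \<Rightarrow> nat \<Rightarrow> nat \<Rightarrow> nat" where
  "rot_swap h i j a = (if a = i then j else if a = j then i
     else if a = partner h i then partner h j else if a = partner h j then partner h i else a)"

definition rot_diag :: "nat \<Rightarrow> nat \<Rightarrow> nat \<Rightarrow> nat \<Rightarrow> complex" where
  "rot_diag h i j a = (if a \<in> {i, j, partner h i, partner h j} then 1 / complex_of_real (sqrt 2) else 1)"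

text \<open>The values at the partner indices are the ones forced by the condition on \<beta> in
  \<open>pair_mat_real_form\<close> for the symplectic involution.\<close>

definition rot_off :: "nat \<Rightarrow> complex \<Rightarrow> nat \<Rightarrow> nat \<Rightarrow> nat \<Rightarrow> complex" where
  "rot_off h c i j a = (if a = i then c else if a = j then - cnj c
     else if a = partner h i then half_sign h i * half_sign h j * cnj c
     else if a = partner h j then - half_sign h i * half_sign h j * c else 0) / complex_of_real (sqrt 2)"

text \<open>The rotation by 45 degrees with relative phase c in the coordinates i, j, accompanied by the
  rotation of the partner coordinates that the symplectic structure forces.\<close>

definition rotor :: "nat \<Rightarrow> complex \<Rightarrow> nat \<Rightarrow> nat \<Rightarrow> cmat" where
  "rotor h c i j = pair_mat (2 * h) (rot_swap h i j) (rot_diag h i j) (rot_off h c i j)"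

context
  fixes h i j :: nat and c :: complex
  assumes ij: "i < 2 * h" "j < 2 * h" "j \<noteq> i" "j \<noteq> partner h i" and c: "c * cnj c = 1"
begin

lemma rot_distinct:
  "i \<noteq> j" "partner h i \<noteq> j" "i \<noteq> partner h i" "j \<noteq> partner h j" "i \<noteq> partner h j"
  "partner h i \<noteq> i" "partner h j \<noteq> j" "partner h j \<noteq> i" "partner h i \<noteq> partner h j" "partner h j \<noteq> partner h i"
  using ij partner_neq[OF ij(1)] partner_neq[OF ij(2)] partner_eq_iff[OF ij(1,2)] partner_partner[OF ij(2)]
  by metis+

lemma rotor_pair_rotation: "pair_rotation (2 * h) (rot_swap h i j) (rot_diag h i j) (rot_off h c i j)"
proof
  have sq: "complex_of_real (sqrt 2) * complex_of_real (sqrt 2) = 2"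
    by (simp flip: of_real_mult)
  have hs: "cnj (half_sign h x) = half_sign h x" "half_sign h x * half_sign h x = 1" for x
    by (auto simp: half_sign_def)
  fix a assume a: "a < 2 * h"
  show "rot_swap h i j a < 2 * h"
    using ij a partner_less by (auto simp: rot_swap_def)
  show "rot_swap h i j (rot_swap h i j a) = a"
    using rot_distinct by (auto simp: rot_swap_def)
  show "cnj (rot_diag h i j a) = rot_diag h i j a"
    by (simp add: rot_diag_def)
  show "rot_diag h i j (rot_swap h i j a) = rot_diag h i j a"
    by (auto simp: rot_diag_def rot_swap_def)
  show "rot_off h c i j a = 0" if "rot_swap h i j a = a"
    using that rot_distinct by (auto simp: rot_off_def rot_swap_def split: if_splits)
  show "rot_diag h i j a * (cnj (rot_off h c i j (rot_swap h i j a)) + rot_off h c i j a) = 0"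
    using rot_distinct
    by (cases "a = i"; cases "a = j"; cases "a = partner h i"; cases "a = partner h j")
      (simp_all add: rot_diag_def rot_off_def rot_swap_def hs)
  have "half_sign h i * half_sign h j * cnj c * (half_sign h i * half_sign h j * c) = 1"
    "half_sign h i * half_sign h j * c * (half_sign h i * half_sign h j * cnj c) = 1"
    using c hs(2)[of i] hs(2)[of j] by algebra+
  then show "rot_diag h i j a * rot_diag h i j a + rot_off h c i j a * cnj (rot_off h c i j a) = 1"
    using c by (auto simp: rot_diag_def rot_off_def sq hs mult.commute[of "cnj c" c])
qed

lemma rotor_symplectic: "rotor h c i j \<in> symplectic_group (2 * h)"
  unfolding rotor_def symplectic_group_eq
proof (rule pair_rotation.pair_mat_real_form[OF rotor_pair_rotation])
  show "signed_involution (2 * h) (partner h) (half_sign h)"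
    by (rule half_sign.signed_involution_axioms)
  have hs: "half_sign h x * half_sign h x = 1" "half_sign h x * (half_sign h x * y) = y"
     "cnj (half_sign h x) = half_sign h x" for x y
    by (auto simp: half_sign_def)
  fix a assume a: "a < 2 * h"
  have p: "partner h a = i \<longleftrightarrow> a = partner h i" "partner h a = j \<longleftrightarrow> a = partner h j"
    "partner h a = partner h i \<longleftrightarrow> a = i" "partner h a = partner h j \<longleftrightarrow> a = j"
    using a ij partner_partner by metis+
  show "rot_swap h i j (partner h a) = partner h (rot_swap h i j a)"
    using rot_distinct ij partner_partner by (auto simp: rot_swap_def p)
  show "rot_diag h i j (partner h a) = rot_diag h i j a"
    by (auto simp: rot_diag_def p)
  show "rot_off h c i j a = half_sign h a * half_sign h (rot_swap h i j a) * cnj (rot_off h c i j (partner h a))"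
    using rot_distinct half_sign_partner ij
    by (auto simp: rot_off_def rot_swap_def p hs mult_ac)
qed

text \<open>For a real phase all entries are real, so the matrix designed for the symplectic group
  serves the orthogonal group too.\<close>

lemma rotor_orthogonal:
  assumes "cnj c = c"
  shows "rotor h c i j \<in> orthogonal_group (2 * h)"
  unfolding rotor_def orthogonal_group_eq
proof (rule pair_rotation.pair_mat_real_form[OF rotor_pair_rotation])
  show "signed_involution (2 * h) (\<lambda>a. a) (\<lambda>a. 1)"
    by (rule trivial_sign.signed_involution_axioms)
  show "rot_off h c i j a = 1 * 1 * cnj (rot_off h c i j a)" for a
    using assms by (simp add: rot_off_def half_sign_def)
qed simp_all

lemma rotor_mmul:
  assumes "k < 2 * h"
  shows "mmul (2 * h) (rotor h c i j) A i k = (A i k + c * A j k) / complex_of_real (sqrt 2)"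
    "mmul (2 * h) (rotor h c i j) A j k = (A j k - cnj c * A i k) / complex_of_real (sqrt 2)"
  using assms ij rot_distinct unfolding rotor_def
  by (simp_all add: pair_rotation.pair_mat_mmul[OF rotor_pair_rotation] rot_diag_def rot_off_def
      rot_swap_def add_divide_distrib diff_divide_distrib)

lemma rotor_mmul_other:
  assumes "k < 2 * h" "l < 2 * h" "l \<notin> {i, j, partner h i, partner h j}"
  shows "mmul (2 * h) (rotor h c i j) A l k = A l k"
  using assms unfolding rotor_def
  by (simp add: pair_rotation.pair_mat_mmul[OF rotor_pair_rotation] rot_diag_def rot_off_def)

end

text \<open>Exchanging single coordinates breaks the symplectic pairing; this freedom of U(d) is
  what spreads the partner overlap of two columns evenly in the unitary case.\<close>

definition transposition_mat :: "nat \<Rightarrow> nat \<Rightarrow> nat \<Rightarrow> cmat" where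
  "transposition_mat d k l = pair_mat d (\<lambda>a. if a = k then l else if a = l then k else a)
     (\<lambda>a. if a = k \<or> a = l then 0 else 1) (\<lambda>a. if a = k \<or> a = l then 1 else 0)"

lemma transposition_pair_rotation:
  assumes "k < d" "l < d" "k \<noteq> l"
  shows "pair_rotation d (\<lambda>a. if a = k then l else if a = l then k else a)
     (\<lambda>a. if a = k \<or> a = l then 0 else 1) (\<lambda>a. if a = k \<or> a = l then 1 else 0)"
  using assms by unfold_locales auto

lemma transposition_mat_unitary:
  assumes "k < d" "l < d" "k \<noteq> l"
  shows "transposition_mat d k l \<in> unitary_group d"
  unfolding transposition_mat_def
  by (rule pair_rotation.pair_mat_unitary[OF transposition_pair_rotation[OF assms]])

lemma transposition_mat_mmul:
  assumes "k < d" "l < d" "k \<noteq> l" "a < d" "b < d"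
  shows "mmul d (transposition_mat d k l) A a b = A (if a = k then l else if a = l then k else a) b"
  using assms unfolding transposition_mat_def
  by (simp add: pair_rotation.pair_mat_mmul[OF transposition_pair_rotation[OF assms(1-3)]])

section \<open>Moments of the entries of Haar random matrices\<close>

locale haar_matrices = matrix_group +
  fixes M :: "cmat measure"
  assumes haar: "is_haar_measure d G M"
begin

sublocale prob_space M
  by (rule haar_measureD(1)[OF haar])

lemma space_M: "space M = G"
  by (rule haar_measureD(2)[OF haar])

text \<open>Bounded measurable functions are an algebra of integrable functions, so polynomials in
  the weights are integrable by the rules collected in \<open>bm_intros\<close>.\<close>

definition bm :: "(cmat \<Rightarrow> real) \<Rightarrow> bool" where
  "bm f \<longleftrightarrow> f \<in> borel_measurable M \<and> (\<exists>B. \<forall>x\<in>G. \<bar>f x\<bar> \<le> B)"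

lemma bm_const: "bm (\<lambda>x. c)"
  by (auto simp: bm_def)

lemma bm_add:
  assumes "bm f" "bm g"
  shows "bm (\<lambda>x. f x + g x)"
proof -
  obtain A B where "\<forall>x\<in>G. \<bar>f x\<bar> \<le> A" "\<forall>x\<in>G. \<bar>g x\<bar> \<le> B"
    using assms by (auto simp: bm_def)
  then have "\<forall>x\<in>G. \<bar>f x + g x\<bar> \<le> A + B"
    by (meson abs_triangle_ineq add_mono order_trans)
  then show ?thesis
    using assms unfolding bm_def by auto
qed

lemma bm_mult:
  assumes "bm f" "bm g"
  shows "bm (\<lambda>x. f x * g x)"
proof -
  obtain A B where "\<forall>x\<in>G. \<bar>f x\<bar> \<le> A" "\<forall>x\<in>G. \<bar>g x\<bar> \<le> B"
    using assms by (auto simp: bm_def)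
  then have "\<forall>x\<in>G. \<bar>f x * g x\<bar> \<le> A * B"
    by (auto simp: abs_mult intro!: mult_mono dest: order_trans[OF abs_ge_zero])
  then show ?thesis
    using assms unfolding bm_def by auto
qed

lemma bm_diff: "bm f \<Longrightarrow> bm g \<Longrightarrow> bm (\<lambda>x. f x - g x)"
  using bm_add[of f "\<lambda>x. (-1) * g x"] bm_mult[OF bm_const[of "-1"], of g] by simp

lemma bm_power: "bm f \<Longrightarrow> bm (\<lambda>x. f x ^ n)"
  by (induction n) (auto intro: bm_const bm_mult)

lemma bm_sum: "(\<And>i. i \<in> I \<Longrightarrow> bm (f i)) \<Longrightarrow> bm (\<lambda>x. \<Sum>i\<in>I. f i x)"
  by (induction I rule: infinite_finite_induct) (auto intro: bm_const bm_add)

lemma bm_integrable: "bm f \<Longrightarrow> integrable M f"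
  unfolding bm_def using space_M by (auto intro!: integrable_const_bound AE_I2)

definition P :: "nat \<Rightarrow> nat \<Rightarrow> cmat \<Rightarrow> real" where
  "P c i x = (cmod (x i c))\<^sup>2"

lemma P_nonneg: "0 \<le> P c i x"
  by (simp add: P_def)

lemma P_le_1: "x \<in> G \<Longrightarrow> P c i x \<le> 1"
  using subset_unitary unitary_entry_le_1[of x d i c] by (auto simp: P_def power_le_one)

lemma sum_P: "x \<in> G \<Longrightarrow> c < d \<Longrightarrow> (\<Sum>i<d. P c i x) = 1"
  using subset_unitary unitary_column_norm by (auto simp: P_def)

lemma bm_P: "bm (P c i)"
  using haar_entry_measurable[OF haar, of i c] P_nonneg P_le_1 unfolding bm_def
  by (intro conjI exI[of _ 1]) (auto simp: P_def[abs_def])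

lemmas bm_intros = bm_const bm_add bm_mult bm_diff bm_power bm_sum bm_P

lemma E_add: "bm f \<Longrightarrow> bm g \<Longrightarrow> expectation (\<lambda>x. f x + g x) = expectation f + expectation g"
  by (simp add: bm_integrable)

lemma E_diff: "bm f \<Longrightarrow> bm g \<Longrightarrow> expectation (\<lambda>x. f x - g x) = expectation f - expectation g"
  by (simp add: bm_integrable)

lemma E_sum: "(\<And>i. i \<in> I \<Longrightarrow> bm (f i)) \<Longrightarrow>
    expectation (\<lambda>x. \<Sum>i\<in>I. f i x) = (\<Sum>i\<in>I. expectation (f i))"
  by (rule Bochner_Integration.integral_sum) (simp add: bm_integrable)

lemma E_mono: "bm f \<Longrightarrow> bm g \<Longrightarrow> (\<And>x. x \<in> G \<Longrightarrow> f x \<le> g x) \<Longrightarrow> expectation f \<le> expectation g"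
  using space_M by (intro integral_mono) (auto simp: bm_integrable)

lemma E_cong: "(\<And>x. x \<in> G \<Longrightarrow> f x = g x) \<Longrightarrow> expectation f = expectation g"
  using space_M by (intro Bochner_Integration.integral_cong) auto

text \<open>The sole entry point of Haar invariance into the moment computations.\<close>

lemma E_translate: "bm f \<Longrightarrow> g \<in> G \<Longrightarrow> expectation (\<lambda>x. f (mmul d g x)) = expectation f"
  by (rule haar_integral_mmul[OF haar]) (auto simp: bm_def)

end

text \<open>For \<open>\<kappa> = 3\<close> the entries are real, for \<open>\<kappa> = 2\<close> the group contains the rotors with phase
  \<open>\<i>\<close>; in both cases \<open>\<kappa> / d\<^sup>2\<close> is, asymptotically, the second moment of the weights of a column.\<close>

locale rotor_invariant = haar_matrices d G M for d G M +
  fixes h :: nat and \<kappa> :: real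
  assumes d_eq: "d = 2 * h" and h_ge: "h \<ge> 4"
    and rotor_1: "\<And>i j. i < d \<Longrightarrow> j < d \<Longrightarrow> j \<noteq> i \<Longrightarrow> j \<noteq> partner h i \<Longrightarrow> rotor h 1 i j \<in> G"
    and kappa: "(\<kappa> = 3 \<and> (\<forall>x\<in>G. \<forall>a<d. \<forall>b<d. cnj (x a b) = x a b)) \<or>
      (\<kappa> = 2 \<and> (\<forall>i<d. \<forall>j<d. j \<noteq> i \<longrightarrow> j \<noteq> partner h i \<longrightarrow> rotor h \<i> i j \<in> G))"
begin

section \<open>Two-coordinate identities from rotor invariance\<close>

definition unrelated :: "nat \<Rightarrow> nat \<Rightarrow> bool" where
  "unrelated i j \<longleftrightarrow> j \<noteq> i \<and> j \<noteq> partner h i"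

lemma unrelated_sym: "i < d \<Longrightarrow> j < d \<Longrightarrow> unrelated i j \<longleftrightarrow> unrelated j i"
  using partner_partner d_eq unfolding unrelated_def by metis

text \<open>The interference term that a rotor of phase c adds to one weight and subtracts from the
  other.\<close>

definition cross :: "complex \<Rightarrow> nat \<Rightarrow> nat \<Rightarrow> nat \<Rightarrow> cmat \<Rightarrow> real" where
  "cross c k i j x = Re (x i k * cnj (c * x j k))"

lemma bm_cross: "bm (cross c k i j)"
proof -
  have "\<bar>cross c k i j x\<bar> \<le> cmod c" if "x \<in> G" for x
  proof -
    have "\<bar>cross c k i j x\<bar> \<le> cmod (x i k * cnj (c * x j k))"
      unfolding cross_def by (rule abs_Re_le_cmod)
    also have "\<dots> = cmod (x i k) * cmod c * cmod (x j k)"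
      by (simp add: norm_mult)
    also have "\<dots> \<le> 1 * cmod c * 1"
      using subset_unitary unitary_entry_le_1 that by (intro mult_mono) auto
    finally show ?thesis by simp
  qed
  moreover have "cross c k i j \<in> borel_measurable M"
  proof -
    note [measurable] = haar_entry_measurable[OF haar]
    have "Re \<in> borel_measurable borel"
      by (rule borel_measurable_continuous_onI[OF continuous_on_Re[OF continuous_on_id]])
    moreover have "(\<lambda>x. x i k * cnj (c * x j k)) \<in> borel_measurable M"
      by measurable
    ultimately show ?thesis
      unfolding cross_def[abs_def] by (rule measurable_compose[rotated])
  qed
  ultimately show ?thesis
    unfolding bm_def by blast
qed

lemma P_rotor:
  assumes "i < d" "j < d" "unrelated i j" "k < d" "cmod c = 1"
  shows "P k i (mmul d (rotor h c i j) x) = (P k i x + P k j x) / 2 + cross c k i j x"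
    "P k j (mmul d (rotor h c i j) x) = (P k i x + P k j x) / 2 - cross c k i j x"
proof -
  have c: "c * cnj c = 1"
    using assms(5) complex_norm_square[of c] by simp
  have sq: "(cmod (z / complex_of_real (sqrt 2)))\<^sup>2 = (cmod z)\<^sup>2 / 2" for z
    by (simp add: norm_divide power_divide)
  have n: "(cmod (z + w))\<^sup>2 = (cmod z)\<^sup>2 + (cmod w)\<^sup>2 + 2 * Re (z * cnj w)" for z w
    unfolding cmod_power2 by (simp add: power2_eq_square algebra_simps)
  have n': "(cmod (z - w))\<^sup>2 = (cmod z)\<^sup>2 + (cmod w)\<^sup>2 - 2 * Re (z * cnj w)" for z w
    unfolding cmod_power2 by (simp add: power2_eq_square algebra_simps)
  note r = rotor_mmul[of i h j c k x, folded d_eq, OF assms(1,2) _ _ c assms(4)]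
  have "j \<noteq> i" "j \<noteq> partner h i"
    using assms(3) by (auto simp: unrelated_def)
  note r = r[OF this]
  have mods: "cmod (c * z) = cmod z" "cmod (cnj c * z) = cmod z" for z
    using assms(5) by (simp_all add: norm_mult)
  show "P k i (mmul d (rotor h c i j) x) = (P k i x + P k j x) / 2 + cross c k i j x"
    unfolding P_def r sq n mods cross_def by simp
  have "Re (x j k * cnj (cnj c * x i k)) = Re (x i k * cnj (c * x j k))"
    by (simp add: algebra_simps)
  then show "P k j (mmul d (rotor h c i j) x) = (P k i x + P k j x) / 2 - cross c k i j x"
    unfolding P_def r sq n' mods cross_def by simp
qed

lemma P_rotor_other:
  assumes "i < d" "j < d" "unrelated i j" "k < d" "l < d" "cmod c = 1" "unrelated i l" "unrelated j l"
  shows "P k l (mmul d (rotor h c i j) x) = P k l x"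
proof -
  have c: "c * cnj c = 1"
    using assms(6) complex_norm_square[of c] by simp
  show ?thesis
    using rotor_mmul_other[of i h j c k l x, folded d_eq, OF assms(1,2) _ _ c assms(4,5)] assms(3,7,8)
    unfolding P_def unrelated_def by simp
qed

lemma cross_square_le: "(cross 1 k i j x)\<^sup>2 \<le> P k i x * P k j x"
proof -
  have "\<bar>cross 1 k i j x\<bar> \<le> cmod (x i k) * cmod (x j k)"
    using abs_Re_le_cmod[of "x i k * cnj (x j k)"] by (simp add: cross_def norm_mult)
  then have "\<bar>cross 1 k i j x\<bar>\<^sup>2 \<le> (cmod (x i k) * cmod (x j k))\<^sup>2"
    by (rule power_mono) simp
  then show ?thesis
    by (simp add: P_def power_mult_distrib)
qed

text \<open>Phase \<i> turns the real part of \<open>x i k * cnj (x j k)\<close> into its imaginary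
  part.\<close>

lemma cross_squares: "(cross 1 k i j x)\<^sup>2 + (cross \<i> k i j x)\<^sup>2 = P k i x * P k j x"
  unfolding cross_def P_def cmod_power2 by (simp add: power2_eq_square algebra_simps)

lemma E_rotor_square:
  assumes ij: "i < d" "j < d" "unrelated i j" "k < d" and c: "cmod c = 1" "rotor h c i j \<in> G"
    and X: "bm X" "\<And>x. X (mmul d (rotor h c i j) x) = X x"
  shows "expectation (\<lambda>x. ((P k i x)\<^sup>2 + (P k j x)\<^sup>2) * X x)
    = expectation (\<lambda>x. ((P k i x + P k j x)\<^sup>2 / 2 + 2 * (cross c k i j x)\<^sup>2) * X x)"
proof -
  have "expectation (\<lambda>x. ((P k i x)\<^sup>2 + (P k j x)\<^sup>2) * X x)
    = expectation (\<lambda>x. ((P k i (mmul d (rotor h c i j) x))\<^sup>2 + (P k j (mmul d (rotor h c i j) x))\<^sup>2)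
        * X (mmul d (rotor h c i j) x))"
    by (rule E_translate[symmetric]) (intro bm_intros X(1) c(2))+
  also have "\<dots> = expectation (\<lambda>x. ((P k i x + P k j x)\<^sup>2 / 2 + 2 * (cross c k i j x)\<^sup>2) * X x)"
    unfolding P_rotor[OF ij c(1)] X(2)
    by (intro E_cong) (simp add: power2_eq_square field_simps)
  finally show ?thesis .
qed

text \<open>Here \<kappa> originates. Invariance under a rotor gives A + B = 2 C + 4 R, with R the
  mean squared interference. For real entries the square is the full product, so R = C and A + B = 6
  C; with phases 1 and \<i> both available, the two values of R add up to C, so A + B = 4 C. The
  factor X lets the identity be used inside higher moments.\<close>

lemma E_P_mult:
  assumes ij: "i < d" "j < d" "unrelated i j" "k < d"
    and X: "bm X" "\<And>c x. cmod c = 1 \<Longrightarrow> X (mmul d (rotor h c i j) x) = X x"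
  shows "2 * \<kappa> * expectation (\<lambda>x. P k i x * P k j x * X x)
    = expectation (\<lambda>x. (P k i x)\<^sup>2 * X x) + expectation (\<lambda>x. (P k j x)\<^sup>2 * X x)"
proof -
  define A where "A = expectation (\<lambda>x. (P k i x)\<^sup>2 * X x)"
  define B where "B = expectation (\<lambda>x. (P k j x)\<^sup>2 * X x)"
  define C where "C = expectation (\<lambda>x. P k i x * P k j x * X x)"
  define R where "R c = expectation (\<lambda>x. (cross c k i j x)\<^sup>2 * X x)" for c
  note bms = bm_intros bm_cross X(1)
  have AB: "A + B = (A + B) / 2 + C + 2 * R c" if c: "cmod c = 1" "rotor h c i j \<in> G" for c
  proof -
    have "A + B = expectation (\<lambda>x. ((P k i x)\<^sup>2 + (P k j x)\<^sup>2) * X x)"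
      unfolding A_def B_def distrib_right by (rule E_add[symmetric]) (intro bms)+
    also have "\<dots> = expectation (\<lambda>x. ((P k i x + P k j x)\<^sup>2 / 2 + 2 * (cross c k i j x)\<^sup>2) * X x)"
      by (rule E_rotor_square[OF ij c X(1) X(2)[OF c(1)]])
    also have "\<dots> = expectation (\<lambda>x. (1/2) * ((P k i x)\<^sup>2 * X x) + (1/2) * ((P k j x)\<^sup>2 * X x)
        + P k i x * P k j x * X x + 2 * ((cross c k i j x)\<^sup>2 * X x))"
      by (rule E_cong) (simp add: power2_eq_square field_simps)
    also have "\<dots> = (1/2) * A + (1/2) * B + C + 2 * R c"
      unfolding A_def B_def C_def R_def
      by (subst E_add, (intro bms)+)+ simp
    finally show ?thesis by simp
  qed
  have r1: "A + B = (A + B) / 2 + C + 2 * R 1"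
    using ij rotor_1 by (intro AB) (auto simp: unrelated_def)
  from kappa show ?thesis
  proof
    assume k3: "\<kappa> = 3 \<and> (\<forall>x\<in>G. \<forall>a<d. \<forall>b<d. cnj (x a b) = x a b)"
    have "(cross 1 k i j x)\<^sup>2 = P k i x * P k j x" if "x \<in> G" for x
    proof -
      have "Im (x i k) = 0" "Im (x j k) = 0"
        using k3 that ij by (metis Reals_cnj_iff complex_is_Real_iff)+
      then show ?thesis
        unfolding cross_def P_def cmod_power2 by (simp add: power2_eq_square)
    qed
    then have "R 1 = C"
      unfolding R_def C_def by (intro E_cong) simp
    then show ?thesis
      unfolding A_def[symmetric] B_def[symmetric] C_def[symmetric] using r1 k3 by (simp add: field_simps)
  next
    assume k2: "\<kappa> = 2 \<and> (\<forall>i<d. \<forall>j<d. j \<noteq> i \<longrightarrow> j \<noteq> partner h i \<longrightarrow> rotor h \<i> i j \<in> G)"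
    then have r2: "A + B = (A + B) / 2 + C + 2 * R \<i>"
      using ij by (intro AB) (auto simp: unrelated_def)
    have "R 1 + R \<i> = expectation (\<lambda>x. (cross 1 k i j x)\<^sup>2 * X x + (cross \<i> k i j x)\<^sup>2 * X x)"
      unfolding R_def by (rule E_add[symmetric]) (intro bms)+
    also have "\<dots> = C"
      unfolding C_def cross_squares[symmetric] by (simp add: distrib_right)
    finally show ?thesis
      unfolding A_def[symmetric] B_def[symmetric] C_def[symmetric] using r1 r2 k2 by (simp add: field_simps)
  qed
qed

text \<open>Bounding the squared interference by the product of the weights treats real and complex
  entries alike, at the price of an inequality. The rotor then gives A \<le> A/4 + 15/4 B, hence the
  5.\<close>

lemma E_P_cube:
  assumes ij: "i < d" "j < d" "unrelated i j" "k < d"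
  shows "expectation (\<lambda>x. P k i x ^ 3) + expectation (\<lambda>x. P k j x ^ 3)
    \<le> 5 * (expectation (\<lambda>x. (P k i x)\<^sup>2 * P k j x) + expectation (\<lambda>x. (P k j x)\<^sup>2 * P k i x))"
proof -
  define A where "A = expectation (\<lambda>x. P k i x ^ 3) + expectation (\<lambda>x. P k j x ^ 3)"
  define B where "B = expectation (\<lambda>x. (P k i x)\<^sup>2 * P k j x) + expectation (\<lambda>x. (P k j x)\<^sup>2 * P k i x)"
  have rot: "rotor h 1 i j \<in> G"
    using ij rotor_1 by (auto simp: unrelated_def)
  have "A = expectation (\<lambda>x. P k i x ^ 3 + P k j x ^ 3)"
    unfolding A_def by (rule E_add[symmetric]) (intro bm_intros)+
  also have "\<dots> = expectation (\<lambda>x. P k i (mmul d (rotor h 1 i j) x) ^ 3 + P k j (mmul d (rotor h 1 i j) x) ^ 3)"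
    by (rule E_translate[symmetric]) (intro bm_intros rot)+
  also have "\<dots> \<le> expectation (\<lambda>x. (1/4) * P k i x ^ 3 + (1/4) * P k j x ^ 3
      + (15/4) * ((P k i x)\<^sup>2 * P k j x) + (15/4) * ((P k j x)\<^sup>2 * P k i x))"
    unfolding P_rotor[OF ij, of 1, simplified]
  proof (rule E_mono)
    fix x
    define p q r where "p = P k i x" and "q = P k j x" and "r = cross 1 k i j x"
    have pq: "0 \<le> p" "0 \<le> q" "r\<^sup>2 \<le> p * q"
      using P_nonneg cross_square_le by (auto simp: p_def q_def r_def)
    have "((p + q) / 2 + r) ^ 3 + ((p + q) / 2 - r) ^ 3 = (p + q) ^ 3 / 4 + 3 * (p + q) * r\<^sup>2"
      by (simp add: power3_eq_cube power2_eq_square field_simps)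
    also have "\<dots> \<le> (p + q) ^ 3 / 4 + 3 * (p + q) * (p * q)"
      using pq by (intro add_left_mono mult_left_mono) auto
    also have "\<dots> = (1/4) * p ^ 3 + (1/4) * q ^ 3 + (15/4) * (p\<^sup>2 * q) + (15/4) * (q\<^sup>2 * p)"
      by (simp add: power3_eq_cube power2_eq_square field_simps)
    finally show "((P k i x + P k j x) / 2 + cross 1 k i j x) ^ 3 + ((P k i x + P k j x) / 2 - cross 1 k i j x) ^ 3
      \<le> (1/4) * P k i x ^ 3 + (1/4) * P k j x ^ 3 + (15/4) * ((P k i x)\<^sup>2 * P k j x) + (15/4) * ((P k j x)\<^sup>2 * P k i x)"
      by (simp only: p_def q_def r_def)
  qed (unfold divide_inverse, (intro bm_intros bm_cross)+)
  also have "\<dots> = (1/4) * A + (15/4) * B"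
    unfolding A_def B_def by (subst E_add, (intro bm_intros)+)+ (simp add: add_divide_distrib)
  finally show ?thesis
    unfolding A_def[symmetric] B_def[symmetric] by simp
qed

text \<open>As for the cubes. The p^2 q^2 terms are absorbed by completing them to a multiple of - p
  q (p - q)^2, which is dropped; A \<le> A/8 + 63/8 B gives the 9.\<close>

lemma E_P_fourth:
  assumes ij: "i < d" "j < d" "unrelated i j" "k < d"
  shows "expectation (\<lambda>x. P k i x ^ 4) + expectation (\<lambda>x. P k j x ^ 4)
    \<le> 9 * (expectation (\<lambda>x. P k i x ^ 3 * P k j x) + expectation (\<lambda>x. P k j x ^ 3 * P k i x))"
proof -
  define A where "A = expectation (\<lambda>x. P k i x ^ 4) + expectation (\<lambda>x. P k j x ^ 4)"
  define B where "B = expectation (\<lambda>x. P k i x ^ 3 * P k j x) + expectation (\<lambda>x. P k j x ^ 3 * P k i x)"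
  have rot: "rotor h 1 i j \<in> G"
    using ij rotor_1 by (auto simp: unrelated_def)
  have "A = expectation (\<lambda>x. P k i x ^ 4 + P k j x ^ 4)"
    unfolding A_def by (rule E_add[symmetric]) (intro bm_intros)+
  also have "\<dots> = expectation (\<lambda>x. P k i (mmul d (rotor h 1 i j) x) ^ 4 + P k j (mmul d (rotor h 1 i j) x) ^ 4)"
    by (rule E_translate[symmetric]) (intro bm_intros rot)+
  also have "\<dots> \<le> expectation (\<lambda>x. (1/8) * P k i x ^ 4 + (1/8) * P k j x ^ 4
      + (63/8) * (P k i x ^ 3 * P k j x) + (63/8) * (P k j x ^ 3 * P k i x))"
    unfolding P_rotor[OF ij, of 1, simplified]
  proof (rule E_mono)
    fix x
    define p q r where "p = P k i x" and "q = P k j x" and "r = cross 1 k i j x"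
    have pq: "0 \<le> p" "0 \<le> q" "r\<^sup>2 \<le> p * q"
      using P_nonneg cross_square_le by (auto simp: p_def q_def r_def)
    have "((p + q) / 2 + r) ^ 4 + ((p + q) / 2 - r) ^ 4
        = (p + q) ^ 4 / 8 + 3 * (p + q)\<^sup>2 * r\<^sup>2 + 2 * (r\<^sup>2 * r\<^sup>2)"
      by (simp add: power4_eq_xxxx power2_eq_square field_simps)
    also have "\<dots> \<le> (p + q) ^ 4 / 8 + 3 * (p + q)\<^sup>2 * (p * q) + 2 * ((p * q) * (p * q))"
      using pq by (intro add_mono mult_left_mono mult_mono order_refl) auto
    also have "\<dots> = (1/8) * p ^ 4 + (1/8) * q ^ 4 + (63/8) * (p ^ 3 * q) + (63/8) * (q ^ 3 * p)
        - (35/8) * (p * q * (p - q)\<^sup>2)"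
      by (simp add: power4_eq_xxxx power3_eq_cube power2_eq_square field_simps)
    also have "\<dots> \<le> (1/8) * p ^ 4 + (1/8) * q ^ 4 + (63/8) * (p ^ 3 * q) + (63/8) * (q ^ 3 * p)"
      using pq by simp
    finally show "((P k i x + P k j x) / 2 + cross 1 k i j x) ^ 4 + ((P k i x + P k j x) / 2 - cross 1 k i j x) ^ 4
      \<le> (1/8) * P k i x ^ 4 + (1/8) * P k j x ^ 4 + (63/8) * (P k i x ^ 3 * P k j x) + (63/8) * (P k j x ^ 3 * P k i x)"
      by (simp only: p_def q_def r_def)
  qed (unfold divide_inverse, (intro bm_intros bm_cross)+)
  also have "\<dots> = (1/8) * A + (63/8) * B"
    unfolding A_def B_def by (subst E_add, (intro bm_intros)+)+ (simp add: add_divide_distrib)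
  finally show ?thesis
    unfolding A_def[symmetric] B_def[symmetric] by simp
qed

text \<open>Summation over all pairs of a symmetric relation turns the two-point identities into
  identities between power sums.\<close>

definition U :: "nat \<Rightarrow> nat \<Rightarrow> real" where
  "U i j = of_bool (unrelated i j)"

lemma U_sym: "i < d \<Longrightarrow> j < d \<Longrightarrow> U i j = U j i"
  using unrelated_sym by (simp add: U_def)

lemma U_bounds: "0 \<le> U i j" "U i j \<le> 1"
  by (simp_all add: U_def)

lemma sum_of_bool_not_in:
  fixes A :: "nat set"
  assumes "A \<subseteq> {..<d}"
  shows "(\<Sum>k<d. of_bool (k \<notin> A)) = real d - real (card A)"
proof -
  have "(\<Sum>k<d. of_bool (k \<notin> A)) = real (card ({..<d} - A))"
    by (simp add: of_bool_def sum.If_cases Int_def set_diff_eq)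
  also have "\<dots> = real d - real (card A)"
    using assms card_mono[OF _ assms] finite_subset[OF assms] by (simp add: card_Diff_subset)
  finally show ?thesis .
qed

lemma partner_d: "i < d \<Longrightarrow> partner h i < d" "i < d \<Longrightarrow> partner h i \<noteq> i" "i < d \<Longrightarrow> partner h (partner h i) = i"
  "i < d \<Longrightarrow> j < d \<Longrightarrow> partner h i = partner h j \<longleftrightarrow> i = j"
  using d_eq partner_less partner_neq partner_partner partner_eq_iff by auto

lemma sum_U1: "i < d \<Longrightarrow> (\<Sum>k<d. U i k) = real d - 2"
  using sum_of_bool_not_in[of "{i, partner h i}"] partner_d[of i]
  by (auto simp: U_def unrelated_def cong: sum.cong)

lemma unrelatedD:
  assumes "unrelated i j" "i < d" "j < d"
  shows "i \<noteq> j" "j \<noteq> i" "i \<noteq> partner h j" "partner h j \<noteq> i" "j \<noteq> partner h i" "partner h i \<noteq> j"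
    "partner h i \<noteq> partner h j" "partner h j \<noteq> partner h i"
  using assms unrelated_sym[OF assms(2,3)] partner_d(4)[OF assms(2,3)] by (auto simp: unrelated_def)

lemma sum_U2:
  assumes "i < d" "j < d" "unrelated i j"
  shows "(\<Sum>k<d. U i k * U j k) = real d - 4"
proof -
  have "card {i, partner h i, j, partner h j} = 4"
    using unrelatedD[OF assms(3,1,2)] partner_d(2)[OF assms(1)] partner_d(2)[OF assms(2)]
    by (simp add: eq_commute)
  moreover have "U i k * U j k = of_bool (k \<notin> {i, partner h i, j, partner h j})" for k
    by (auto simp: U_def unrelated_def)
  ultimately show ?thesis
    using sum_of_bool_not_in[of "{i, partner h i, j, partner h j}"] assms partner_d by simp
qed

lemma sum_U3:
  assumes "i < d" "j < d" "k < d" "unrelated i j" "unrelated i k" "unrelated j k"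
  shows "(\<Sum>l<d. U i l * U j l * U k l) = real d - 6"
proof -
  have "card {i, partner h i, j, partner h j, k, partner h k} = 6"
    using unrelatedD[OF assms(4,1,2)] unrelatedD[OF assms(5,1,3)] unrelatedD[OF assms(6,2,3)]
      partner_d(2)[OF assms(1)] partner_d(2)[OF assms(2)] partner_d(2)[OF assms(3)]
    by (simp add: eq_commute)
  moreover have "U i l * U j l * U k l = of_bool (l \<notin> {i, partner h i, j, partner h j, k, partner h k})" for l
    by (auto simp: U_def unrelated_def)
  ultimately show ?thesis
    using sum_of_bool_not_in[of "{i, partner h i, j, partner h j, k, partner h k}"] assms partner_d by simp
qed

lemma sum_swap_sym:
  fixes f :: "nat \<Rightarrow> real"
  assumes "\<And>i j. i < d \<Longrightarrow> j < d \<Longrightarrow> W i j = W j i"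
  shows "(\<Sum>i<d. \<Sum>j<d. W i j * (f i + f j)) = 2 * (\<Sum>i<d. f i * (\<Sum>j<d. W i j))"
proof -
  have "(\<Sum>i<d. \<Sum>j<d. W i j * f j) = (\<Sum>j<d. \<Sum>i<d. W i j * f j)"
    by (rule sum.swap)
  also have "\<dots> = (\<Sum>j<d. \<Sum>i<d. W j i * f j)"
    using assms by (intro sum.cong) auto
  finally show ?thesis
    by (simp add: distrib_left sum.distrib sum_distrib_left mult_ac)
qed

lemma kappa_cases: "\<kappa> = 2 \<or> \<kappa> = 3"
  using kappa by auto

text \<open>The 0-1 weights w select coordinates whose rotors leave X unchanged, so that X may
  contain weights at other, already fixed coordinates.\<close>

lemma E_pair_sum:
  assumes k: "k < d" and X: "bm X"
    and w: "\<And>j. w j = 0 \<or> w j = 1"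
    and inv: "\<And>i j c x. i < d \<Longrightarrow> j < d \<Longrightarrow> w i \<noteq> 0 \<Longrightarrow> w j \<noteq> 0 \<Longrightarrow> unrelated i j \<Longrightarrow> cmod c = 1 \<Longrightarrow>
      X (mmul d (rotor h c i j) x) = X x"
  shows "\<kappa> * (\<Sum>i<d. \<Sum>j<d. w i * w j * U i j * expectation (\<lambda>x. P k i x * P k j x * X x))
    = (\<Sum>i<d. expectation (\<lambda>x. (P k i x)\<^sup>2 * X x) * (\<Sum>j<d. w i * w j * U i j))"
proof -
  let ?S = "\<lambda>i. expectation (\<lambda>x. (P k i x)\<^sup>2 * X x)"
  have "w i * w j * U i j * (2 * \<kappa> * expectation (\<lambda>x. P k i x * P k j x * X x)) = w i * w j * U i j * (?S i + ?S j)"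
    if "i < d" "j < d" for i j
  proof (cases "w i = 0 \<or> w j = 0 \<or> \<not> unrelated i j")
    case False
    then show ?thesis
      using E_P_mult[of i j k X] that k X inv by simp
  qed (auto simp: U_def)
  then have "(\<Sum>i<d. \<Sum>j<d. w i * w j * U i j * (2 * \<kappa> * expectation (\<lambda>x. P k i x * P k j x * X x)))
    = (\<Sum>i<d. \<Sum>j<d. w i * w j * U i j * (?S i + ?S j))"
    by (intro sum.cong) auto
  also have "\<dots> = 2 * (\<Sum>i<d. ?S i * (\<Sum>j<d. w i * w j * U i j))"
    by (rule sum_swap_sym) (use U_sym in auto)
  also have "(\<Sum>i<d. \<Sum>j<d. w i * w j * U i j * (2 * \<kappa> * expectation (\<lambda>x. P k i x * P k j x * X x)))
    = 2 * (\<kappa> * (\<Sum>i<d. \<Sum>j<d. w i * w j * U i j * expectation (\<lambda>x. P k i x * P k j x * X x)))"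
    unfolding sum_distrib_left by (intro sum.cong) auto
  finally show ?thesis
    by simp
qed

section \<open>Power sums of one column\<close>

definition S :: "nat \<Rightarrow> nat \<Rightarrow> real" where
  "S k m = (\<Sum>i<d. expectation (\<lambda>x. P k i x ^ m))"

lemma d_ge: "real d \<ge> 8"
  using d_eq h_ge by simp

lemma sum_E_pairs: 
  assumes "k < d"
  shows "(\<Sum>i<d. \<Sum>j<d. U i j * expectation (\<lambda>x. P k i x * P k j x)) = (real d - 2) * S k 2 / \<kappa>"
proof -
  have "\<kappa> * (\<Sum>i<d. \<Sum>j<d. 1 * 1 * U i j * expectation (\<lambda>x. P k i x * P k j x * 1))
    = (\<Sum>i<d. expectation (\<lambda>x. (P k i x)\<^sup>2 * 1) * (\<Sum>j<d. 1 * 1 * U i j))"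
    by (rule E_pair_sum[OF assms bm_const]) auto
  also have "\<dots> = (\<Sum>i<d. expectation (\<lambda>x. (P k i x)\<^sup>2) * (real d - 2))"
    by (intro sum.cong) (auto simp: sum_U1)
  also have "\<dots> = (real d - 2) * S k 2"
    by (simp add: S_def sum_distrib_left mult.commute)
  finally show ?thesis
    using kappa_cases by (auto simp: field_simps)
qed

lemma total_pairs:
  assumes "k < d"
  shows "(\<Sum>i<d. \<Sum>j<d. expectation (\<lambda>x. P k i x * P k j x)) = 1"
proof -
  have "(\<Sum>i<d. \<Sum>j<d. expectation (\<lambda>x. P k i x * P k j x)) = expectation (\<lambda>x. \<Sum>i<d. \<Sum>j<d. P k i x * P k j x)"
    by (subst E_sum, (intro bm_intros)+)+ (simp add: E_sum bm_intros)
  also have "\<dots> = expectation (\<lambda>x. 1)"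
    using sum_P[OF _ assms] by (intro E_cong) (simp flip: sum_product)
  finally show ?thesis by (simp add: prob_space)
qed

text \<open>The unrelated pairs are part of all pairs, whose products sum to 1; the 3 bounds
  \<kappa>.\<close>

lemma S2_le: 
  assumes "k < d"
  shows "S k 2 \<le> 3 / (real d - 2)"
proof -
  have "(real d - 2) * S k 2 / \<kappa> \<le> (\<Sum>i<d. \<Sum>j<d. expectation (\<lambda>x. P k i x * P k j x))"
    unfolding sum_E_pairs[OF assms, symmetric]
    using U_bounds P_nonneg by (intro sum_mono mult_left_le_one_le Bochner_Integration.integral_nonneg) auto
  then have "(real d - 2) * S k 2 \<le> 3"
    using total_pairs[OF assms] kappa_cases by auto
  then show ?thesis
    using d_ge by (simp add: pos_le_divide_eq mult.commute)
qed

lemma sum_partner: "(\<Sum>i<d. f (partner h i)) = (\<Sum>i<d. f i)"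
  by (rule sum.reindex_bij_betw, rule bij_betwI[of _ _ _ "partner h"]) (auto simp: partner_d)

text \<open>All pairs together give 1. The unrelated ones contribute (d - 2) / \<kappa> times
  \<open>S k 2\<close>, the diagonal ones \<open>S k 2\<close>, and the partner pairs, by AM-GM, at
  most \<open>S k 2\<close> again; the last two account for 2 \<kappa> in the denominator.\<close>

lemma S2_ge:
  assumes "k < d"
  shows "S k 2 \<ge> \<kappa> / (real d - 2 + 2 * \<kappa>)"
proof -
  have split: "expectation (\<lambda>x. P k i x * P k j x) \<le> U i j * expectation (\<lambda>x. P k i x * P k j x)
      + (if j = i then expectation (\<lambda>x. P k i x ^ 2) else 0)
      + (if j = partner h i then (expectation (\<lambda>x. P k i x ^ 2) + expectation (\<lambda>x. P k (partner h i) x ^ 2)) / 2 else 0)"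
    if "i < d" "j < d" for i j
  proof -
    have "expectation (\<lambda>x. P k i x * P k (partner h i) x)
      \<le> expectation (\<lambda>x. (1/2) * P k i x ^ 2 + (1/2) * P k (partner h i) x ^ 2)"
    proof (rule E_mono)
      show "P k i x * P k (partner h i) x \<le> (1/2) * P k i x ^ 2 + (1/2) * P k (partner h i) x ^ 2" for x
        using sum_squares_bound[of "P k i x" "P k (partner h i) x"] by simp
    qed (intro bm_intros)+
    also have "\<dots> = (expectation (\<lambda>x. P k i x ^ 2) + expectation (\<lambda>x. P k (partner h i) x ^ 2)) / 2"
      by (subst E_add, (intro bm_intros)+) simp
    finally show ?thesis
      using partner_d(2)[OF that(1)] by (auto simp: U_def unrelated_def power2_eq_square)
  qed
  have "1 \<le> (\<Sum>i<d. \<Sum>j<d. U i j * expectation (\<lambda>x. P k i x * P k j x)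
      + (if j = i then expectation (\<lambda>x. P k i x ^ 2) else 0)
      + (if j = partner h i then (expectation (\<lambda>x. P k i x ^ 2) + expectation (\<lambda>x. P k (partner h i) x ^ 2)) / 2 else 0))"
    unfolding total_pairs[OF assms, symmetric] by (intro sum_mono split) auto
  also have "\<dots> = (real d - 2) * S k 2 / \<kappa> + S k 2 + (\<Sum>i<d. (expectation (\<lambda>x. P k i x ^ 2) + expectation (\<lambda>x. P k (partner h i) x ^ 2)) / 2)"
    using sum_E_pairs[OF assms] partner_d(1) by (simp add: sum.distrib S_def)
  also have "(\<Sum>i<d. (expectation (\<lambda>x. P k i x ^ 2) + expectation (\<lambda>x. P k (partner h i) x ^ 2)) / 2) = S k 2"
    using sum_partner[of "\<lambda>i. expectation (\<lambda>x. P k i x ^ 2)"]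
    by (simp add: S_def sum.distrib add_divide_distrib flip: sum_divide_distrib)
  finally have "1 \<le> S k 2 * ((real d - 2 + 2 * \<kappa>) / \<kappa>)"
    using kappa_cases by (auto simp: field_simps)
  then show ?thesis
    using kappa_cases d_ge by (auto simp: field_simps)
qed

text \<open>Summed over unrelated pairs, the left side counts each coordinate d - 2 times, while the
  right side is at most its sum over all pairs, where the free weight sums to 1. Each step thus
  gains a factor of order 1/d.\<close>

lemma S_step:
  assumes k: "k < d" and C: "C \<ge> 0"
    and two: "\<And>i j. i < d \<Longrightarrow> j < d \<Longrightarrow> unrelated i j \<Longrightarrow>
      expectation (\<lambda>x. P k i x ^ Suc m) + expectation (\<lambda>x. P k j x ^ Suc m)
      \<le> C * (expectation (\<lambda>x. P k i x ^ m * P k j x) + expectation (\<lambda>x. P k j x ^ m * P k i x))"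
  shows "(real d - 2) * S k (Suc m) \<le> C * S k m"
proof -
  let ?e = "\<lambda>i. expectation (\<lambda>x. P k i x ^ Suc m)"
  let ?f = "\<lambda>i j. expectation (\<lambda>x. P k i x ^ m * P k j x)"
  have f0: "0 \<le> ?f i j" for i j
    by (intro Bochner_Integration.integral_nonneg) (simp add: P_nonneg)
  have "2 * ((real d - 2) * S k (Suc m)) = 2 * (\<Sum>i<d. ?e i * (\<Sum>j<d. U i j))"
    by (simp add: sum_U1 S_def sum_distrib_left mult.commute)
  also have "\<dots> = (\<Sum>i<d. \<Sum>j<d. U i j * (?e i + ?e j))"
    by (rule sum_swap_sym[symmetric]) (rule U_sym)
  also have "\<dots> \<le> (\<Sum>i<d. \<Sum>j<d. C * (?f i j + ?f j i))"
  proof (intro sum_mono)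
    fix i j assume "i \<in> {..<d}" "j \<in> {..<d}"
    then show "U i j * (?e i + ?e j) \<le> C * (?f i j + ?f j i)"
      using two[of i j] f0[of i j] f0[of j i] C by (cases "unrelated i j") (auto simp: U_def)
  qed
  also have "\<dots> = 2 * (C * (\<Sum>i<d. \<Sum>j<d. ?f i j))"
    using sum.swap[of "\<lambda>i j. ?f j i" "{..<d}" "{..<d}"] by (simp add: sum.distrib distrib_left flip: sum_distrib_left)
  also have "(\<Sum>i<d. \<Sum>j<d. ?f i j) = S k m"
    unfolding S_def
  proof (rule sum.cong)
    fix i
    have "(\<Sum>j<d. ?f i j) = expectation (\<lambda>x. \<Sum>j<d. P k i x ^ m * P k j x)"
      by (rule E_sum[symmetric]) (intro bm_intros)
    also have "\<dots> = expectation (\<lambda>x. P k i x ^ m)"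
      using sum_P[OF _ k] by (intro E_cong) (simp flip: sum_distrib_left)
    finally show "(\<Sum>j<d. ?f i j) = expectation (\<lambda>x. P k i x ^ m)" .
  qed simp
  finally show ?thesis by simp
qed

text \<open>135 = 9 * 5 * 3, from the fourth, third and second moment in turn.\<close>

lemma S4_le:
  assumes "k < d"
  shows "S k 4 \<le> 135 / (real d - 2) ^ 3"
proof -
  have d2: "real d - 2 > 0" using d_ge by simp
  have "(real d - 2) * S k (Suc 3) \<le> 9 * S k 3"
    using E_P_fourth[OF _ _ _ assms] by (intro S_step[OF assms]) (simp_all add: numeral_eq_Suc)
  moreover have "(real d - 2) * S k (Suc 2) \<le> 5 * S k 2"
    using E_P_cube[OF _ _ _ assms] by (intro S_step[OF assms]) (simp_all add: numeral_eq_Suc)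
  ultimately have "S k 4 \<le> 9 * S k 3 / (real d - 2)" "S k 3 \<le> 5 * S k 2 / (real d - 2)"
    using d2 by (simp_all add: pos_le_divide_eq mult.commute)
  then have "S k 4 \<le> 9 * (5 * (3 / (real d - 2)) / (real d - 2)) / (real d - 2)"
    using S2_le[OF assms] d2 by (smt (verit, best) divide_right_mono)
  then show ?thesis
    by (simp add: power3_eq_cube)
qed

lemma U_cases: "U i j = 0 \<or> U i j = 1"
  by (simp add: U_def)

lemma sum_E_triples:
  assumes k: "k < d" and i: "i < d"
  shows "\<kappa> * (\<Sum>j<d. \<Sum>l<d. U i j * U i l * U j l * expectation (\<lambda>x. P k j x * P k l x * (P k i x)\<^sup>2))
    = (real d - 4) * (\<Sum>j<d. U i j * expectation (\<lambda>x. (P k j x)\<^sup>2 * (P k i x)\<^sup>2))"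
proof -
  have "\<kappa> * (\<Sum>j<d. \<Sum>l<d. U i j * U i l * U j l * expectation (\<lambda>x. P k j x * P k l x * (P k i x)\<^sup>2))
    = (\<Sum>j<d. expectation (\<lambda>x. (P k j x)\<^sup>2 * (P k i x)\<^sup>2) * (\<Sum>l<d. U i j * U i l * U j l))"
  proof (rule E_pair_sum[OF k])
    show "(P k i (mmul d (rotor h c j l) x))\<^sup>2 = (P k i x)\<^sup>2"
      if "j < d" "l < d" "U i j \<noteq> 0" "U i l \<noteq> 0" "unrelated j l" "cmod c = 1" for j l c x
      using that i k unrelated_sym P_rotor_other[of j l k i c x] by (simp add: U_def)
  qed (auto intro: bm_intros simp: U_cases)
  also have "\<dots> = (\<Sum>j<d. expectation (\<lambda>x. (P k j x)\<^sup>2 * (P k i x)\<^sup>2) * (U i j * (real d - 4)))"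
  proof (intro sum.cong refl arg_cong2[of _ _ _ _ "(*)"])
    fix j assume "j \<in> {..<d}"
    then show "(\<Sum>l<d. U i j * U i l * U j l) = U i j * (real d - 4)"
      using sum_U2[of i j] i by (cases "unrelated i j") (auto simp: U_def)
  qed
  finally show ?thesis
    by (simp add: sum_distrib_left mult_ac)
qed

text \<open>The factor \<open>U j l\<close> on both sides makes the equation trivial for related j
  and l. Otherwise the selected rotors avoid both coordinates and their partners, so
  \<open>P k j x * P k l x\<close> is invariant.\<close>

lemma sum_E_quadruples:
  assumes k: "k < d" and jl: "j < d" "l < d"
  shows "\<kappa> * (\<Sum>i<d. \<Sum>m<d. (U j i * U l i) * (U j m * U l m) * U i m * expectation (\<lambda>x. P k i x * P k m x * (P k j x * P k l x))) * U j l
    = (real d - 6) * (\<Sum>i<d. U j i * U l i * expectation (\<lambda>x. (P k i x)\<^sup>2 * (P k j x * P k l x))) * U j l"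
proof (cases "unrelated j l")
  case True
  have "\<kappa> * (\<Sum>i<d. \<Sum>m<d. (U j i * U l i) * (U j m * U l m) * U i m * expectation (\<lambda>x. P k i x * P k m x * (P k j x * P k l x)))
    = (\<Sum>i<d. expectation (\<lambda>x. (P k i x)\<^sup>2 * (P k j x * P k l x)) * (\<Sum>m<d. (U j i * U l i) * (U j m * U l m) * U i m))"
  proof (rule E_pair_sum[OF k])
    show "P k j (mmul d (rotor h c i m) x) * P k l (mmul d (rotor h c i m) x) = P k j x * P k l x"
      if "i < d" "m < d" "U j i * U l i \<noteq> 0" "U j m * U l m \<noteq> 0" "unrelated i m" "cmod c = 1" for i m c x
      using that jl k unrelated_sym P_rotor_other[of i m k j c x] P_rotor_other[of i m k l c x] by (simp add: U_def)
    show "U j i * U l i = 0 \<or> U j i * U l i = 1" for i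
      using U_cases[of j i] U_cases[of l i] by auto
  qed (auto intro: bm_intros)
  also have "\<dots> = (\<Sum>i<d. expectation (\<lambda>x. (P k i x)\<^sup>2 * (P k j x * P k l x)) * (U j i * U l i * (real d - 6)))"
  proof (intro sum.cong refl arg_cong2[of _ _ _ _ "(*)"])
    fix i assume i: "i \<in> {..<d}"
    show "(\<Sum>m<d. (U j i * U l i) * (U j m * U l m) * U i m) = U j i * U l i * (real d - 6)"
    proof (cases "unrelated j i \<and> unrelated l i")
      case r: True
      then show ?thesis
        using sum_U3[of j l i] True jl i by (simp add: U_def)
    qed (auto simp: U_def)
  qed
  finally show ?thesis
    by (simp add: sum_distrib_left mult_ac)
qed (simp add: U_def)

lemma total_quadruples:
  assumes "k < d"
  shows "(\<Sum>j<d. \<Sum>l<d. \<Sum>i<d. \<Sum>m<d. expectation (\<lambda>x. P k i x * P k m x * (P k j x * P k l x))) = 1"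
proof -
  have "(\<Sum>i<d. \<Sum>m<d. expectation (\<lambda>x. P k i x * P k m x * (P k j x * P k l x))) = expectation (\<lambda>x. P k j x * P k l x)"
    for j l
  proof -
    have "(\<Sum>i<d. \<Sum>m<d. expectation (\<lambda>x. P k i x * P k m x * (P k j x * P k l x)))
      = expectation (\<lambda>x. \<Sum>i<d. \<Sum>m<d. P k i x * P k m x * (P k j x * P k l x))"
      by (subst E_sum, (intro bm_intros)+)+ (simp add: E_sum bm_intros)
    also have "\<dots> = expectation (\<lambda>x. P k j x * P k l x)"
      using sum_P[OF _ assms] by (intro E_cong) (simp flip: sum_product sum_distrib_right)
    finally show ?thesis .
  qed
  then show ?thesis
    using total_pairs[OF assms] by simp
qed

lemma E_quadruple_nonneg: "0 \<le> expectation (\<lambda>x. P k i x * P k m x * (P k j x * P k l x))"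
  by (intro Bochner_Integration.integral_nonneg) (simp add: P_nonneg)

text \<open>Each of the two squares is traded for a product over two different coordinates at the
  cost of a factor \<kappa>. What results is part of the fourth power of the column sum, which is 1.
  The factors d - 4 and d - 6 count the coordinates unrelated to two and to three given
  ones.\<close>

lemma sum_E_square_pairs_le:
  assumes k: "k < d"
  shows "(\<Sum>i<d. \<Sum>j<d. U i j * expectation (\<lambda>x. (P k j x)\<^sup>2 * (P k i x)\<^sup>2)) \<le> \<kappa>\<^sup>2 / ((real d - 4) * (real d - 6))"
proof -
  define A where "A = (\<Sum>i<d. \<Sum>j<d. U i j * expectation (\<lambda>x. (P k j x)\<^sup>2 * (P k i x)\<^sup>2))"
  define T where "T i j l = expectation (\<lambda>x. (P k i x)\<^sup>2 * (P k j x * P k l x))" for i j l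
  define Q where "Q i m j l = expectation (\<lambda>x. P k i x * P k m x * (P k j x * P k l x))" for i m j l
  have T_eq: "expectation (\<lambda>x. P k j x * P k l x * (P k i x)\<^sup>2) = T i j l" for i j l
    unfolding T_def by (simp add: mult.commute)
  have "(real d - 4) * A = (\<Sum>i<d. \<kappa> * (\<Sum>j<d. \<Sum>l<d. U i j * U i l * U j l * T i j l))"
    unfolding A_def using sum_E_triples[OF k] by (simp add: sum_distrib_left T_eq)
  also have "\<dots> = \<kappa> * (\<Sum>i<d. \<Sum>j<d. \<Sum>l<d. U i j * U i l * U j l * T i j l)"
    by (simp add: sum_distrib_left)
  also have "(\<Sum>i<d. \<Sum>j<d. \<Sum>l<d. U i j * U i l * U j l * T i j l)
      = (\<Sum>j<d. \<Sum>i<d. \<Sum>l<d. U i j * U i l * U j l * T i j l)"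
    by (rule sum.swap)
  also have "\<dots> = (\<Sum>j<d. \<Sum>l<d. \<Sum>i<d. U i j * U i l * U j l * T i j l)"
    by (intro sum.cong refl sum.swap)
  also have "\<dots> = (\<Sum>j<d. \<Sum>l<d. (\<Sum>i<d. U j i * U l i * T i j l) * U j l)"
    unfolding sum_distrib_right using U_sym by (intro sum.cong refl) simp
  finally have "(real d - 6) * ((real d - 4) * A)
      = \<kappa> * (\<Sum>j<d. \<Sum>l<d. (real d - 6) * (\<Sum>i<d. U j i * U l i * T i j l) * U j l)"
    by (simp add: sum_distrib_left mult_ac)
  also have "\<dots> = \<kappa> * (\<Sum>j<d. \<Sum>l<d. \<kappa> * (\<Sum>i<d. \<Sum>m<d. (U j i * U l i) * (U j m * U l m) * U i m * Q i m j l) * U j l)"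
    unfolding T_def Q_def
    by (rule arg_cong[of _ _ "\<lambda>s. \<kappa> * s"], rule sum.cong[OF refl], rule sum.cong[OF refl],
        rule sum_E_quadruples[OF k, symmetric]) auto
  also have "\<dots> = \<kappa>\<^sup>2 * (\<Sum>j<d. \<Sum>l<d. \<Sum>i<d. \<Sum>m<d. (U j i * U l i) * (U j m * U l m) * U i m * U j l * Q i m j l)"
    by (simp add: sum_distrib_left sum_distrib_right power2_eq_square mult_ac)
  also have "\<dots> \<le> \<kappa>\<^sup>2 * (\<Sum>j<d. \<Sum>l<d. \<Sum>i<d. \<Sum>m<d. Q i m j l)"
    using U_bounds E_quadruple_nonneg unfolding Q_def
    by (intro mult_left_mono sum_mono mult_left_le_one_le mult_le_one mult_nonneg_nonneg) auto
  also have "\<dots> = \<kappa>\<^sup>2"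
    using total_quadruples[OF k] by (simp add: Q_def)
  finally show ?thesis
    using d_ge unfolding A_def by (simp add: pos_le_divide_eq mult_ac)
qed

text \<open>The probability that two samples from column k coincide.\<close>

definition F :: "nat \<Rightarrow> cmat \<Rightarrow> real" where
  "F k x = (\<Sum>i<d. (P k i x)\<^sup>2)"

lemma bm_F: "bm (F k)"
  unfolding F_def[abs_def] by (intro bm_intros)

lemma E_F: "expectation (F k) = S k 2"
  unfolding F_def[abs_def] S_def by (rule E_sum) (intro bm_intros)

text \<open>The first term comes from unrelated pairs. Diagonal pairs give \<open>S k 4\<close> and
  partner pairs, by AM-GM, at most \<open>S k 4\<close> again, hence 270 = 2 * 135.\<close>

lemma E_F_square_le:
  assumes k: "k < d"
  shows "expectation (\<lambda>x. (F k x)\<^sup>2) \<le> \<kappa>\<^sup>2 / ((real d - 4) * (real d - 6)) + 270 / (real d - 2) ^ 3"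
proof -
  let ?e = "\<lambda>i j. expectation (\<lambda>x. (P k j x)\<^sup>2 * (P k i x)\<^sup>2)"
  let ?q = "\<lambda>i. expectation (\<lambda>x. P k i x ^ 4)"
  have pow: "(t\<^sup>2)\<^sup>2 = t ^ 4" for t :: real
    by (simp flip: power_mult)
  have split: "?e i j \<le> U i j * ?e i j + (if j = i then ?q i else 0)
      + (if j = partner h i then (?q i + ?q (partner h i)) / 2 else 0)"
    if "i < d" "j < d" for i j
  proof -
    have "?e i (partner h i) \<le> expectation (\<lambda>x. (1/2) * P k i x ^ 4 + (1/2) * P k (partner h i) x ^ 4)"
    proof (rule E_mono)
      show "(P k (partner h i) x)\<^sup>2 * (P k i x)\<^sup>2 \<le> (1/2) * P k i x ^ 4 + (1/2) * P k (partner h i) x ^ 4" for x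
        using sum_squares_bound[of "(P k i x)\<^sup>2" "(P k (partner h i) x)\<^sup>2"] unfolding pow by (simp add: mult_ac)
    qed (intro bm_intros)+
    also have "\<dots> = (?q i + ?q (partner h i)) / 2"
      by (subst E_add, (intro bm_intros)+) simp
    finally have *: "?e i (partner h i) \<le> (?q i + ?q (partner h i)) / 2" .
    have "?e i i = ?q i"
      by (rule E_cong) (simp flip: power_add)
    then show ?thesis
      using partner_d(2)[OF that(1)] * by (auto simp: U_def unrelated_def)
  qed
  have "expectation (\<lambda>x. (F k x)\<^sup>2) = expectation (\<lambda>x. \<Sum>i<d. \<Sum>j<d. (P k j x)\<^sup>2 * (P k i x)\<^sup>2)"
    by (rule E_cong) (simp add: F_def power2_eq_square[of "\<Sum>i<d. _ i"] sum_product mult.commute)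
  also have "\<dots> = (\<Sum>i<d. \<Sum>j<d. ?e i j)"
    by (subst E_sum, (intro bm_intros)+)+ (simp add: E_sum bm_intros)
  also have "\<dots> \<le> (\<Sum>i<d. \<Sum>j<d. U i j * ?e i j + (if j = i then ?q i else 0)
      + (if j = partner h i then (?q i + ?q (partner h i)) / 2 else 0))"
    by (intro sum_mono split) auto
  also have "\<dots> = (\<Sum>i<d. \<Sum>j<d. U i j * ?e i j) + S k 4 + (\<Sum>i<d. (?q i + ?q (partner h i)) / 2)"
    using partner_d(1) by (simp add: sum.distrib S_def)
  also have "(\<Sum>i<d. (?q i + ?q (partner h i)) / 2) = S k 4"
    using sum_partner[of ?q] by (simp add: S_def sum.distrib add_divide_distrib flip: sum_divide_distrib)
  finally show ?thesis
    using sum_E_square_pairs_le[OF k] S4_le[OF k] by simp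
qed

text \<open>Expanding the square requires the second moment of F from above and its mean from below.
  The bounds agree to leading order, so the right-hand side tends to 0 as d grows.\<close>

lemma E_F_deviation:
  assumes k: "k < d"
  shows "expectation (\<lambda>x. (real d * F k x - \<kappa>)\<^sup>2)
    \<le> (real d)\<^sup>2 * (\<kappa>\<^sup>2 / ((real d - 4) * (real d - 6)) + 270 / (real d - 2) ^ 3)
      - 2 * \<kappa> * real d * (\<kappa> / (real d - 2 + 2 * \<kappa>)) + \<kappa>\<^sup>2"
proof -
  have "expectation (\<lambda>x. (real d * F k x - \<kappa>)\<^sup>2)
      = expectation (\<lambda>x. (real d)\<^sup>2 * (F k x)\<^sup>2 - (2 * \<kappa> * real d) * F k x + \<kappa>\<^sup>2)"
    by (rule E_cong) (simp add: power2_eq_square algebra_simps)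
  also have "\<dots> = (real d)\<^sup>2 * expectation (\<lambda>x. (F k x)\<^sup>2) - (2 * \<kappa> * real d) * S k 2 + \<kappa>\<^sup>2"
    by (subst E_add E_diff, (intro bm_intros bm_F)+)+ (simp add: E_F prob_space)
  also have "\<dots> \<le> (real d)\<^sup>2 * (\<kappa>\<^sup>2 / ((real d - 4) * (real d - 6)) + 270 / (real d - 2) ^ 3)
      - 2 * \<kappa> * real d * (\<kappa> / (real d - 2 + 2 * \<kappa>)) + \<kappa>\<^sup>2"
    using kappa_cases by (intro add_right_mono diff_mono mult_left_mono E_F_square_le S2_ge k) auto
  finally show ?thesis .
qed

end

section \<open>Partner overlap of two columns under row exchanges\<close>

context rotor_invariant
begin

context
  fixes a b :: nat
  assumes ab: "a < d" "b < d"
    and trans_G: "\<And>k l. k < d \<Longrightarrow> l < d \<Longrightarrow> k \<noteq> l \<Longrightarrow> transposition_mat d k l \<in> G"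
begin

lemma P_transposition:
  assumes "k < d" "l < d" "k \<noteq> l" "c < d" "m < d"
  shows "P c m (mmul d (transposition_mat d k l) x) = P c (if m = k then l else if m = l then k else m) x"
  unfolding P_def using transposition_mat_mmul[OF assms(1-3,5,4)] by simp

text \<open>A transposition permutes the rows of both columns at once, so the row read in column b
  can be moved freely as long as the row read in column a stays put.\<close>

lemma E_exchange2:
  assumes "i < d" "j < d" "l < d" "i \<noteq> j" "i \<noteq> l"
  shows "expectation (\<lambda>x. P a i x * P b j x) = expectation (\<lambda>x. P a i x * P b l x)"
proof (cases "j = l")
  case False
  have "expectation (\<lambda>x. P a i x * P b j x)
    = expectation (\<lambda>x. P a i (mmul d (transposition_mat d j l) x) * P b j (mmul d (transposition_mat d j l) x))"
    by (rule E_translate[symmetric], intro bm_intros) (use assms False trans_G in auto)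
  also have "\<dots> = expectation (\<lambda>x. P a i x * P b l x)"
    using assms False ab by (simp add: P_transposition)
  finally show ?thesis .
qed simp

lemma E_exchange3:
  assumes "i < d" "j < d" "k < d" "l < d" "k \<notin> {i, j}" "l \<notin> {i, j}"
  shows "expectation (\<lambda>x. P a i x * P a j x * P b k x) = expectation (\<lambda>x. P a i x * P a j x * P b l x)"
proof (cases "k = l")
  case False
  have "expectation (\<lambda>x. P a i x * P a j x * P b k x)
    = expectation (\<lambda>x. P a i (mmul d (transposition_mat d k l) x) * P a j (mmul d (transposition_mat d k l) x)
        * P b k (mmul d (transposition_mat d k l) x))"
    by (rule E_translate[symmetric], intro bm_intros) (use assms False trans_G in auto)
  also have "\<dots> = expectation (\<lambda>x. P a i x * P a j x * P b l x)"
    using assms False ab by (simp add: P_transposition)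
  finally show ?thesis .
qed simp

lemma E_exchange4:
  assumes "i < d" "j < d" "k < d" "l < d" "m < d" "l \<notin> {i, j, k}" "m \<notin> {i, j, k}"
  shows "expectation (\<lambda>x. P a i x * P a j x * P b k x * P b l x) = expectation (\<lambda>x. P a i x * P a j x * P b k x * P b m x)"
proof (cases "l = m")
  case False
  have "expectation (\<lambda>x. P a i x * P a j x * P b k x * P b l x)
    = expectation (\<lambda>x. P a i (mmul d (transposition_mat d l m) x) * P a j (mmul d (transposition_mat d l m) x)
        * P b k (mmul d (transposition_mat d l m) x) * P b l (mmul d (transposition_mat d l m) x))"
    by (rule E_translate[symmetric], intro bm_intros) (use assms False trans_G in auto)
  also have "\<dots> = expectation (\<lambda>x. P a i x * P a j x * P b k x * P b m x)"
    using assms False ab by (simp add: P_transposition)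
  finally show ?thesis .
qed simp

lemma sum_E_weighted_le:
  assumes "bm X" "\<And>x. 0 \<le> X x" "L \<subseteq> {..<d}"
  shows "(\<Sum>l\<in>L. expectation (\<lambda>x. X x * P b l x)) \<le> expectation X"
proof -
  have "(\<Sum>l\<in>L. expectation (\<lambda>x. X x * P b l x)) \<le> (\<Sum>l<d. expectation (\<lambda>x. X x * P b l x))"
    using assms P_nonneg by (intro sum_mono2 Bochner_Integration.integral_nonneg mult_nonneg_nonneg) auto
  also have "\<dots> = expectation (\<lambda>x. \<Sum>l<d. X x * P b l x)"
    by (rule E_sum[symmetric]) (intro bm_intros assms(1))
  also have "\<dots> = expectation X"
    using sum_P[OF _ ab(2)] by (intro E_cong) (simp flip: sum_distrib_left)
  finally show ?thesis .
qed

text \<open>By exchange symmetry l can be averaged over the d - 3 rows outside {i, j, k}, then k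
  over the d - 2 rows outside {i, j}; each time the weights of column b sum to at most 1.\<close>

lemma E_four_le:
  assumes "i < d" "j < d" "k < d" "l < d" "i \<noteq> j" "k \<notin> {i, j}" "l \<notin> {i, j, k}"
  shows "expectation (\<lambda>x. P a i x * P a j x * P b k x * P b l x)
    \<le> expectation (\<lambda>x. P a i x * P a j x) / ((real d - 2) * (real d - 3))"
proof -
  have "(real d - 3) * expectation (\<lambda>x. P a i x * P a j x * P b k x * P b l x)
      = (\<Sum>m\<in>{..<d} - {i, j, k}. expectation (\<lambda>x. P a i x * P a j x * P b k x * P b l x))"
    using assms d_ge by (simp add: card_Diff_subset)
  also have "\<dots> = (\<Sum>m\<in>{..<d} - {i, j, k}. expectation (\<lambda>x. P a i x * P a j x * P b k x * P b m x))"
    by (intro sum.cong refl E_exchange4) (use assms in auto)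
  also have "\<dots> \<le> expectation (\<lambda>x. P a i x * P a j x * P b k x)"
    by (rule sum_E_weighted_le) (auto intro!: bm_intros simp: P_nonneg)
  finally have 1: "(real d - 3) * expectation (\<lambda>x. P a i x * P a j x * P b k x * P b l x)
      \<le> expectation (\<lambda>x. P a i x * P a j x * P b k x)" .
  have "(real d - 2) * expectation (\<lambda>x. P a i x * P a j x * P b k x)
      = (\<Sum>m\<in>{..<d} - {i, j}. expectation (\<lambda>x. P a i x * P a j x * P b k x))"
    using assms d_ge by (simp add: card_Diff_subset)
  also have "\<dots> = (\<Sum>m\<in>{..<d} - {i, j}. expectation (\<lambda>x. P a i x * P a j x * P b m x))"
    by (intro sum.cong refl E_exchange3) (use assms in auto)
  also have "\<dots> \<le> expectation (\<lambda>x. P a i x * P a j x)"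
    by (rule sum_E_weighted_le) (auto intro!: bm_intros simp: P_nonneg)
  finally have "(real d - 2) * ((real d - 3) * expectation (\<lambda>x. P a i x * P a j x * P b k x * P b l x))
      \<le> expectation (\<lambda>x. P a i x * P a j x)"
    using 1 d_ge by (smt (verit) mult_left_mono)
  then show ?thesis
    using d_ge by (simp add: pos_le_divide_eq mult_ac)
qed

lemma bm_overlap: "bm (\<lambda>x. \<Sum>i<d. P a i x * P b (partner h i) x)"
  by (intro bm_intros)

text \<open>The partner row can be replaced by any of the d - 1 rows other than i, so the sum over
  them is the full column sum less the diagonal term. By AM-GM the diagonal terms total at most the
  mean of the two second power sums.\<close>

lemma E_overlap_ge:
  "expectation (\<lambda>x. \<Sum>i<d. P a i x * P b (partner h i) x) \<ge> (1 - 3 / (real d - 2)) / (real d - 1)"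
proof -
  have one: "(real d - 1) * expectation (\<lambda>x. P a i x * P b (partner h i) x)
      = expectation (\<lambda>x. P a i x) - expectation (\<lambda>x. P a i x * P b i x)" if i: "i < d" for i
  proof -
    have "(real d - 1) * expectation (\<lambda>x. P a i x * P b (partner h i) x)
        = (\<Sum>j\<in>{..<d} - {i}. expectation (\<lambda>x. P a i x * P b (partner h i) x))"
      using i d_ge by (simp add: card_Diff_subset)
    also have "\<dots> = (\<Sum>j\<in>{..<d} - {i}. expectation (\<lambda>x. P a i x * P b j x))"
      by (intro sum.cong refl E_exchange2) (use i partner_d in force)+
    also have "\<dots> = (\<Sum>j<d. expectation (\<lambda>x. P a i x * P b j x)) - expectation (\<lambda>x. P a i x * P b i x)"
      using i by (simp add: sum_diff1)
    also have "(\<Sum>j<d. expectation (\<lambda>x. P a i x * P b j x)) = expectation (\<lambda>x. \<Sum>j<d. P a i x * P b j x)"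
      by (rule E_sum[symmetric]) (intro bm_intros)
    also have "\<dots> = expectation (\<lambda>x. P a i x)"
      using sum_P[OF _ ab(2)] by (intro E_cong) (simp flip: sum_distrib_left)
    finally show ?thesis .
  qed
  have "(\<Sum>i<d. expectation (\<lambda>x. P a i x * P b i x)) \<le> (\<Sum>i<d. (expectation (\<lambda>x. P a i x ^ 2) + expectation (\<lambda>x. P b i x ^ 2)) / 2)"
  proof (intro sum_mono)
    fix i
    have "expectation (\<lambda>x. P a i x * P b i x) \<le> expectation (\<lambda>x. (1/2) * P a i x ^ 2 + (1/2) * P b i x ^ 2)"
    proof (rule E_mono)
      show "P a i x * P b i x \<le> (1/2) * P a i x ^ 2 + (1/2) * P b i x ^ 2" for x
        using sum_squares_bound[of "P a i x" "P b i x"] by simp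
    qed (intro bm_intros)+
    also have "\<dots> = (expectation (\<lambda>x. P a i x ^ 2) + expectation (\<lambda>x. P b i x ^ 2)) / 2"
      by (subst E_add, (intro bm_intros)+) simp
    finally show "expectation (\<lambda>x. P a i x * P b i x) \<le> (expectation (\<lambda>x. P a i x ^ 2) + expectation (\<lambda>x. P b i x ^ 2)) / 2" .
  qed
  also have "\<dots> = (S a 2 + S b 2) / 2"
    by (simp add: S_def sum.distrib add_divide_distrib flip: sum_divide_distrib)
  also have "\<dots> \<le> 3 / (real d - 2)"
    using S2_le[OF ab(1)] S2_le[OF ab(2)] by simp
  finally have diag: "(\<Sum>i<d. expectation (\<lambda>x. P a i x * P b i x)) \<le> 3 / (real d - 2)" .
  have "(\<Sum>i<d. expectation (\<lambda>x. P a i x)) = expectation (\<lambda>x. \<Sum>i<d. P a i x)"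
    by (rule E_sum[symmetric]) (intro bm_intros)
  also have "\<dots> = expectation (\<lambda>x. 1)"
    by (intro E_cong sum_P ab)
  finally have tot: "(\<Sum>i<d. expectation (\<lambda>x. P a i x)) = 1"
    by (simp add: prob_space)
  have "(real d - 1) * expectation (\<lambda>x. \<Sum>i<d. P a i x * P b (partner h i) x)
      = (\<Sum>i<d. (real d - 1) * expectation (\<lambda>x. P a i x * P b (partner h i) x))"
    by (subst E_sum) (auto intro: bm_intros simp: sum_distrib_left)
  also have "\<dots> = (\<Sum>i<d. expectation (\<lambda>x. P a i x) - expectation (\<lambda>x. P a i x * P b i x))"
    by (intro sum.cong refl one) simp
  also have "\<dots> \<ge> 1 - 3 / (real d - 2)"
    using diag tot by (simp add: sum_subtractf)
  finally show ?thesis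
    using d_ge by (simp add: pos_divide_le_eq mult.commute)
qed

text \<open>For unrelated i and j the four rows involved are suitable for \<open>E_four_le\<close>.
  The cases of equal and of partner rows each total at most the mean of the fourth power sums of the
  two columns, hence 270 = 2 * 135.\<close>

lemma E_overlap_square_le:
  "expectation (\<lambda>x. (\<Sum>i<d. P a i x * P b (partner h i) x)\<^sup>2)
    \<le> 1 / ((real d - 2) * (real d - 3)) + 270 / (real d - 2) ^ 3"
proof -
  let ?e = "\<lambda>i j. expectation (\<lambda>x. P a i x * P a j x * P b (partner h i) x * P b (partner h j) x)"
  let ?q = "\<lambda>i. expectation (\<lambda>x. P a i x ^ 4)" and ?r = "\<lambda>i. expectation (\<lambda>x. P b i x ^ 4)"
  let ?D = "(real d - 2) * (real d - 3)"
  define Z where "Z i = (?q i + ?r i + ?q (partner h i) + ?r (partner h i)) / 4" for i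
  have amgm: "s * t * u * v \<le> (1/4) * s ^ 4 + (1/4) * t ^ 4 + (1/4) * u ^ 4 + (1/4) * v ^ 4" for s t u v :: real
  proof -
    have "2 * ((s * t) * (u * v)) \<le> (s * t)\<^sup>2 + (u * v)\<^sup>2"
      using sum_squares_bound[of "s * t" "u * v"] by simp
    moreover have "2 * (s\<^sup>2 * t\<^sup>2) \<le> (s\<^sup>2)\<^sup>2 + (t\<^sup>2)\<^sup>2" "2 * (u\<^sup>2 * v\<^sup>2) \<le> (u\<^sup>2)\<^sup>2 + (v\<^sup>2)\<^sup>2"
      using sum_squares_bound[of "s\<^sup>2" "t\<^sup>2"] sum_squares_bound[of "u\<^sup>2" "v\<^sup>2"] by simp_all
    ultimately show ?thesis
      by (simp add: power_mult_distrib mult.assoc flip: power_mult)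
  qed
  have E_amgm: "expectation (\<lambda>x. P a i x * P a j x * P b k x * P b l x) \<le> (?q i + ?q j + ?r k + ?r l) / 4" for i j k l
  proof -
    have "expectation (\<lambda>x. P a i x * P a j x * P b k x * P b l x)
      \<le> expectation (\<lambda>x. (1/4) * P a i x ^ 4 + (1/4) * P a j x ^ 4 + (1/4) * P b k x ^ 4 + (1/4) * P b l x ^ 4)"
      by (rule E_mono[OF _ _ amgm]) (intro bm_intros)+
    also have "\<dots> = (?q i + ?q j + ?r k + ?r l) / 4"
      by (subst E_add, (intro bm_intros)+)+ simp
    finally show ?thesis .
  qed
  have split: "?e i j \<le> expectation (\<lambda>x. P a i x * P a j x) / ?D
      + (if j = i then (?q i + ?r (partner h i)) / 2 else 0) + (if j = partner h i then Z i else 0)"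
    if "i < d" "j < d" for i j
  proof -
    have 0: "0 \<le> expectation (\<lambda>x. P a i x * P a j x) / ?D"
      using d_ge by (intro divide_nonneg_nonneg Bochner_Integration.integral_nonneg) (auto simp: P_nonneg)
    consider "unrelated i j" | "j = i" | "j = partner h i"
      by (auto simp: unrelated_def)
    then show ?thesis
    proof cases
      case 1
      then show ?thesis
        using E_four_le[of i j "partner h i" "partner h j"] unrelatedD[OF 1 that] that partner_d by simp
    next
      case 2
      have *: "?e i i \<le> (?q i + ?r (partner h i)) / 2"
        by (rule order_trans[OF E_amgm]) simp
      have n: "(i = partner h i) = False"
        using partner_d(2)[OF that(1)] by metis
      show ?thesis
        using add_increasing[OF 0[unfolded 2] *] unfolding 2 n by (simp only: simp_thms if_True if_False add_0_right)
    next
      case 3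
      have *: "?e i (partner h i) \<le> Z i"
        unfolding partner_d(3)[OF that(1)] Z_def by (rule order_trans[OF E_amgm]) simp
      have n: "(partner h i = i) = False"
        using partner_d(2)[OF that(1)] by metis
      show ?thesis
        using add_increasing[OF 0[unfolded 3] *] unfolding 3 n by (simp only: simp_thms if_True if_False add_0_right)
    qed
  qed
  have "expectation (\<lambda>x. (\<Sum>i<d. P a i x * P b (partner h i) x)\<^sup>2)
      = expectation (\<lambda>x. \<Sum>i<d. \<Sum>j<d. P a i x * P a j x * P b (partner h i) x * P b (partner h j) x)"
    by (rule E_cong) (simp add: power2_eq_square sum_product mult_ac)
  also have "\<dots> = (\<Sum>i<d. \<Sum>j<d. ?e i j)"
    by (subst E_sum, (intro bm_intros)+)+ (simp add: E_sum bm_intros)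
  also have "\<dots> \<le> (\<Sum>i<d. \<Sum>j<d. expectation (\<lambda>x. P a i x * P a j x) / ?D
      + (if j = i then (?q i + ?r (partner h i)) / 2 else 0) + (if j = partner h i then Z i else 0))"
    by (intro sum_mono split) auto
  also have "\<dots> = 1 / ?D + (\<Sum>i<d. (?q i + ?r (partner h i)) / 2) + (\<Sum>i<d. Z i)"
    using total_pairs[OF ab(1)] partner_d(1) by (simp add: sum.distrib flip: sum_divide_distrib)
  also have "(\<Sum>i<d. (?q i + ?r (partner h i)) / 2) = (S a 4 + S b 4) / 2"
    using sum_partner[of ?r] by (simp add: S_def sum.distrib flip: sum_divide_distrib)
  also have "(\<Sum>i<d. Z i) = (S a 4 + S b 4) / 2"
    using sum_partner[of ?r] sum_partner[of ?q] by (simp add: Z_def S_def sum.distrib flip: sum_divide_distrib)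
  finally show ?thesis
    using S4_le[OF ab(1)] S4_le[OF ab(2)] by simp
qed

lemma E_overlap_deviation:
  "expectation (\<lambda>x. (real d * (\<Sum>i<d. P a i x * P b (partner h i) x) - 1)\<^sup>2)
    \<le> (real d)\<^sup>2 * (1 / ((real d - 2) * (real d - 3)) + 270 / (real d - 2) ^ 3)
      - 2 * real d * ((1 - 3 / (real d - 2)) / (real d - 1)) + 1"
proof -
  define f where "f x = (\<Sum>i<d. P a i x * P b (partner h i) x)" for x
  have bm_f: "bm f"
    unfolding f_def[abs_def] by (rule bm_overlap)
  have "expectation (\<lambda>x. (real d * f x - 1)\<^sup>2)
      = expectation (\<lambda>x. (real d)\<^sup>2 * (f x)\<^sup>2 - (2 * real d) * f x + 1)"
    by (rule E_cong) (simp add: power2_eq_square algebra_simps)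
  also have "\<dots> = (real d)\<^sup>2 * expectation (\<lambda>x. (f x)\<^sup>2) - (2 * real d) * expectation f + 1"
    by (subst E_add E_diff, (intro bm_intros bm_f)+)+ (simp add: prob_space)
  also have "\<dots> \<le> (real d)\<^sup>2 * (1 / ((real d - 2) * (real d - 3)) + 270 / (real d - 2) ^ 3)
      - 2 * real d * ((1 - 3 / (real d - 2)) / (real d - 1)) + 1"
    unfolding f_def[abs_def]
    by (intro add_right_mono diff_mono mult_left_mono E_overlap_square_le E_overlap_ge) auto
  finally show ?thesis
    unfolding f_def .
qed

end

end

section \<open>The collision learner\<close>

text \<open>Expectation of F over the final history for independent rounds. It models
  \<open>succ\<close> because the inputs of the learner depend on the length of the history
  only.\<close>

fun run :: "(nat \<Rightarrow> nat \<Rightarrow> real) \<Rightarrow> nat \<Rightarrow> (nat list \<Rightarrow> real) \<Rightarrow> nat \<Rightarrow> nat list \<Rightarrow> real" where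
  "run w D F 0 h = F h"
| "run w D F (Suc t) h = (\<Sum>s<D. w (length h) s * run w D F t (h @ [s]))"

text \<open>The recursion peels off the first round, whereas induction on blocks has to remove the
  last.\<close>

lemma run_Suc_last:
  "run w D F (Suc t) h = run w D (\<lambda>h'. \<Sum>s<D. w (length h') s * F (h' @ [s])) t h"
proof (induction t arbitrary: h)
  case (Suc t)
  show ?case
    by (subst run.simps(2), subst Suc.IH, subst run.simps(2)) (rule refl)
qed simp

lemma run_cong:
  "(\<And>h'. length h' = length h + t \<Longrightarrow> F h' = F' h') \<Longrightarrow> run w D F t h = run w D F' t h"
proof (induction t arbitrary: h)
  case (Suc t)
  have "run w D F t (h @ [s]) = run w D F' t (h @ [s])" for s
    using Suc.prems by (intro Suc.IH) simp
  then show ?case by simp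
qed simp

lemma run_mono:
  assumes "\<And>t s. 0 \<le> w t s" "\<And>h. F h \<le> F' h"
  shows "run w D F t h \<le> run w D F' t h"
  using assms by (induction t arbitrary: h) (auto intro!: sum_mono mult_left_mono)

lemma run_add: "run w D (\<lambda>h. F h + F' h) t h = run w D F t h + run w D F' t h"
  by (induction t arbitrary: h) (simp_all add: distrib_left sum.distrib)

lemma run_cmult: "run w D (\<lambda>h. c * F h) t h = c * run w D F t h"
  by (induction t arbitrary: h) (simp_all add: sum_distrib_left mult_ac)

lemma run_const:
  assumes "\<And>t. (\<Sum>s<D. w t s) = 1"
  shows "run w D (\<lambda>h. c) t h = c"
  using assms by (induction t arbitrary: h) (simp_all flip: sum_distrib_right)

definition block_count :: "(nat \<Rightarrow> nat \<Rightarrow> nat \<Rightarrow> bool) \<Rightarrow> nat \<Rightarrow> nat list \<Rightarrow> real" where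
  "block_count R J h = (\<Sum>j<J. of_bool (R j (h ! (2 * j)) (h ! (2 * j + 1))))"

definition block_prob :: "(nat \<Rightarrow> nat \<Rightarrow> real) \<Rightarrow> nat \<Rightarrow> (nat \<Rightarrow> nat \<Rightarrow> nat \<Rightarrow> bool) \<Rightarrow> nat \<Rightarrow> real" where
  "block_prob w D R j = (\<Sum>s<D. \<Sum>s'<D. w (2 * j) s * w (2 * j + 1) s' * of_bool (R j s s'))"

text \<open>The counts of independent events: \<open>E(Y - a)\<^sup>2 = (E Y - a)\<^sup>2 + Var Y\<close>; absorbing the mean of
  the last block into the constant a makes the induction go through.\<close>

lemma run_block_count_square:
  assumes w: "\<And>t. (\<Sum>s<D. w t s) = 1"
  shows "run w D (\<lambda>h. (block_count R J h - a)\<^sup>2) (2 * J) []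
    = ((\<Sum>j<J. block_prob w D R j) - a)\<^sup>2 + (\<Sum>j<J. block_prob w D R j * (1 - block_prob w D R j))"
proof (induction J arbitrary: a)
  case 0
  show ?case by (simp add: block_count_def)
next
  case (Suc J)
  define f where "f = block_prob w D R J"
  have step: "(\<Sum>s<D. w (length h) s * (\<Sum>s'<D. w (length (h @ [s])) s' * (block_count R (Suc J) ((h @ [s]) @ [s']) - a)\<^sup>2))
      = (block_count R J h - (a - f))\<^sup>2 + f * (1 - f)" if h: "length h = 2 * J" for h
  proof -
    define y where "y = block_count R J h - a"
    have cnt: "block_count R (Suc J) ((h @ [s]) @ [s']) - a = y + of_bool (R J s s')" for s s'
    proof -
      have "block_count R J (h @ [s, s']) = block_count R J h"
        unfolding block_count_def using h by (intro sum.cong refl) (simp add: nth_append)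
      moreover have "(h @ [s, s']) ! (2 * J) = s" "(h @ [s, s']) ! (2 * J + 1) = s'"
        using h by (simp_all add: nth_append)
      ultimately show ?thesis
        by (simp add: block_count_def y_def)
    qed
    \<comment> \<open>An indicator b equals its square, so (y + b)^2 = y^2 + (2 y + 1) b is affine
      in b.\<close>
    have "(\<Sum>s<D. w (length h) s * (\<Sum>s'<D. w (length (h @ [s])) s' * (block_count R (Suc J) ((h @ [s]) @ [s']) - a)\<^sup>2))
        = (\<Sum>s<D. \<Sum>s'<D. y\<^sup>2 * (w (2 * J) s * w (2 * J + 1) s')
          + (2 * y + 1) * (w (2 * J) s * w (2 * J + 1) s' * of_bool (R J s s')))"
      unfolding cnt sum_distrib_left using h
      by (intro sum.cong refl) (auto simp: power2_eq_square algebra_simps)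
    also have "\<dots> = y\<^sup>2 * (\<Sum>s<D. \<Sum>s'<D. w (2 * J) s * w (2 * J + 1) s') + (2 * y + 1) * f"
      unfolding f_def block_prob_def by (simp only: sum.distrib sum_distrib_left)
    also have "(\<Sum>s<D. \<Sum>s'<D. w (2 * J) s * w (2 * J + 1) s') = 1"
      by (simp add: w flip: sum_product)
    finally show ?thesis
      by (simp add: y_def power2_eq_square algebra_simps)
  qed
  have "run w D (\<lambda>h. (block_count R (Suc J) h - a)\<^sup>2) (2 * Suc J) []
      = run w D (\<lambda>h. (block_count R J h - (a - f))\<^sup>2 + f * (1 - f)) (2 * J) []"
    unfolding mult_Suc_right add_2_eq_Suc run_Suc_last by (rule run_cong) (use step in simp)
  also have "\<dots> = ((\<Sum>j<J. block_prob w D R j) - (a - f))\<^sup>2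
      + (\<Sum>j<J. block_prob w D R j * (1 - block_prob w D R j)) + f * (1 - f)"
    unfolding run_add Suc.IH by (simp add: run_const[OF w])
  finally show ?case
    by (simp add: f_def algebra_simps)
qed

lemma run_block_count_square_le:
  assumes w: "\<And>t. (\<Sum>s<D. w t s) = 1"
  shows "run w D (\<lambda>h. (block_count R J h - a)\<^sup>2) (2 * J) []
    \<le> ((\<Sum>j<J. block_prob w D R j) - a)\<^sup>2 + (\<Sum>j<J. block_prob w D R j)"
proof -
  have "block_prob w D R j * (1 - block_prob w D R j) \<le> block_prob w D R j" for j
    using zero_le_square[of "block_prob w D R j"] by (simp add: algebra_simps)
  then show ?thesis
    unfolding run_block_count_square[OF w] by (intro add_left_mono sum_mono)
qed

section \<open>The learner and its outcome distribution\<close>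

definition basis_vec :: "nat \<Rightarrow> cvec" where
  "basis_vec c = (\<lambda>i. if i = c then 1 else 0)"

definition basis_proj :: "nat \<Rightarrow> cmat" where
  "basis_proj s = (\<lambda>i j. if i = s \<and> j = s then 1 else 0)"

text \<open>Rounds are grouped into blocks of two. The first B blocks use the input pair \<open>(e\<^sub>0, e\<^sub>0)\<close> and
  count equal outcomes, the next B blocks use \<open>(e\<^sub>0, e\<^sub>h)\<close> and count outcomes that are partners.\<close>

definition input_col :: "nat \<Rightarrow> nat \<Rightarrow> nat \<Rightarrow> nat" where
  "input_col h B t = (if t < 2 * B \<or> even t then 0 else h)"

definition equal_event :: "nat \<Rightarrow> nat \<Rightarrow> nat \<Rightarrow> nat \<Rightarrow> bool" where
  "equal_event B j s s' \<longleftrightarrow> j < B \<and> s' = s"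

definition partner_event :: "nat \<Rightarrow> nat \<Rightarrow> nat \<Rightarrow> nat \<Rightarrow> nat \<Rightarrow> bool" where
  "partner_event h B j s s' \<longleftrightarrow> B \<le> j \<and> s' = partner h s"

text \<open>For B = 100 d the equality count is near 300 or 200 and the partner count near 200 or
  100, so 250 and 150 lie midway. Equality is tested first: it singles out the orthogonal case, for
  which no estimate of the partner count is made.\<close>

definition collision_learner :: "nat \<Rightarrow> nat \<Rightarrow> nat \<Rightarrow> learner" where
  "collision_learner D h B = \<lparr>seed = return_pmf 0, aux = (\<lambda>_ _. 0),
     inp = (\<lambda>_ hist. basis_vec (input_col h B (length hist))),
     povm = (\<lambda>_ _. map basis_proj [0..<D]),
     answer = (\<lambda>_ hist. if block_count (equal_event B) (2 * B) hist \<ge> 250 then OrthogonalC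
        else if block_count (partner_event h B) (2 * B) hist \<ge> 150 then SymplecticC else UnitaryC)\<rparr>"

lemma psd_basis_proj:
  assumes "s < D"
  shows "psd D (basis_proj s)"
  unfolding psd_def
proof (intro conjI allI)
  show "is_mat D (basis_proj s)"
    using assms by (auto simp: is_mat_def basis_proj_def)
  show "basis_proj s i j = cnj (basis_proj s j i)" for i j
    by (auto simp: basis_proj_def)
  fix v :: cvec
  have "(\<Sum>i<D. \<Sum>j<D. cnj (v i) * basis_proj s i j * v j) = (\<Sum>i<D. if i = s then cnj (v s) * v s else 0)"
  proof (rule sum.cong)
    fix i
    have "(\<Sum>j<D. cnj (v i) * basis_proj s i j * v j) = (\<Sum>j<D. if j = s then (if i = s then cnj (v s) * v s else 0) else 0)"
      by (rule sum.cong) (auto simp: basis_proj_def)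
    then show "(\<Sum>j<D. cnj (v i) * basis_proj s i j * v j) = (if i = s then cnj (v s) * v s else 0)"
      using assms by simp
  qed simp
  also have "\<dots> = cnj (v s) * v s"
    using assms by simp
  finally show "0 \<le> Re (\<Sum>i<D. \<Sum>j<D. cnj (v i) * basis_proj s i j * v j)"
    by simp
qed

lemma valid_collision_learner:
  assumes "h < 2 ^ n"
  shows "valid_learner n (collision_learner (2 ^ n) h B)"
proof -
  have c: "input_col h B t < 2 ^ n" for t
    using assms by (simp add: input_col_def)
  have 1: "(\<Sum>i<2 ^ n. (cmod (basis_vec c i))\<^sup>2) = 1" if "c < 2 ^ n" for c
  proof -
    have "(\<Sum>i<2 ^ n. (cmod (basis_vec c i))\<^sup>2) = (\<Sum>i<2 ^ n. if i = c then 1 else 0)"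
      by (rule sum.cong) (auto simp: basis_vec_def)
    then show ?thesis using that by simp
  qed
  have 2: "(\<Sum>s<2 ^ n. (map basis_proj [0..<2 ^ n] ! s) i j) = idm (2 ^ n) i j" for i j
  proof -
    have "(\<Sum>s<2 ^ n. (map basis_proj [0..<2 ^ n] ! s) i j) = (\<Sum>s<2 ^ n. if s = i then (if j = i then 1 else 0) else 0)"
      by (rule sum.cong) (auto simp: basis_proj_def)
    then show ?thesis by (simp add: idm_def)
  qed
  show ?thesis
    unfolding valid_learner_def collision_learner_def Let_def
    using not_le[THEN iffD2, OF c] 1[OF c] 2 psd_basis_proj by (auto simp: basis_vec_def)
qed

lemma collision_round_prob:
  assumes "s < 2 ^ n" "input_col h B (length hist) < 2 ^ n"
  shows "round_prob n C (collision_learner (2 ^ n) h B) r hist s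
    = Re (C (proj (2 ^ n) (basis_vec (input_col h B (length hist)))) s s)"
proof -
  let ?\<rho> = "proj (2 ^ n) (basis_vec (input_col h B (length hist)))"
  have rho: "(\<lambda>a b. if a < 2 ^ n \<and> b < 2 ^ n then ?\<rho> a b else 0) = ?\<rho>"
    by (intro ext) (auto simp: proj_def)
  have "round_prob n C (collision_learner (2 ^ n) h B) r hist s
      = Re (\<Sum>i<2 ^ n. \<Sum>k<2 ^ n. basis_proj s i k * C ?\<rho> k i)"
    using assms(1) by (simp add: round_prob_def collision_learner_def mtrace_def mmul_def ext_id_def rho Let_def cong: if_cong)
  also have "(\<Sum>i<2 ^ n. \<Sum>k<2 ^ n. basis_proj s i k * C ?\<rho> k i) = (\<Sum>i<2 ^ n. if i = s then C ?\<rho> s s else 0)"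
  proof (rule sum.cong)
    fix i
    have "(\<Sum>k<2 ^ n. basis_proj s i k * C ?\<rho> k i) = (\<Sum>k<2 ^ n. if k = s then (if i = s then C ?\<rho> s s else 0) else 0)"
      by (rule sum.cong) (auto simp: basis_proj_def)
    then show "(\<Sum>k<2 ^ n. basis_proj s i k * C ?\<rho> k i) = (if i = s then C ?\<rho> s s else 0)"
      using assms(1) by simp
  qed simp
  finally show ?thesis
    using assms(1) by simp
qed

lemma mmul_proj_basis:
  assumes "c < d" "s < d"
  shows "mmul d (mmul d A (proj d (basis_vec c))) B s s = A s c * B c s"
proof -
  have "mmul d A (proj d (basis_vec c)) s k = (if k = c then A s c else 0)" if "k < d" for k
  proof -
    have "(\<Sum>l<d. A s l * proj d (basis_vec c) l k) = (\<Sum>l<d. if l = c then (if k = c then A s c else 0) else 0)"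
      using assms that by (intro sum.cong) (auto simp: proj_def basis_vec_def)
    then show ?thesis
      using assms that by (simp add: mmul_def)
  qed
  then have "mmul d (mmul d A (proj d (basis_vec c))) B s s = (\<Sum>k<d. if k = c then A s c * B c s else 0)"
    using assms by (simp add: mmul_def[of d _ B] mult_delta_left cong: if_cong)
  then show ?thesis
    using assms by simp
qed

text \<open>The orthogonal channel is written with the transpose; real entries turn its square into
  a squared modulus.\<close>

lemma class_channel_basis:
  assumes M: "M \<in> class_group k d" and c: "c < d" "s < d"
  shows "Re (class_channel k d M (proj d (basis_vec c)) s s) = (cmod (M s c))\<^sup>2"
proof -
  have sq: "Re (M s c * cnj (M s c)) = (cmod (M s c))\<^sup>2"
    by (simp only: complex_norm_square[symmetric] Re_complex_of_real)
  show ?thesis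
  proof (cases k)
    case OrthogonalC
    then have "cnj (M s c) = M s c"
      using M c trivial_sign.real_formD[of M d s c] by (simp add: class_group_def orthogonal_group_eq)
    then show ?thesis
      using sq c unfolding OrthogonalC class_channel_def group_class.case
      by (simp only: mmul_proj_basis mtransp_def simp_thms if_True)
  qed (use sq c in \<open>simp_all only: class_channel_def group_class.case mmul_proj_basis madj_def simp_thms if_True\<close>)
qed

lemma collision_succ:
  assumes "M \<in> class_group k (2 ^ n)" "h < 2 ^ n"
  shows "succ n (class_channel k (2 ^ n) M) (collision_learner (2 ^ n) h B) k' r t hist
    = run (\<lambda>t s. (cmod (M s (input_col h B t)))\<^sup>2) (2 ^ n)
        (\<lambda>hist. of_bool (answer (collision_learner (2 ^ n) h B) r hist = k')) t hist"
proof (induction t arbitrary: hist)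
  case (Suc t)
  have len: "length (povm (collision_learner (2 ^ n) h B) r hist) = 2 ^ n"
    by (simp add: collision_learner_def)
  have c: "input_col h B (length hist) < 2 ^ n"
    using assms(2) by (simp add: input_col_def)
  show ?case
    unfolding succ.simps run.simps Suc.IH len
    using collision_round_prob[OF _ c] class_channel_basis[OF assms(1) c]
    by (intro sum.cong) auto
qed simp

lemma collision_success_prob:
  assumes "M \<in> class_group k (2 ^ n)" "h < 2 ^ n"
  shows "success_prob n (class_channel k (2 ^ n) M) (collision_learner (2 ^ n) h B) k' T
    = run (\<lambda>t s. (cmod (M s (input_col h B t)))\<^sup>2) (2 ^ n)
        (\<lambda>hist. of_bool (answer (collision_learner (2 ^ n) h B) 0 hist = k')) T []"
  unfolding success_prob_def collision_succ[OF assms] by (simp add: collision_learner_def)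

text \<open>Chebyshev in pointwise form: a wrong answer puts some count at least 50 away from its
  target, where the squared deviation over 50^2 = 2500 is at least 1. Afterwards only monotonicity
  and linearity of expectations are used.\<close>

lemma answer_bounds:
  fixes h B :: nat and hist :: "nat list"
  defines "X \<equiv> block_count (equal_event B) (2 * B) hist" and "Y \<equiv> block_count (partner_event h B) (2 * B) hist"
  shows "of_bool (answer (collision_learner D h B) r hist = OrthogonalC) \<ge> 1 - (X - 300)\<^sup>2 / 2500"
    and "of_bool (answer (collision_learner D h B) r hist = SymplecticC) \<ge> 1 - (X - 200)\<^sup>2 / 2500 - (Y - 200)\<^sup>2 / 2500"
    and "of_bool (answer (collision_learner D h B) r hist = UnitaryC) \<ge> 1 - (X - 200)\<^sup>2 / 2500 - (Y - 100)\<^sup>2 / 2500"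
proof -
  have far: "1 \<le> (t - a)\<^sup>2 / 2500" if "\<bar>t - a\<bar> \<ge> 50" for t a :: real
  proof -
    have "50\<^sup>2 \<le> \<bar>t - a\<bar>\<^sup>2"
      using that by (intro power_mono) auto
    then show ?thesis by simp
  qed
  have ans: "answer (collision_learner D h B) r hist
      = (if X \<ge> 250 then OrthogonalC else if Y \<ge> 150 then SymplecticC else UnitaryC)"
    by (simp add: collision_learner_def X_def Y_def)
  define u where "u a = (X - a)\<^sup>2 / 2500" for a
  define v where "v a = (Y - a)\<^sup>2 / 2500" for a
  have uv: "0 \<le> u a" "0 \<le> v a" "\<bar>X - a\<bar> \<ge> 50 \<Longrightarrow> 1 \<le> u a" "\<bar>Y - a\<bar> \<ge> 50 \<Longrightarrow> 1 \<le> v a" for a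
    using far[of X a] far[of Y a] by (simp_all add: u_def v_def)
  show "of_bool (answer (collision_learner D h B) r hist = OrthogonalC) \<ge> 1 - (X - 300)\<^sup>2 / 2500"
    unfolding ans u_def[symmetric] using uv[of 300] by auto
  show "of_bool (answer (collision_learner D h B) r hist = SymplecticC) \<ge> 1 - (X - 200)\<^sup>2 / 2500 - (Y - 200)\<^sup>2 / 2500"
    unfolding ans u_def[symmetric] v_def[symmetric] using uv[of 200] by auto
  show "of_bool (answer (collision_learner D h B) r hist = UnitaryC) \<ge> 1 - (X - 200)\<^sup>2 / 2500 - (Y - 100)\<^sup>2 / 2500"
    unfolding ans u_def[symmetric] v_def[symmetric] using uv[of 200] uv[of 100] by auto
qed

section \<open>Averaging the success probability over the group\<close>

context haar_matrices
begin

lemma bm_run: "bm (\<lambda>x. run (\<lambda>t s. P (c t) s x) D f t hist)"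
proof (induction t arbitrary: hist)
  case (Suc t)
  show ?case
    unfolding run.simps by (intro bm_sum bm_mult bm_P Suc.IH)
qed (simp add: bm_const)

end

context rotor_invariant
begin

definition overlap :: "cmat \<Rightarrow> real" where
  "overlap x = (\<Sum>i<d. P 0 i x * P h (partner h i) x)"

definition weight :: "nat \<Rightarrow> cmat \<Rightarrow> nat \<Rightarrow> nat \<Rightarrow> real" where
  "weight B x = (\<lambda>t s. P (input_col h B t) s x)"

lemma columns: "0 < d" "h < d"
  using d_eq h_ge by auto

lemma input_col_less: "input_col h B t < d"
  using columns by (simp add: input_col_def)

lemma weight_sum: "x \<in> G \<Longrightarrow> (\<Sum>s<d. weight B x t s) = 1"
  unfolding weight_def using input_col_less by (rule sum_P[rotated])

lemma weight_nonneg: "0 \<le> weight B x t s"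
  by (simp add: weight_def P_nonneg)

lemma sum_block_prob_equal:
  "(\<Sum>j<2 * B. block_prob (weight B x) d (equal_event B) j) = real B * F 0 x"
proof -
  have "block_prob (weight B x) d (equal_event B) j = (if j < B then F 0 x else 0)" for j
  proof (cases "j < B")
    case True
    have "(\<Sum>s'<d. weight B x (2 * j) s * weight B x (2 * j + 1) s' * of_bool (equal_event B j s s'))
      = (\<Sum>s'<d. if s' = s then (P 0 s x)\<^sup>2 else 0)" for s
      using True by (intro sum.cong) (auto simp: equal_event_def weight_def input_col_def power2_eq_square)
    then show ?thesis
      using True by (simp add: block_prob_def F_def)
  qed (simp add: block_prob_def equal_event_def)
  moreover have "{..<2 * B} \<inter> {j. j < B} = {..<B}"
    by auto
  ultimately show ?thesis
    by (simp add: sum.If_cases)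
qed

lemma sum_block_prob_partner:
  "(\<Sum>j<2 * B. block_prob (weight B x) d (partner_event h B) j) = real B * overlap x"
proof -
  have "block_prob (weight B x) d (partner_event h B) j = (if j < B then 0 else overlap x)" for j
  proof (cases "j < B")
    case False
    have "(\<Sum>s'<d. weight B x (2 * j) s * weight B x (2 * j + 1) s' * of_bool (partner_event h B j s s'))
      = (\<Sum>s'<d. if s' = partner h s then P 0 s x * P h (partner h s) x else 0)" for s
      using False by (intro sum.cong) (auto simp: partner_event_def weight_def input_col_def)
    then show ?thesis
      using False partner_d(1) by (simp add: block_prob_def overlap_def)
  qed (simp add: block_prob_def partner_event_def)
  moreover have "{..<2 * B} \<inter> - {j. j < B} = {B..<2 * B}"
    by auto
  ultimately show ?thesis
    by (simp add: sum.If_cases)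
qed

text \<open>With \<open>B = 100 d\<close> blocks the counts concentrate at 100 times the normalised collision
  probabilities \<open>u = d F\<close> and \<open>u = d overlap\<close>, with Poisson-like fluctuations; the last step bounds
  the variance \<open>100 u\<close> by the squared deviation.\<close>

lemma run_count_le:
  assumes x: "x \<in> G" and sum: "(\<Sum>j<2 * (100 * d). block_prob (weight (100 * d) x) d R j) = real (100 * d) * f"
  shows "run (weight (100 * d) x) d (\<lambda>hist. (block_count R (2 * (100 * d)) hist - 100 * \<mu>)\<^sup>2 / 2500) (2 * (2 * (100 * d))) []
    \<le> (201 / 50) * (real d * f - \<mu>)\<^sup>2 + (\<mu> + 1 / 2) / 25"
proof -
  define u where "u = real d * f"
  have "run (weight (100 * d) x) d (\<lambda>hist. (block_count R (2 * (100 * d)) hist - 100 * \<mu>)\<^sup>2 / 2500) (2 * (2 * (100 * d))) []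
    = (1 / 2500) * run (weight (100 * d) x) d (\<lambda>hist. (block_count R (2 * (100 * d)) hist - 100 * \<mu>)\<^sup>2) (2 * (2 * (100 * d))) []"
    by (simp flip: run_cmult)
  also have "\<dots> \<le> (1 / 2500) * ((100 * u - 100 * \<mu>)\<^sup>2 + 100 * u)"
    using run_block_count_square_le[where w = "weight (100 * d) x" and D = d and R = R and J = "2 * (100 * d)"
        and a = "100 * \<mu>", OF weight_sum[OF x]] sum
    by (intro mult_left_mono) (simp_all add: u_def mult_ac)
  also have "\<dots> = 4 * (u - \<mu>)\<^sup>2 + u / 25"
    by (simp add: power2_eq_square field_simps)
  also have "\<dots> \<le> 4 * (u - \<mu>)\<^sup>2 + (\<mu> + 1 / 2 + (u - \<mu>)\<^sup>2 / 2) / 25"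
  proof (intro add_left_mono divide_right_mono)
    show "u \<le> \<mu> + 1 / 2 + (u - \<mu>)\<^sup>2 / 2"
      using zero_le_power2[of "u - \<mu> - 1"] by (simp add: power2_eq_square field_simps)
  qed simp
  also have "\<dots> = (201 / 50) * (u - \<mu>)\<^sup>2 + (\<mu> + 1 / 2) / 25"
    by (simp add: field_simps)
  finally show ?thesis
    unfolding u_def .
qed

lemma E_affine_square:
  assumes "bm f" "expectation (\<lambda>x. (real d * f x - \<mu>)\<^sup>2) \<le> 1 / 100"
  shows "expectation (\<lambda>x. (201 / 50) * (real d * f x - \<mu>)\<^sup>2 + (\<mu> + 1 / 2) / 25) \<le> 201 / 5000 + (\<mu> + 1 / 2) / 25"
proof -
  have "expectation (\<lambda>x. (201 / 50) * (real d * f x - \<mu>)\<^sup>2 + (\<mu> + 1 / 2) / 25)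
    = (201 / 50) * expectation (\<lambda>x. (real d * f x - \<mu>)\<^sup>2) + (\<mu> + 1 / 2) / 25"
    by (subst E_add, (intro bm_intros assms(1))+) (simp add: prob_space)
  then show ?thesis
    using assms(2) by simp
qed

lemma bm_partner_overlap: "bm overlap"
  unfolding overlap_def[abs_def] by (intro bm_intros)

text \<open>The orthogonal case, decided by one count: with \<mu> \<le> 3 the failure bound is at
  most 0.0402 + 0.14, well below 1/3.\<close>

lemma expectation_run_ge:
  assumes g: "\<And>hist. g hist \<ge> 1 - (block_count (equal_event (100 * d)) (2 * (100 * d)) hist - 100 * \<mu>)\<^sup>2 / 2500"
    and \<mu>: "\<mu> \<le> 3"
    and dev: "expectation (\<lambda>x. (real d * F 0 x - \<mu>)\<^sup>2) \<le> 1 / 100"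
  shows "expectation (\<lambda>x. run (weight (100 * d) x) d g (2 * (2 * (100 * d))) []) \<ge> 2 / 3"
proof -
  let ?T = "2 * (2 * (100 * d))"
  let ?A = "\<lambda>hist. (block_count (equal_event (100 * d)) (2 * (100 * d)) hist - 100 * \<mu>)\<^sup>2 / 2500"
  have "run (weight (100 * d) x) d g ?T [] \<ge> 1 - ((201 / 50) * (real d * F 0 x - \<mu>)\<^sup>2 + (\<mu> + 1 / 2) / 25)"
    if x: "x \<in> G" for x
  proof -
    have "1 = run (weight (100 * d) x) d (\<lambda>hist. 1) ?T []"
      by (simp only: run_const[OF weight_sum[OF x]])
    also have "\<dots> \<le> run (weight (100 * d) x) d (\<lambda>hist. g hist + ?A hist) ?T []"
      by (rule run_mono[OF weight_nonneg]) (use g in \<open>simp add: algebra_simps\<close>)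
    finally show ?thesis
      using run_count_le[OF x sum_block_prob_equal, of \<mu>] by (simp add: run_add)
  qed
  then have "expectation (\<lambda>x. run (weight (100 * d) x) d g ?T [])
    \<ge> expectation (\<lambda>x. 1 - ((201 / 50) * (real d * F 0 x - \<mu>)\<^sup>2 + (\<mu> + 1 / 2) / 25))"
    by (intro E_mono) (intro bm_intros bm_F bm_run[folded weight_def] | simp add: weight_def bm_run)+
  also have "expectation (\<lambda>x. 1 - ((201 / 50) * (real d * F 0 x - \<mu>)\<^sup>2 + (\<mu> + 1 / 2) / 25))
    = 1 - expectation (\<lambda>x. (201 / 50) * (real d * F 0 x - \<mu>)\<^sup>2 + (\<mu> + 1 / 2) / 25)"
    by (subst E_diff) (intro bm_intros bm_F | simp add: prob_space)+
  also have "\<dots> \<ge> 1 - (201 / 5000 + (\<mu> + 1 / 2) / 25)"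
    by (intro diff_left_mono E_affine_square bm_F dev)
  finally have "1 - (201 / 5000 + (\<mu> + 1 / 2) / 25) \<le> expectation (\<lambda>x. run (weight (100 * d) x) d g ?T [])" .
  then show ?thesis
    by (rule order_trans[rotated]) (use \<mu> in \<open>simp add: field_simps\<close>)
qed

text \<open>The other two cases, where both counts must be right: the failure bound is at most
  0.0804 + 0.2, since \<mu> + \<mu>' \<le> 4.\<close>

lemma expectation_run_two_ge:
  assumes g: "\<And>hist. g hist \<ge> 1 - (block_count (equal_event (100 * d)) (2 * (100 * d)) hist - 100 * \<mu>)\<^sup>2 / 2500
      - (block_count (partner_event h (100 * d)) (2 * (100 * d)) hist - 100 * \<mu>')\<^sup>2 / 2500"
    and \<mu>: "\<mu> + \<mu>' \<le> 4"
    and dev: "expectation (\<lambda>x. (real d * F 0 x - \<mu>)\<^sup>2) \<le> 1 / 100"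
    and dev': "expectation (\<lambda>x. (real d * overlap x - \<mu>')\<^sup>2) \<le> 1 / 100"
  shows "expectation (\<lambda>x. run (weight (100 * d) x) d g (2 * (2 * (100 * d))) []) \<ge> 2 / 3"
proof -
  let ?T = "2 * (2 * (100 * d))"
  let ?A = "\<lambda>hist. (block_count (equal_event (100 * d)) (2 * (100 * d)) hist - 100 * \<mu>)\<^sup>2 / 2500"
  let ?B = "\<lambda>hist. (block_count (partner_event h (100 * d)) (2 * (100 * d)) hist - 100 * \<mu>')\<^sup>2 / 2500"
  have "run (weight (100 * d) x) d g ?T [] \<ge> 1 - ((201 / 50) * (real d * F 0 x - \<mu>)\<^sup>2 + (\<mu> + 1 / 2) / 25)
      - ((201 / 50) * (real d * overlap x - \<mu>')\<^sup>2 + (\<mu>' + 1 / 2) / 25)"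
    if x: "x \<in> G" for x
  proof -
    have "1 = run (weight (100 * d) x) d (\<lambda>hist. 1) ?T []"
      by (simp only: run_const[OF weight_sum[OF x]])
    also have "\<dots> \<le> run (weight (100 * d) x) d (\<lambda>hist. g hist + (?A hist + ?B hist)) ?T []"
      by (rule run_mono[OF weight_nonneg]) (use g in \<open>simp add: algebra_simps\<close>)
    finally show ?thesis
      using run_count_le[OF x sum_block_prob_equal, of \<mu>] run_count_le[OF x sum_block_prob_partner, of \<mu>']
      by (simp add: run_add)
  qed
  then have "expectation (\<lambda>x. run (weight (100 * d) x) d g ?T [])
    \<ge> expectation (\<lambda>x. 1 - ((201 / 50) * (real d * F 0 x - \<mu>)\<^sup>2 + (\<mu> + 1 / 2) / 25)
      - ((201 / 50) * (real d * overlap x - \<mu>')\<^sup>2 + (\<mu>' + 1 / 2) / 25))"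
    by (intro E_mono) (intro bm_intros bm_F bm_partner_overlap | simp add: weight_def bm_run)+
  also have "expectation (\<lambda>x. 1 - ((201 / 50) * (real d * F 0 x - \<mu>)\<^sup>2 + (\<mu> + 1 / 2) / 25)
      - ((201 / 50) * (real d * overlap x - \<mu>')\<^sup>2 + (\<mu>' + 1 / 2) / 25))
    = 1 - expectation (\<lambda>x. (201 / 50) * (real d * F 0 x - \<mu>)\<^sup>2 + (\<mu> + 1 / 2) / 25)
      - expectation (\<lambda>x. (201 / 50) * (real d * overlap x - \<mu>')\<^sup>2 + (\<mu>' + 1 / 2) / 25)"
    by (subst E_diff, (intro bm_intros bm_F bm_partner_overlap)+)+ (simp add: prob_space)
  also have "\<dots> \<ge> 1 - (201 / 5000 + (\<mu> + 1 / 2) / 25) - (201 / 5000 + (\<mu>' + 1 / 2) / 25)"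
    by (intro diff_mono order_refl E_affine_square bm_F dev bm_partner_overlap dev')
  finally have "1 - (201 / 5000 + (\<mu> + 1 / 2) / 25) - (201 / 5000 + (\<mu>' + 1 / 2) / 25)
    \<le> expectation (\<lambda>x. run (weight (100 * d) x) d g ?T [])" .
  then show ?thesis
    by (rule order_trans[rotated]) (use \<mu> in \<open>simp add: field_simps\<close>)
qed

end

section \<open>Vanishing errors and the three cases\<close>

definition column_error :: "real \<Rightarrow> real \<Rightarrow> real" where
  "column_error \<kappa> d = d\<^sup>2 * (\<kappa>\<^sup>2 / ((d - 4) * (d - 6)) + 270 / (d - 2) ^ 3)
      - 2 * \<kappa> * d * (\<kappa> / (d - 2 + 2 * \<kappa>)) + \<kappa>\<^sup>2"

definition overlap_error :: "real \<Rightarrow> real" where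
  "overlap_error d = d\<^sup>2 * (1 / ((d - 2) * (d - 3)) + 270 / (d - 2) ^ 3)
      - 2 * d * ((1 - 3 / (d - 2)) / (d - 1)) + 1"

text \<open>The errors are rational functions of d whose leading terms cancel. The bound n \<ge> 3
  ensures d \<ge> 8, so that h \<ge> 4 and d - 6 > 0.\<close>

lemma errors_small:
  "\<exists>N. \<forall>n\<ge>N. n \<ge> 3 \<and> column_error 2 (2 ^ n) \<le> 1 / 100 \<and> column_error 3 (2 ^ n) \<le> 1 / 100
    \<and> overlap_error (2 ^ n) \<le> 1 / 100"
proof -
  have ev: "eventually (\<lambda>d. f d < 1 / 100) at_top" if "(f \<longlongrightarrow> 0) at_top" for f :: "real \<Rightarrow> real"
    by (rule order_tendstoD(2)[OF that]) simp
  have "eventually (\<lambda>d. column_error 2 d < 1 / 100) at_top" "eventually (\<lambda>d. column_error 3 d < 1 / 100) at_top"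
    "eventually (\<lambda>d. overlap_error d < 1 / 100) at_top"
    unfolding column_error_def overlap_error_def by (rule ev, real_asymp)+
  moreover have "filterlim (\<lambda>n. 2 ^ n :: real) at_top sequentially"
    by real_asymp
  ultimately have "eventually (\<lambda>n. column_error 2 (2 ^ n) < 1 / 100) sequentially"
    "eventually (\<lambda>n. column_error 3 (2 ^ n) < 1 / 100) sequentially"
    "eventually (\<lambda>n. overlap_error (2 ^ n) < 1 / 100) sequentially"
    using eventually_compose_filterlim by blast+
  then have "eventually (\<lambda>n. n \<ge> 3 \<and> column_error 2 (2 ^ n) \<le> 1 / 100 \<and> column_error 3 (2 ^ n) \<le> 1 / 100
    \<and> overlap_error (2 ^ n) \<le> 1 / 100) sequentially"
    using eventually_ge_at_top[of "3 :: nat"] by eventually_elim auto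
  then show ?thesis
    unfolding eventually_sequentially .
qed

lemma rotor_i_symplectic:
  assumes "i < 2 * h" "j < 2 * h" "j \<noteq> i" "j \<noteq> partner h i"
  shows "rotor h 1 i j \<in> symplectic_group (2 * h)" "rotor h \<i> i j \<in> symplectic_group (2 * h)"
  using assms by (auto intro!: rotor_symplectic)

lemma rotor_invariant_orthogonal:
  assumes "h \<ge> 4"
  shows "rotor_invariant (2 * h) (orthogonal_group (2 * h)) (haar (2 * h) (orthogonal_group (2 * h))) h 3"
proof -
  interpret matrix_group "2 * h" "orthogonal_group (2 * h)"
    by (rule matrix_group_orthogonal)
  show ?thesis
  proof
    show "is_haar_measure (2 * h) (orthogonal_group (2 * h)) (haar (2 * h) (orthogonal_group (2 * h)))"
      by (rule is_haar_measure_haar)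
    show "rotor h 1 i j \<in> orthogonal_group (2 * h)"
      if "i < 2 * h" "j < 2 * h" "j \<noteq> i" "j \<noteq> partner h i" for i j
      using that by (intro rotor_orthogonal) auto
    have "\<forall>x\<in>orthogonal_group (2 * h). \<forall>a<2 * h. \<forall>b<2 * h. cnj (x a b) = x a b"
      unfolding orthogonal_group_eq using trivial_sign.real_formD by fastforce
    then show "((3 :: real) = 3 \<and> (\<forall>x\<in>orthogonal_group (2 * h). \<forall>a<2 * h. \<forall>b<2 * h. cnj (x a b) = x a b)) \<or>
      ((3 :: real) = 2 \<and> (\<forall>i<2 * h. \<forall>j<2 * h. j \<noteq> i \<longrightarrow> j \<noteq> partner h i \<longrightarrow> rotor h \<i> i j \<in> orthogonal_group (2 * h)))"
      by simp
  qed (use assms in simp_all)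
qed

lemma rotor_invariant_symplectic:
  assumes "h \<ge> 4"
  shows "rotor_invariant (2 * h) (symplectic_group (2 * h)) (haar (2 * h) (symplectic_group (2 * h))) h 2"
proof -
  interpret matrix_group "2 * h" "symplectic_group (2 * h)"
    by (rule matrix_group_symplectic)
  show ?thesis
    by unfold_locales (use assms is_haar_measure_haar rotor_i_symplectic in auto)
qed

lemma rotor_invariant_unitary:
  assumes "h \<ge> 4"
  shows "rotor_invariant (2 * h) (unitary_group (2 * h)) (haar (2 * h) (unitary_group (2 * h))) h 2"
proof -
  interpret matrix_group "2 * h" "unitary_group (2 * h)"
    by (rule matrix_group_unitary)
  have "rotor h 1 i j \<in> unitary_group (2 * h)" "rotor h \<i> i j \<in> unitary_group (2 * h)"
    if "i < 2 * h" "j < 2 * h" "j \<noteq> i" "j \<noteq> partner h i" for i j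
    using rotor_i_symplectic[OF that] by (auto simp: symplectic_group_def)
  then show ?thesis
    by unfold_locales (use assms is_haar_measure_haar in auto)
qed

text \<open>For b = 0 the partner column is column h, which is why the learner probes that
  column.\<close>

lemma symplectic_partner_entry:
  assumes S: "S \<in> symplectic_group (2 * h)" and ab: "a < 2 * h" "b < 2 * h"
  shows "cmod (S (partner h a) (partner h b)) = cmod (S a b)"
  using half_sign.real_formD[OF S[unfolded symplectic_group_eq] ab]
  by (simp add: norm_mult half_sign_def)

lemma collision_learner_success:
  fixes n h :: nat
  assumes d: "2 ^ n = 2 * h" and h: "h \<ge> 4"
    and small: "column_error 2 (2 ^ n) \<le> 1 / 100" "column_error 3 (2 ^ n) \<le> 1 / 100" "overlap_error (2 ^ n) \<le> 1 / 100"
  shows "(\<integral>M. success_prob n (class_channel k (2 ^ n) M) (collision_learner (2 ^ n) h (100 * 2 ^ n)) k (2 * (2 * (100 * 2 ^ n)))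
    \<partial>(haar (2 ^ n) (class_group k (2 ^ n)))) \<ge> 2 / 3"
proof -
  let ?L = "collision_learner (2 ^ n) h (100 * 2 ^ n)"
  let ?g = "\<lambda>hist. of_bool (answer ?L 0 hist = k) :: real"
  have hn: "h < 2 ^ n"
    using d h by simp
  have rd: "real (2 ^ n) = 2 ^ n"
    by simp
  have reduce: "(\<integral>M. success_prob n (class_channel k (2 ^ n) M) ?L k T \<partial>(haar (2 ^ n) (class_group k (2 ^ n))))
      = (\<integral>M. run (rotor_invariant.weight h (100 * 2 ^ n) M) (2 ^ n) ?g T [] \<partial>(haar (2 ^ n) (class_group k (2 ^ n))))"
    if inv: "rotor_invariant (2 ^ n) (class_group k (2 ^ n)) (haar (2 ^ n) (class_group k (2 ^ n))) h \<kappa>" for \<kappa> T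
  proof -
    interpret rotor_invariant "2 ^ n" "class_group k (2 ^ n)" "haar (2 ^ n) (class_group k (2 ^ n))" h \<kappa>
      by (rule inv)
    show ?thesis
      by (rule E_cong) (simp add: collision_success_prob[OF _ hn] weight_def P_def)
  qed
  show ?thesis
  proof (cases k)
    case OrthogonalC
    have inv: "rotor_invariant (2 ^ n) (class_group k (2 ^ n)) (haar (2 ^ n) (class_group k (2 ^ n))) h 3"
      using rotor_invariant_orthogonal[OF h] by (simp add: OrthogonalC class_group_def d)
    interpret rotor_invariant "2 ^ n" "class_group k (2 ^ n)" "haar (2 ^ n) (class_group k (2 ^ n))" h 3
      by (rule inv)
    show ?thesis
      unfolding reduce[OF inv]
    proof (rule expectation_run_ge)
      show "?g hist \<ge> 1 - (block_count (equal_event (100 * 2 ^ n)) (2 * (100 * 2 ^ n)) hist - 100 * 3)\<^sup>2 / 2500" for hist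
        using answer_bounds(1)[of "100 * 2 ^ n" hist "2 ^ n" h 0] by (simp add: OrthogonalC)
      show "expectation (\<lambda>x. (real (2 ^ n) * F 0 x - 3)\<^sup>2) \<le> 1 / 100"
        using E_F_deviation[OF columns(1)] small(2) unfolding column_error_def rd by linarith
    qed simp_all
  next
    case SymplecticC
    have inv: "rotor_invariant (2 ^ n) (class_group k (2 ^ n)) (haar (2 ^ n) (class_group k (2 ^ n))) h 2"
      using rotor_invariant_symplectic[OF h] by (simp add: SymplecticC class_group_def d)
    interpret rotor_invariant "2 ^ n" "class_group k (2 ^ n)" "haar (2 ^ n) (class_group k (2 ^ n))" h 2
      by (rule inv)
    have dev: "expectation (\<lambda>x. (real (2 ^ n) * F 0 x - 2)\<^sup>2) \<le> 1 / 100"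
      using E_F_deviation[OF columns(1)] small(1) unfolding column_error_def rd by linarith
    \<comment> \<open>In the symplectic case column h is column 0 with its halves swapped, up to
      phases, so the overlap is the collision probability and inherits its deviation bound.\<close>
    have ov: "overlap x = F 0 x" if x: "x \<in> class_group k (2 ^ n)" for x
    proof -
      have "partner h 0 = h"
        using h by (simp add: partner_def)
      then have "P h (partner h i) x = P 0 i x" if "i < 2 ^ n" for i
        using symplectic_partner_entry[of x h i 0] x that d h
        by (simp add: P_def SymplecticC class_group_def)
      then show ?thesis
        unfolding overlap_def F_def by (intro sum.cong) (auto simp: power2_eq_square)
    qed
    show ?thesis
      unfolding reduce[OF inv]
    proof (rule expectation_run_two_ge)
      show "?g hist \<ge> 1 - (block_count (equal_event (100 * 2 ^ n)) (2 * (100 * 2 ^ n)) hist - 100 * 2)\<^sup>2 / 2500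
          - (block_count (partner_event h (100 * 2 ^ n)) (2 * (100 * 2 ^ n)) hist - 100 * 2)\<^sup>2 / 2500" for hist
        using answer_bounds(2)[of "100 * 2 ^ n" hist h "2 ^ n" 0] by (simp add: SymplecticC)
      have "expectation (\<lambda>x. (real (2 ^ n) * overlap x - 2)\<^sup>2) = expectation (\<lambda>x. (real (2 ^ n) * F 0 x - 2)\<^sup>2)"
        by (rule E_cong) (simp add: ov)
      with dev show "expectation (\<lambda>x. (real (2 ^ n) * overlap x - 2)\<^sup>2) \<le> 1 / 100"
        by simp
    qed (use dev in simp_all)
  next
    case UnitaryC
    have inv: "rotor_invariant (2 ^ n) (class_group k (2 ^ n)) (haar (2 ^ n) (class_group k (2 ^ n))) h 2"
      using rotor_invariant_unitary[OF h] by (simp add: UnitaryC class_group_def d)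
    interpret rotor_invariant "2 ^ n" "class_group k (2 ^ n)" "haar (2 ^ n) (class_group k (2 ^ n))" h 2
      by (rule inv)
    have dev: "expectation (\<lambda>x. (real (2 ^ n) * F 0 x - 2)\<^sup>2) \<le> 1 / 100"
      using E_F_deviation[OF columns(1)] small(1) unfolding column_error_def rd by linarith
    have trans: "transposition_mat (2 ^ n) i l \<in> class_group k (2 ^ n)" if "i < 2 ^ n" "l < 2 ^ n" "i \<noteq> l" for i l
      using transposition_mat_unitary[OF that] by (simp add: UnitaryC class_group_def)
    show ?thesis
      unfolding reduce[OF inv]
    proof (rule expectation_run_two_ge)
      show "?g hist \<ge> 1 - (block_count (equal_event (100 * 2 ^ n)) (2 * (100 * 2 ^ n)) hist - 100 * 2)\<^sup>2 / 2500
          - (block_count (partner_event h (100 * 2 ^ n)) (2 * (100 * 2 ^ n)) hist - 100 * 1)\<^sup>2 / 2500" for hist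
        using answer_bounds(3)[of "100 * 2 ^ n" hist h "2 ^ n" 0] by (simp add: UnitaryC)
      show "expectation (\<lambda>x. (real (2 ^ n) * overlap x - 1)\<^sup>2) \<le> 1 / 100"
        using E_overlap_deviation[OF columns trans] small(3)
        unfolding overlap_error_def overlap_def rd by linarith
    qed (use dev in simp_all)
  qed
qed

theorem mainTheorem19:
  "\<exists>c N. \<forall>n\<ge>N. \<exists>T L. valid_learner n L \<and> real T \<le> c * 2 ^ n \<and>
     (\<forall>k. (\<integral>M. success_prob n (class_channel k (2 ^ n) M) L k T
              \<partial>(haar (2 ^ n) (class_group k (2 ^ n)))) \<ge> 2 / 3)"
proof -
  obtain N where N: "\<And>n. n \<ge> N \<Longrightarrow> n \<ge> 3 \<and> column_error 2 (2 ^ n) \<le> 1 / 100 \<and> column_error 3 (2 ^ n) \<le> 1 / 100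
      \<and> overlap_error (2 ^ n) \<le> 1 / 100"
    using errors_small by blast
  \<comment> \<open>With B = 100 d there are 2 B = 200 d blocks of two rounds, hence T = 400
    d.\<close>
  have "valid_learner n (collision_learner (2 ^ n) (2 ^ (n - 1)) (100 * 2 ^ n))
      \<and> real (2 * (2 * (100 * 2 ^ n))) \<le> 400 * 2 ^ n
      \<and> (\<forall>k. (\<integral>M. success_prob n (class_channel k (2 ^ n) M)
              (collision_learner (2 ^ n) (2 ^ (n - 1)) (100 * 2 ^ n)) k (2 * (2 * (100 * 2 ^ n)))
            \<partial>(haar (2 ^ n) (class_group k (2 ^ n)))) \<ge> 2 / 3)" if n: "n \<ge> N" for n
  proof -
    have d: "2 ^ n = 2 * (2 ^ (n - 1) :: nat)"
      using N[OF n] by (simp flip: power_Suc)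
    have "(2 :: nat) ^ 2 \<le> 2 ^ (n - 1)"
      using N[OF n] by (intro power_increasing) auto
    then have h: "(4 :: nat) \<le> 2 ^ (n - 1)"
      by simp
    show ?thesis
    proof (intro conjI allI)
      show "valid_learner n (collision_learner (2 ^ n) (2 ^ (n - 1)) (100 * 2 ^ n))"
        using N[OF n] by (intro valid_collision_learner power_strict_increasing) auto
    qed (use collision_learner_success[OF d h] N[OF n] in auto)
  qed
  then show ?thesis
    by blast
qed

end
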